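(* For every $n\in\mathbb Z^+$, the Olshanski projection $\boldsymbol\mu_{n,n+1}:\boldsymbol\zeta(n+1)\to\boldsymbol\zeta(n)$ is the same map as $\boldsymbol\pi_{n,n+1}:\boldsymbol\zeta(n+1)\to\boldsymbol\zeta(n)$.
   Context: $\boldsymbol\zeta(n)$ is the center of $\mathbf U(gl(n))$ (over $\mathbb C$), $e_{i,j}$ the standard basis of $gl(n)$, and $gl(n)\subset gl(n+1)$ in the standard way. Capelli elements: for $k=1,\dots,n$, $\mathbf H_k(n)=\sum_{1\le i_1<\cdots<i_k\le n}\mathbf{cdet}[e_{i_r,i_s}+\delta_{rs}(k-s)]_{r,s=1}^k$, where $\mathbf{cdet}(A)=\sum_\sigma(-1)^{|\sigma|}a_{\sigma(1),1}a_{\sigma(2),2}\cdots a_{\sigma(k),k}$; $\mathbf H_1(n),\dots,\mathbf H_n(n)$ are algebraically independent generators of $\boldsymbol\zeta(n)$. $\boldsymbol\pi_{n,n+1}$ is the algebra epimorphism with $\boldsymbol\pi_{n,n+1}(\mathbf H_k(n+1))=\mathbf H_k(n)$ for $k=1,\dots,n$ and $\boldsymbol\pi_{n,n+1}(\mathbf H_{n+1}(n+1))=0$. Olshanski projection: let $\mathbf U(gl(n+1))^0$ be the centralizer of $e_{n+1,n+1}$ in $\mathbf U(gl(n+1))$, $\mathcal I(n+1)$ the left ideal of $\mathbf U(gl(n+1))$ generated by $e_{i,n+1}$, $i=1,\dots,n+1$, and $\mathcal I(n+1)^0=\mathcal I(n+1)\cap\mathbf U(gl(n+1))^0$. Then $\mathcal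 I(n+1)^0$ is a two-sided ideal of $\mathbf U(gl(n+1))^0$ and $\mathbf U(gl(n+1))^0=\mathbf U(gl(n))\oplus\mathcal I(n+1)^0$. The projection $\mathbf U(gl(n+1))^0\to\mathbf U(gl(n))$ with kernel $\mathcal I(n+1)^0$ is an algebra epimorphism, and its restriction to $\boldsymbol\zeta(n+1)$ is $\boldsymbol\mu_{n,n+1}:\boldsymbol\zeta(n+1)\to\boldsymbol\zeta(n)$. *)

theory Defs
  imports Complex_Main "HOL-Library.FuncSet" "HOL-Combinatorics.Permutations"
    "HOL-Algebra.QuotRing"
begin

section \<open>Free associative algebras over the complex numbers\<close>

text \<open>
  The free unital associative algebra on a set \<open>S\<close> of letters: finitely supported functions from
  words to coefficients, multiplied by concatenation of words.
\<close>

definition free_algebra :: "'a set \<Rightarrow> ('a list \<Rightarrow> complex) ring" where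
  "free_algebra S = \<lparr>
     carrier = {f. finite {w. f w \<noteq> 0} \<and> {w. f w \<noteq> 0} \<subseteq> lists S},
     mult = (\<lambda>f g w. \<Sum>i\<le>length w. f (take i w) * g (drop i w)),
     one = (\<lambda>w. if w = [] then 1 else 0),
     zero = (\<lambda>w. 0),
     add = (\<lambda>f g w. f w + g w)\<rparr>"

definition word :: "'a list \<Rightarrow> 'a list \<Rightarrow> complex" where
  "word u = (\<lambda>w. if w = u then 1 else 0)"

lemma conv_support:
  fixes f g :: "'a list \<Rightarrow> complex"
  shows "{w. (\<Sum>i\<le>length w. f (take i w) * g (drop i w)) \<noteq> 0}
    \<subseteq> (\<lambda>(u, v). u @ v) ` ({w. f w \<noteq> 0} \<times> {w. g w \<noteq> 0})"
proof
  fix w assume "w \<in> {w. (\<Sum>i\<le>length w. f (take i w) * g (drop i w)) \<noteq> 0}"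
  then obtain i where "f (take i w) * g (drop i w) \<noteq> 0"
    by (metis (mono_tags, lifting) mem_Collect_eq sum.neutral)
  then show "w \<in> (\<lambda>(u, v). u @ v) ` ({w. f w \<noteq> 0} \<times> {w. g w \<noteq> 0})"
    by (intro image_eqI[of _ _ "(take i w, drop i w)"]) auto
qed

lemma conv_assoc:
  fixes f g h :: "'a list \<Rightarrow> complex"
  shows "(\<Sum>i\<le>length w. (\<Sum>j\<le>length (take i w). f (take j (take i w)) * g (drop j (take i w)))
            * h (drop i w))
       = (\<Sum>i\<le>length w. f (take i w) *
            (\<Sum>j\<le>length (drop i w). g (take j (drop i w)) * h (drop j (drop i w))))"
  (is "?l = ?r")
proof -
  define T where "T i j = f (take i w) * g (take j (drop i w)) * h (drop (i + j) w)" for i j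
  have "?l = (\<Sum>k\<le>length w. \<Sum>i\<le>k. T i (k - i))"
    by (intro sum.cong refl)
      (auto simp: T_def sum_distrib_right drop_take min_def intro!: sum.cong)
  also have "\<dots> = (\<Sum>(i, j)\<in>{(i, j). i + j \<le> length w}. T i j)"
    by (rule sum.triangle_reindex_eq[symmetric])
  also have "{(i, j). i + j \<le> length w} = Sigma {..length w} (\<lambda>i. {..length w - i})"
    by auto
  also have "(\<Sum>(i, j)\<in>\<dots>. T i j) = (\<Sum>i\<le>length w. \<Sum>j\<le>length w - i. T i j)"
    by (rule sum.Sigma[symmetric]) auto
  also have "\<dots> = ?r"
    by (intro sum.cong refl) (auto simp: T_def sum_distrib_left mult.assoc add.commute intro!: sum.cong)
  finally show ?thesis .
qed

lemma ring_free_algebra: "ring (free_algebra S)"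
proof (rule ringI)
  show "abelian_group (free_algebra S)"
  proof (rule abelian_groupI)
    fix x y assume "x \<in> carrier (free_algebra S)" "y \<in> carrier (free_algebra S)"
    moreover have "{w. x w + y w \<noteq> 0} \<subseteq> {w. x w \<noteq> 0} \<union> {w. y w \<noteq> 0}" by auto
    ultimately show "x \<oplus>\<^bsub>free_algebra S\<^esub> y \<in> carrier (free_algebra S)"
      unfolding free_algebra_def by (auto intro: finite_subset)
  next
    fix x assume "x \<in> carrier (free_algebra S)"
    then show "\<exists>y\<in>carrier (free_algebra S). y \<oplus>\<^bsub>free_algebra S\<^esub> x = \<zero>\<^bsub>free_algebra S\<^esub>"
      by (intro bexI[of _ "\<lambda>w. - x w"]) (auto simp: free_algebra_def)
  qed (auto simp: free_algebra_def algebra_simps)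
  show "monoid (free_algebra S)"
  proof (rule monoidI)
    fix x y assume xy: "x \<in> carrier (free_algebra S)" "y \<in> carrier (free_algebra S)"
    have fin: "finite ((\<lambda>(u, v). u @ v) ` ({w. x w \<noteq> 0} \<times> {w. y w \<noteq> 0}))"
      using xy by (simp add: free_algebra_def)
    have lis: "(\<lambda>(u, v). u @ v) ` ({w. x w \<noteq> 0} \<times> {w. y w \<noteq> 0}) \<subseteq> lists S"
    proof
      fix w assume "w \<in> (\<lambda>(u, v). u @ v) ` ({w. x w \<noteq> 0} \<times> {w. y w \<noteq> 0})"
      then obtain u v where uv: "w = u @ v" "u \<in> {w. x w \<noteq> 0}" "v \<in> {w. y w \<noteq> 0}"
        by (elim imageE SigmaE) simp
      have "u \<in> lists S" "v \<in> lists S"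
        using xy uv(2,3) unfolding free_algebra_def partial_object.simps by blast+
      then show "w \<in> lists S"
        unfolding uv(1) append_in_lists_conv by blast
    qed
    show "x \<otimes>\<^bsub>free_algebra S\<^esub> y \<in> carrier (free_algebra S)"
      using finite_subset[OF conv_support fin] subset_trans[OF conv_support lis]
      by (simp add: free_algebra_def)
  next
    fix x y z assume "x \<in> carrier (free_algebra S)"
    show "x \<otimes>\<^bsub>free_algebra S\<^esub> y \<otimes>\<^bsub>free_algebra S\<^esub> z =
      x \<otimes>\<^bsub>free_algebra S\<^esub> (y \<otimes>\<^bsub>free_algebra S\<^esub> z)"
      unfolding free_algebra_def by (simp only: monoid.simps conv_assoc)
  next
    fix x :: "'a list \<Rightarrow> complex"
    show "\<one>\<^bsub>free_algebra S\<^esub> \<otimes>\<^bsub>free_algebra S\<^esub> x = x"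
    proof
      fix w
      have "(\<Sum>i\<le>length w. (if take i w = [] then 1 else 0) * x (drop i w))
        = (\<Sum>i\<in>{0}. (if take i w = [] then 1 else 0) * x (drop i w))"
        by (rule sum.mono_neutral_right) auto
      then show "(\<one>\<^bsub>free_algebra S\<^esub> \<otimes>\<^bsub>free_algebra S\<^esub> x) w = x w"
        by (simp add: free_algebra_def)
    qed
    show "x \<otimes>\<^bsub>free_algebra S\<^esub> \<one>\<^bsub>free_algebra S\<^esub> = x"
    proof
      fix w
      have "(\<Sum>i\<le>length w. x (take i w) * (if drop i w = [] then 1 else 0))
        = (\<Sum>i\<in>{length w}. x (take i w) * (if drop i w = [] then 1 else 0))"
        by (rule sum.mono_neutral_right) auto
      then show "(x \<otimes>\<^bsub>free_algebra S\<^esub> \<one>\<^bsub>free_algebra S\<^esub>) w = x w"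
        by (simp add: free_algebra_def)
    qed
  next
    have "{w :: 'a list. w = []} = {[]}" by simp
    then show "\<one>\<^bsub>free_algebra S\<^esub> \<in> carrier (free_algebra S)"
      by (simp add: free_algebra_def)
  qed
  fix x y z :: "'a list \<Rightarrow> complex"
  show "(x \<oplus>\<^bsub>free_algebra S\<^esub> y) \<otimes>\<^bsub>free_algebra S\<^esub> z =
    x \<otimes>\<^bsub>free_algebra S\<^esub> z \<oplus>\<^bsub>free_algebra S\<^esub> y \<otimes>\<^bsub>free_algebra S\<^esub> z"
    by (simp add: free_algebra_def distrib_right sum.distrib)
  show "z \<otimes>\<^bsub>free_algebra S\<^esub> (x \<oplus>\<^bsub>free_algebra S\<^esub> y) =
    z \<otimes>\<^bsub>free_algebra S\<^esub> x \<oplus>\<^bsub>free_algebra S\<^esub> z \<otimes>\<^bsub>free_algebra S\<^esub> y"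
    by (simp add: free_algebra_def distrib_left sum.distrib)
qed


section \<open>The universal enveloping algebra of gl(n)\<close>

text \<open>
  A letter \<open>(i, j)\<close> with \<open>1 \<le> i, j \<le> n\<close> stands for the standard basis element of gl(n) with entry 1
  in row \<open>i\<close> and column \<open>j\<close>.  The relations are
  \<open>e\<^sub>i\<^sub>j e\<^sub>k\<^sub>l - e\<^sub>k\<^sub>l e\<^sub>i\<^sub>j = [e\<^sub>i\<^sub>j, e\<^sub>k\<^sub>l] = \<delta>\<^sub>j\<^sub>k e\<^sub>i\<^sub>l - \<delta>\<^sub>l\<^sub>i e\<^sub>k\<^sub>j\<close>.
\<close>

definition gl_letters :: "nat \<Rightarrow> (nat \<times> nat) set" where
  "gl_letters n = {1..n} \<times> {1..n}"

definition gl_relation :: "nat \<Rightarrow> nat \<Rightarrow> nat \<Rightarrow> nat \<Rightarrow> (nat \<times> nat) list \<Rightarrow> complex" where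
  "gl_relation i j k l = (\<lambda>w.
     word [(i, j), (k, l)] w - word [(k, l), (i, j)] w
     - ((if j = k then word [(i, l)] w else 0) - (if l = i then word [(k, j)] w else 0)))"

definition gl_ideal :: "nat \<Rightarrow> ((nat \<times> nat) list \<Rightarrow> complex) set" where
  "gl_ideal n = Idl\<^bsub>free_algebra (gl_letters n)\<^esub>
     {gl_relation i j k l | i j k l. (i, j) \<in> gl_letters n \<and> (k, l) \<in> gl_letters n}"

type_synonym U_elem = "((nat \<times> nat) list \<Rightarrow> complex) set"

definition U_gl :: "nat \<Rightarrow> U_elem ring" where
  "U_gl n = free_algebra (gl_letters n) Quot gl_ideal n"

definition U_smult :: "nat \<Rightarrow> complex \<Rightarrow> U_elem \<Rightarrow> U_elem" where
  "U_smult n c x =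
     (gl_ideal n +>\<^bsub>free_algebra (gl_letters n)\<^esub> (\<lambda>w. c * word [] w)) \<otimes>\<^bsub>U_gl n\<^esub> x"

definition gen :: "nat \<Rightarrow> nat \<Rightarrow> nat \<Rightarrow> U_elem" where
  "gen n i j = gl_ideal n +>\<^bsub>free_algebra (gl_letters n)\<^esub> word [(i, j)]"

text \<open>
  The map \<open>U(gl(n)) \<rightarrow> U(gl(n+1))\<close> induced by the standard inclusion of gl(n) in gl(n+1).  It sends
  the class of \<open>f\<close> modulo \<open>gl_ideal n\<close> to the class of \<open>f\<close> modulo \<open>gl_ideal (n + 1)\<close>; since
  \<open>gl_ideal n \<subseteq> gl_ideal (n + 1)\<close>, this is the following set sum.
\<close>

definition U_incl :: "nat \<Rightarrow> U_elem \<Rightarrow> U_elem" where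
  "U_incl n x = gl_ideal (n + 1) <+>\<^bsub>free_algebra (gl_letters (n + 1))\<^esub> x"

lemma gl_ideal_ideal: "ideal (gl_ideal n) (free_algebra (gl_letters n))"
proof -
  have supp: "w \<in> {[(i, j), (k, l)], [(k, l), (i, j)], [(i, l)], [(k, j)]}"
    if "gl_relation i j k l w \<noteq> 0" for i j k l w
  proof (rule ccontr)
    assume "w \<notin> {[(i, j), (k, l)], [(k, l), (i, j)], [(i, l)], [(k, j)]}"
    then have "word [(i, j), (k, l)] w = 0" "word [(k, l), (i, j)] w = 0"
      "word [(i, l)] w = 0" "word [(k, j)] w = 0"
      unfolding word_def insert_iff by argo+
    then show False
      using that unfolding gl_relation_def by (simp split: if_split_asm)
  qed
  have fin: "finite {w. gl_relation i j k l w \<noteq> 0}" for i j k l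
    by (rule finite_subset[of _ "{[(i, j), (k, l)], [(k, l), (i, j)], [(i, l)], [(k, j)]}"])
      (use supp in blast, simp)
  have lis: "w \<in> lists (gl_letters n)"
    if "gl_relation i j k l w \<noteq> 0" "(i, j) \<in> gl_letters n" "(k, l) \<in> gl_letters n" for i j k l w
    using supp[OF that(1)] that(2,3) by (elim insertE emptyE) (simp_all add: gl_letters_def)
  show ?thesis
    unfolding gl_ideal_def
  proof (intro ring.genideal_ideal ring_free_algebra subsetI)
    fix x assume "x \<in> {gl_relation i j k l | i j k l. (i, j) \<in> gl_letters n \<and> (k, l) \<in> gl_letters n}"
    then obtain i j k l
      where x: "x = gl_relation i j k l" "(i, j) \<in> gl_letters n" "(k, l) \<in> gl_letters n"
      by blast
    then show "x \<in> carrier (free_algebra (gl_letters n))"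
      using fin lis[OF _ x(2,3)] unfolding free_algebra_def x(1) partial_object.simps by blast
  qed
qed

lemma ring_U_gl: "ring (U_gl n)"
  unfolding U_gl_def by (rule ideal.quotient_is_ring[OF gl_ideal_ideal])


section \<open>Centralizers, centers and left ideals\<close>

definition centralizer :: "('a, 'b) ring_scheme \<Rightarrow> 'a set \<Rightarrow> 'a set" where
  "centralizer R X = {z \<in> carrier R. \<forall>x\<in>X. z \<otimes>\<^bsub>R\<^esub> x = x \<otimes>\<^bsub>R\<^esub> z}"

definition left_ideal :: "'a set \<Rightarrow> ('a, 'b) ring_scheme \<Rightarrow> bool" where
  "left_ideal L R \<longleftrightarrow>
     additive_subgroup L R \<and> (\<forall>a\<in>L. \<forall>x\<in>carrier R. x \<otimes>\<^bsub>R\<^esub> a \<in> L)"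

definition gen_left_ideal :: "('a, 'b) ring_scheme \<Rightarrow> 'a set \<Rightarrow> 'a set" where
  "gen_left_ideal R X = \<Inter>{L. left_ideal L R \<and> X \<subseteq> L}"

definition zeta :: "nat \<Rightarrow> U_elem set" where
  "zeta n = centralizer (U_gl n) (carrier (U_gl n))"


section \<open>Capelli elements\<close>

text \<open>
  The column determinant of the \<open>k \<times> k\<close> matrix with entries \<open>A r s\<close>, \<open>1 \<le> r, s \<le> k\<close>, over a ring
  that need not be commutative: the \<open>foldr\<close> is the product \<open>A (\<sigma> 1) 1 \<cdots> A (\<sigma> k) k\<close> in this order.
\<close>

definition cdet :: "('a, 'b) ring_scheme \<Rightarrow> nat \<Rightarrow> (nat \<Rightarrow> nat \<Rightarrow> 'a) \<Rightarrow> 'a" where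
  "cdet R k A = (\<Oplus>\<^bsub>R\<^esub>\<sigma>\<in>{\<sigma>. \<sigma> permutes {1..k}}.
     add_pow R (sign \<sigma>) (foldr (\<otimes>\<^bsub>R\<^esub>) (map (\<lambda>s. A (\<sigma> s) s) [1..<k + 1]) \<one>\<^bsub>R\<^esub>))"

text \<open>
  A sequence \<open>i\<^sub>1 < \<dots> < i\<^sub>k\<close> in \<open>{1..n}\<close> is given by the set \<open>I\<close> of its members; lists are indexed
  from 0, so \<open>i\<^sub>r\<close> is \<open>sorted_list_of_set I ! (r - 1)\<close>.
\<close>

definition Capelli :: "nat \<Rightarrow> nat \<Rightarrow> U_elem" where
  "Capelli k n = (\<Oplus>\<^bsub>U_gl n\<^esub>I\<in>{I. I \<subseteq> {1..n} \<and> card I = k}.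
     cdet (U_gl n) k (\<lambda>r s.
       gen n (sorted_list_of_set I ! (r - 1)) (sorted_list_of_set I ! (s - 1))
       \<oplus>\<^bsub>U_gl n\<^esub> (if r = s then add_pow (U_gl n) (int k - int s) \<one>\<^bsub>U_gl n\<^esub> else \<zero>\<^bsub>U_gl n\<^esub>)))"


section \<open>The two projections\<close>

definition zeta_epi :: "nat \<Rightarrow> (U_elem \<Rightarrow> U_elem) \<Rightarrow> bool" where
  "zeta_epi n f \<longleftrightarrow>
     f \<in> ring_hom (U_gl (n + 1)\<lparr>carrier := zeta (n + 1)\<rparr>) (U_gl n\<lparr>carrier := zeta n\<rparr>) \<and>
     (\<forall>c. \<forall>x\<in>zeta (n + 1). f (U_smult (n + 1) c x) = U_smult n c (f x)) \<and>
     f ` zeta (n + 1) = zeta n"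

text \<open>
  Maps with domain \<open>zeta (n + 1)\<close> are represented by extensional functions, so that equality of
  functions is equality of maps.
\<close>

definition capelli_proj :: "nat \<Rightarrow> U_elem \<Rightarrow> U_elem" where
  "capelli_proj n = (THE f. f \<in> extensional (zeta (n + 1)) \<and> zeta_epi n f \<and>
     (\<forall>k\<in>{1..n}. f (Capelli k (n + 1)) = Capelli k n) \<and>
     f (Capelli (n + 1) (n + 1)) = \<zero>\<^bsub>U_gl n\<^esub>)"

definition U0 :: "nat \<Rightarrow> U_elem set" where
  "U0 m = centralizer (U_gl m) {gen m m m}"

definition I0 :: "nat \<Rightarrow> U_elem set" where
  "I0 m = gen_left_ideal (U_gl m) {gen m i m | i. i \<in> {1..m}} \<inter> U0 m"

text \<open>
  The projection of \<open>U0 (n + 1) = U(gl(n)) \<oplus> I0 (n + 1)\<close> onto its first summand: the component of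
  \<open>x\<close> in \<open>U(gl(n))\<close> is the \<open>y\<close> that differs from \<open>x\<close> by an element of \<open>I0 (n + 1)\<close>.
\<close>

definition olshanski :: "nat \<Rightarrow> U_elem \<Rightarrow> U_elem" where
  "olshanski n = (\<lambda>x\<in>U0 (n + 1).
     THE y. y \<in> carrier (U_gl n) \<and> x \<ominus>\<^bsub>U_gl (n + 1)\<^esub> U_incl n y \<in> I0 (n + 1))"

definition olshanski_zeta :: "nat \<Rightarrow> U_elem \<Rightarrow> U_elem" where
  "olshanski_zeta n = restrict (olshanski n) (zeta (n + 1))"

end

theory Submission
  imports Defs "HOL-Library.Poly_Mapping" "HOL-Computational_Algebra.Polynomial"
begin

text \<open>
  Let \<open>e\<^sub>i\<^sub>j\<close> act on polynomials in matrix entries \<open>x\<^sub>i\<^sub>j\<close> by \<open>\<Sum>\<^sub>l x\<^sub>i\<^sub>l \<partial>/\<partial>x\<^sub>j\<^sub>l + x\<^sub>i\<^sub>j\<close>.  A word of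
  length \<open>d\<close> sends 1 to the corresponding monomial plus terms of degree less than \<open>d\<close>.  So evaluation
  at 1 identifies \<open>U(gl(n))\<close> with the polynomial ring as a filtered vector space, and
  \<open>U(gl(n))\<close> is realised faithfully as a ring of operators.

  The symbol of a central element is an ad-invariant polynomial on matrices.  An ad-invariant is
  determined by its restriction to diagonal matrices, which is symmetric, hence a polynomial in the
  elementary symmetric functions; these are the restricted symbols of the Capelli elements.
  Descending on the degree, the Capelli elements generate the centre, so a homomorphism on
  \<open>zeta (n + 1)\<close> is determined by its values on them.

  In a column determinant containing the index \<open>n + 1\<close> every product ends in some
  \<open>e\<^sub>i\<^sub>,\<^sub>n\<^sub>+\<^sub>1\<close>, so the k-th Capelli elements of gl(n+1) and gl(n) differ by an
  element of the left ideal.  Congruence modulo that ideal is multiplicative on central elements,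
  which extends the comparison to the whole centre.
\<close>


section \<open>Polynomials and derivations\<close>

text \<open>The quotient \<open>U_gl n\<close> offers no normal form to compute with; the operators
  supply one, because the value at the polynomial 1 already separates classes. Identities are
  therefore proved for operators, in a type of class \<open>ring_1\<close>, and pulled back by
  injectivity. Since a letter acts by the same operator for every n, elements of U(gl(n)) and
  U(gl(n+1)) can be subtracted there directly. For the centrality of the Capelli elements, sums over
  all index sequences are handier than sums over increasing ones: replacing one index usually
  destroys the order. The signs under permutations of rows and columns lead back to increasing
  sequences, up to the factor k!. The ideal of the comparison is only a left ideal. In aa' - bb' =
  (a - b)a' + b(a' - b') the first term belongs to it because the central a' can be moved to the
  left. Finally, \<open>capelli_proj\<close> is a \<open>THE\<close>. Existence is supplied by the
  Olshanski projection itself, once it is an epimorphism of the centres with the prescribed values;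
  uniqueness comes from generation.\<close>

type_synonym 'a mpoly = "'a multiset \<Rightarrow>\<^sub>0 complex"

abbreviation mlookup :: "'a mpoly \<Rightarrow> 'a multiset \<Rightarrow> complex" where
  "mlookup \<equiv> Poly_Mapping.lookup"

abbreviation mkeys :: "'a mpoly \<Rightarrow> 'a multiset set" where
  "mkeys \<equiv> Poly_Mapping.keys"

definition Const :: "complex \<Rightarrow> 'a mpoly" where
  "Const c = Poly_Mapping.single {#} c"

definition Var :: "'a \<Rightarrow> 'a mpoly" where
  "Var a = Poly_Mapping.single {#a#} 1"

lemma Const_simps [simp]:
  "Const 0 = 0" "Const 1 = 1" "Const (a + b) = Const a + Const b"
  "Const (a * b) = Const a * Const b" "Const (- a) = - Const a" "Const (a - b) = Const a - Const b"
  by (simp_all add: Const_def single_add single_uminus single_diff mult_single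
      flip: zero_multiset_def single_one)

lemma single_conv_Const: "Poly_Mapping.single m c = Const c * Poly_Mapping.single m 1"
  by (simp add: Const_def mult_single)

lemma single_add_mset:
  "Poly_Mapping.single (add_mset a m) 1 = (Var a * Poly_Mapping.single m 1 :: 'a mpoly)"
  by (simp add: Var_def mult_single)

lemma mpoly_sum_single: "p = (\<Sum>m\<in>mkeys p. Poly_Mapping.single m (mlookup p m))"
  by (rule poly_mapping_eqI) (simp add: lookup_sum lookup_single when_def in_keys_iff)

lemma mpoly_linear_induct [case_names zero single add]:
  fixes p :: "'a mpoly"
  assumes "P 0" and "\<And>m c. P (Poly_Mapping.single m c)" and "\<And>p q. P p \<Longrightarrow> P q \<Longrightarrow> P (p + q)"
  shows "P p"
proof -
  have "P (\<Sum>m\<in>M. Poly_Mapping.single m (mlookup p m))" if "finite M" for M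
    using that by induction (auto intro: assms)
  then show ?thesis
    using mpoly_sum_single[of p] by (metis finite_keys)
qed

lemma mpoly_induct [case_names Const Var add mult]:
  fixes p :: "'a mpoly"
  assumes C: "\<And>c. P (Const c)" and V: "\<And>a. P (Var a)"
    and A: "\<And>p q. P p \<Longrightarrow> P q \<Longrightarrow> P (p + q)" and M: "\<And>p q. P p \<Longrightarrow> P q \<Longrightarrow> P (p * q)"
  shows "P p"
proof (induction p rule: mpoly_linear_induct)
  case zero
  then show ?case using C[of 0] by simp
next
  case (single m c)
  have "P (Poly_Mapping.single m 1)"
    by (induction m) (use C[of 1] in \<open>auto simp: single_add_mset Const_def intro: V M\<close>)
  then show ?case by (subst single_conv_Const) (intro M C)
qed (rule A)

lemma mlookup_Const_mult: "mlookup (Const c * p) m = c * mlookup p m"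
proof (induction p rule: mpoly_linear_induct)
  case (single k d)
  show ?case by (simp add: Const_def mult_single lookup_single when_def)
qed (simp_all add: lookup_add algebra_simps)

lemma mlookup_single_mult:
  "mlookup (Poly_Mapping.single M 1 * p) (M + m) = mlookup p m"
proof (induction p rule: mpoly_linear_induct)
  case (single k d)
  show ?case by (simp add: mult_single lookup_single when_def)
qed (simp_all add: lookup_add algebra_simps)

lemma mlookup_single_mult_notin:
  "\<not> M \<subseteq># m \<Longrightarrow> mlookup (Poly_Mapping.single M 1 * p) m = 0"
proof (induction p rule: mpoly_linear_induct)
  case (single k d)
  then show ?case by (auto simp: mult_single lookup_single when_def)
qed (simp_all add: lookup_add algebra_simps)

lemma mlookup_Var_mult:
  "mlookup (Var a * p) m = (if a \<in># m then mlookup p (m - {#a#}) else 0)"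
  using mlookup_single_mult[of "{#a#}" p "m - {#a#}"] mlookup_single_mult_notin[of "{#a#}" m p]
  by (auto simp: Var_def)

text \<open>Take a monomial of \<open>p\<close> with the largest exponent of \<open>a\<close>.
  Multiplied by \<open>Var a\<close> it exceeds every exponent of \<open>a\<close> that occurs in
  \<open>Var b * p\<close>, so it cannot cancel.\<close>

lemma Var_minus_Var_cancel:
  fixes p :: "'a mpoly"
  assumes "a \<noteq> b" and "(Var a - Var b) * p = 0"
  shows "p = 0"
proof (rule ccontr)
  assume "p \<noteq> 0"
  then have "mkeys p \<noteq> {}" by simp
  define N where "N = Max ((\<lambda>m. count m a) ` mkeys p)"
  have "N \<in> (\<lambda>m. count m a) ` mkeys p"
    unfolding N_def using \<open>mkeys p \<noteq> {}\<close> by (intro Max_in) auto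
  then obtain m where m: "m \<in> mkeys p" "count m a = N" by auto
  have big: "mlookup p k = 0" if "count k a > N" for k
  proof (rule ccontr)
    assume "mlookup p k \<noteq> 0"
    then have "count k a \<le> N" unfolding N_def by (intro Max_ge) (auto simp: in_keys_iff)
    with that show False by simp
  qed
  have "mlookup (Var a * p) (add_mset a m) = mlookup (Var b * p) (add_mset a m)"
    using assms(2) by (simp add: left_diff_distrib)
  also have "\<dots> = 0"
    using assms(1) m(2) by (auto simp: mlookup_Var_mult intro!: big)
  finally show False
    using m(1) by (simp add: mlookup_Var_mult in_keys_iff)
qed


section \<open>Evaluation of polynomials in commutative rings\<close>

locale const_hom =
  fixes s :: "complex \<Rightarrow> 'b::comm_ring_1"
  assumes s_0: "s 0 = 0" and s_1: "s 1 = 1" and s_add: "s (x + y) = s x + s y"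
    and s_mult: "s (x * y) = s x * s y"

text \<open>The map \<open>s\<close> on coefficients is a parameter because there are two targets:
  polynomials again (substitution, with \<open>Const\<close>) and polynomials in a parameter t over
  them, from which derivations are extracted.\<close>

definition evalm :: "(complex \<Rightarrow> 'b::comm_ring_1) \<Rightarrow> ('a \<Rightarrow> 'b) \<Rightarrow> 'a mpoly \<Rightarrow> 'b" where
  "evalm s v p = (\<Sum>m\<in>mkeys p. s (mlookup p m) * prod_mset (image_mset v m))"

context const_hom
begin

lemma evalm_cover:
  assumes "finite M" "mkeys p \<subseteq> M"
  shows "evalm s v p = (\<Sum>m\<in>M. s (mlookup p m) * prod_mset (image_mset v m))"
  unfolding evalm_def
  by (rule sum.mono_neutral_left) (use assms in \<open>auto simp: in_keys_iff s_0\<close>)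

lemma evalm_zero [simp]: "evalm s v 0 = 0"
  by (simp add: evalm_def)

lemma evalm_single [simp]:
  "evalm s v (Poly_Mapping.single m c) = s c * prod_mset (image_mset v m)"
  by (subst evalm_cover[of "{m}"]) auto

lemma evalm_Const [simp]: "evalm s v (Const c) = s c"
  by (simp add: Const_def)

lemma evalm_one [simp]: "evalm s v 1 = 1"
  using evalm_Const[of v 1] by (simp add: s_1)

lemma evalm_Var [simp]: "evalm s v (Var a) = v a"
  by (simp add: Var_def s_1)

lemma evalm_add [simp]: "evalm s v (p + q) = evalm s v p + evalm s v q"
  using evalm_cover[of "mkeys p \<union> mkeys q" "p + q" v] evalm_cover[of "mkeys p \<union> mkeys q" p v]
    evalm_cover[of "mkeys p \<union> mkeys q" q v] Poly_Mapping.keys_add[of p q]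
  by (simp add: lookup_add s_add distrib_right sum.distrib)

lemma evalm_mult [simp]: "evalm s v (p * q) = evalm s v p * evalm s v q"
proof (induction p rule: mpoly_linear_induct)
  case (single m c)
  show ?case
  proof (induction q rule: mpoly_linear_induct)
    case (single k d)
    show ?case by (simp add: mult_single s_mult algebra_simps)
  qed (simp_all add: algebra_simps)
qed (simp_all add: algebra_simps)

lemma evalm_uminus [simp]: "evalm s v (- p) = - evalm s v p"
  using evalm_add[of v p "- p"] by (simp add: add_eq_0_iff del: evalm_add)

lemma evalm_diff [simp]: "evalm s v (p - q) = evalm s v p - evalm s v q"
  using evalm_add[of v p "- q"] by (simp del: evalm_add)

lemma evalm_sum [simp]: "evalm s v (sum f I) = (\<Sum>i\<in>I. evalm s v (f i))"
  by (induction I rule: infinite_finite_induct) auto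

end

interpretation Const: const_hom "Const :: complex \<Rightarrow> 'a mpoly"
  by unfold_locales auto

lemma const_hom_pCons_Const: "const_hom (\<lambda>c. [:Const c :: 'a mpoly:])"
  by unfold_locales (auto simp: one_pCons)

interpretation cpoly: const_hom "\<lambda>c. [:Const c :: 'a mpoly:]"
  by (rule const_hom_pCons_Const)

abbreviation msubst :: "('a \<Rightarrow> 'b mpoly) \<Rightarrow> 'a mpoly \<Rightarrow> 'b mpoly" where
  "msubst \<equiv> evalm Const"

lemma msubst_msubst: "msubst v (msubst u p) = msubst (\<lambda>a. msubst v (u a)) p"
  by (induction p rule: mpoly_induct) auto

lemma msubst_Var [simp]: "msubst Var p = p"
  by (induction p rule: mpoly_induct) auto

text \<open>
  A derivation is read off from the ring map \<open>x\<^sub>a \<mapsto> x\<^sub>a + t \<delta>(a)\<close> as the coefficient of \<open>t\<close>, so that the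
  Leibniz rule need not be proved on monomials.
\<close>

definition der :: "('a \<Rightarrow> 'a mpoly) \<Rightarrow> 'a mpoly \<Rightarrow> 'a mpoly" where
  "der \<delta> p = coeff (evalm (\<lambda>c. [:Const c:]) (\<lambda>a. [:Var a, \<delta> a:]) p) 1"

lemma der_simps [simp]:
  "der \<delta> 0 = 0" "der \<delta> 1 = 0" "der \<delta> (Const c) = 0" "der \<delta> (Var a) = \<delta> a"
  "der \<delta> (p + q) = der \<delta> p + der \<delta> q" "der \<delta> (p - q) = der \<delta> p - der \<delta> q"
  "der \<delta> (- p) = - der \<delta> p"
  by (simp_all add: der_def one_pCons flip: one_pCons)

lemma der_mult [simp]: "der \<delta> (p * q) = der \<delta> p * q + p * der \<delta> q"
proof -
  have 0: "coeff (evalm (\<lambda>c. [:Const c:]) (\<lambda>a. [:Var a, \<delta> a:]) p) 0 = p" for p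
    by (induction p rule: mpoly_induct) (auto simp: coeff_mult)
  show ?thesis
    by (simp add: der_def coeff_mult 0)
qed

lemma der_sum [simp]: "der \<delta> (sum f I) = (\<Sum>i\<in>I. der \<delta> (f i))"
  by (induction I rule: infinite_finite_induct) auto

lemma der_add_fun: "der (\<lambda>a. \<delta> a + \<epsilon> a) p = der \<delta> p + der \<epsilon> p"
  by (induction p rule: mpoly_induct) (auto simp: algebra_simps)

text \<open>A commutator of derivations is a derivation, hence determined by its values on the
  variables.\<close>

lemma der_commutator:
  "der \<delta> (der \<epsilon> p) - der \<epsilon> (der \<delta> p) = der (\<lambda>a. der \<delta> (\<epsilon> a) - der \<epsilon> (\<delta> a)) p"
  by (induction p rule: mpoly_induct) (auto simp: algebra_simps)

text \<open>By the Leibniz rule a derivation replaces one occurrence of a variable \<open>a\<close>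
  in a monomial by monomials of \<open>\<delta> a\<close>. All later degree counts for derivations
  rest on this.\<close>

lemma keys_der:
  "mkeys (der \<delta> p) \<subseteq> {m - {#a#} + k | m a k. m \<in> mkeys p \<and> a \<in># m \<and> k \<in> mkeys (\<delta> a)}"
proof -
  have 1: "mkeys (der \<delta> (Poly_Mapping.single m 1)) \<subseteq> {m - {#a#} + k | a k. a \<in># m \<and> k \<in> mkeys (\<delta> a)}" for m
  proof (induction m)
    case empty
    have "Poly_Mapping.single {#} (1::complex) = (1 :: 'a mpoly)"
      by (simp flip: zero_multiset_def)
    then show ?case by simp
  next
    case (add b m)
    show ?case
    proof
      fix x assume "x \<in> mkeys (der \<delta> (Poly_Mapping.single (add_mset b m) 1))"
      then have "x \<in> mkeys (\<delta> b * Poly_Mapping.single m 1) \<or> x \<in> mkeys (Var b * der \<delta> (Poly_Mapping.single m 1))"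
        unfolding single_add_mset der_mult using Poly_Mapping.keys_add by fastforce
      then show "x \<in> {add_mset b m - {#a#} + k | a k. a \<in># add_mset b m \<and> k \<in> mkeys (\<delta> a)}"
      proof
        assume "x \<in> mkeys (\<delta> b * Poly_Mapping.single m 1)"
        then obtain k where "k \<in> mkeys (\<delta> b)" "x = k + m"
          using Poly_Mapping.keys_mult[of "\<delta> b" "Poly_Mapping.single m 1"] by auto
        then show ?thesis
          by (intro CollectI exI[of _ b] exI[of _ k]) auto
      next
        assume "x \<in> mkeys (Var b * der \<delta> (Poly_Mapping.single m 1))"
        then obtain y where "y \<in> mkeys (der \<delta> (Poly_Mapping.single m 1))" "x = add_mset b y"
          using Poly_Mapping.keys_mult[of "Var b" "der \<delta> (Poly_Mapping.single m 1)"]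
          by (auto simp: Var_def)
        then obtain a k where "a \<in># m" "k \<in> mkeys (\<delta> a)" "x = add_mset b (m - {#a#} + k)"
          using add.IH by auto
        then show ?thesis
          by (intro CollectI exI[of _ a] exI[of _ k])
            (auto simp: add_mset_remove_trivial_eq insert_DiffM multiset_eq_iff)
      qed
    qed
  qed
  have "der \<delta> p = (\<Sum>m\<in>mkeys p. der \<delta> (Poly_Mapping.single m (mlookup p m)))"
    by (subst (1) mpoly_sum_single) simp
  then have "mkeys (der \<delta> p) \<subseteq> (\<Union>m\<in>mkeys p. mkeys (der \<delta> (Poly_Mapping.single m (mlookup p m))))"
    using Poly_Mapping.keys_sum by metis
  also have "\<dots> \<subseteq> (\<Union>m\<in>mkeys p. mkeys (der \<delta> (Poly_Mapping.single m 1)))"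
  proof (intro UN_mono subset_refl)
    fix m
    show "mkeys (der \<delta> (Poly_Mapping.single m (mlookup p m))) \<subseteq> mkeys (der \<delta> (Poly_Mapping.single m 1))"
      by (subst single_conv_Const) (auto simp: in_keys_iff mlookup_Const_mult)
  qed
  also have "\<dots> \<subseteq> {m - {#a#} + k | m a k. m \<in> mkeys p \<and> a \<in># m \<and> k \<in> mkeys (\<delta> a)}"
    using 1 by fastforce
  finally show ?thesis .
qed

text \<open>Serves two gradings: by total degree and by the number of off-diagonal
  variables.\<close>

definition part :: "('a multiset \<Rightarrow> bool) \<Rightarrow> 'a mpoly \<Rightarrow> 'a mpoly" where
  "part P p = Poly_Mapping.mapp (\<lambda>m c. if P m then c else 0) p"

lemma mlookup_part [simp]: "mlookup (part P p) m = (if P m then mlookup p m else 0)"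
  by (simp add: part_def lookup_mapp when_def in_keys_iff)

lemma keys_part [simp]: "mkeys (part P p) = {m \<in> mkeys p. P m}"
  by (auto simp: in_keys_iff split: if_splits)

lemma part_simps [simp]:
  "part P 0 = 0" "part P (p + q) = part P p + part P q" "part P (p - q) = part P p - part P q"
  "part P (- p) = - part P p"
  by (rule poly_mapping_eqI; simp add: lookup_add lookup_minus)+

lemma part_sum [simp]: "part P (sum f I) = (\<Sum>i\<in>I. part P (f i))"
  by (induction I rule: infinite_finite_induct) auto

lemma part_Const_mult [simp]: "part P (Const c * p) = Const c * part P p"
  by (rule poly_mapping_eqI) (simp add: mlookup_Const_mult)

lemma part_eq_0I: "(\<And>m. m \<in> mkeys p \<Longrightarrow> \<not> P m) \<Longrightarrow> part P p = 0"
  by (rule poly_mapping_eqI) (auto simp: in_keys_iff)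

lemma part_eq_selfI: "(\<And>m. m \<in> mkeys p \<Longrightarrow> P m) \<Longrightarrow> part P p = p"
  by (rule poly_mapping_eqI) (auto simp: in_keys_iff)

lemma part_split: "p = part P p + part (\<lambda>m. \<not> P m) p"
  by (rule poly_mapping_eqI) (simp add: lookup_add)


section \<open>Symmetric polynomials\<close>

definition homog :: "nat \<Rightarrow> 'a mpoly \<Rightarrow> bool" where
  "homog d p \<longleftrightarrow> (\<forall>m\<in>mkeys p. size m = d)"

definition vars_in :: "'a set \<Rightarrow> 'a mpoly \<Rightarrow> bool" where
  "vars_in A p \<longleftrightarrow> (\<forall>m\<in>mkeys p. set_mset m \<subseteq> A)"

lemma homogD: "homog d p \<Longrightarrow> m \<in> mkeys p \<Longrightarrow> size m = d"
  by (simp add: homog_def)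

lemma vars_inD: "vars_in A p \<Longrightarrow> m \<in> mkeys p \<Longrightarrow> set_mset m \<subseteq> A"
  by (simp add: vars_in_def)

lemma homog_simps [simp]: "homog d 0" "homog 0 (Const c)" "homog 1 (Var a)"
  by (auto simp: homog_def Const_def Var_def split: if_splits)

lemma vars_in_simps [simp]: "vars_in A 0" "vars_in A (Const c)" "vars_in A (Var a) \<longleftrightarrow> a \<in> A"
  by (auto simp: vars_in_def Const_def Var_def split: if_splits)

lemma homog_add: "homog d p \<Longrightarrow> homog d q \<Longrightarrow> homog d (p + q)"
  using Poly_Mapping.keys_add[of p q] unfolding homog_def by blast

lemma keys_diff_subset: "mkeys (p - q) \<subseteq> mkeys p \<union> mkeys q"
  by (auto simp: in_keys_iff lookup_minus)

lemma homog_diff: "homog d p \<Longrightarrow> homog d q \<Longrightarrow> homog d (p - q)"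
  using keys_diff_subset[of p q] unfolding homog_def by blast

lemma homog_mult: "homog d p \<Longrightarrow> homog e q \<Longrightarrow> homog (d + e) (p * q)"
  using Poly_Mapping.keys_mult[of p q] unfolding homog_def by fastforce

lemma vars_in_add: "vars_in A p \<Longrightarrow> vars_in A q \<Longrightarrow> vars_in A (p + q)"
  using Poly_Mapping.keys_add[of p q] unfolding vars_in_def by blast

lemma vars_in_diff: "vars_in A p \<Longrightarrow> vars_in A q \<Longrightarrow> vars_in A (p - q)"
  using keys_diff_subset[of p q] unfolding vars_in_def by blast

lemma vars_in_mult: "vars_in A p \<Longrightarrow> vars_in A q \<Longrightarrow> vars_in A (p * q)"
  using Poly_Mapping.keys_mult[of p q] unfolding vars_in_def by fastforce

lemma homog_sum: "(\<And>i. i \<in> I \<Longrightarrow> homog d (f i)) \<Longrightarrow> homog d (sum f I)"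
  by (induction I rule: infinite_finite_induct) (auto intro: homog_add)

lemma vars_in_sum: "(\<And>i. i \<in> I \<Longrightarrow> vars_in A (f i)) \<Longrightarrow> vars_in A (sum f I)"
  by (induction I rule: infinite_finite_induct) (auto intro: vars_in_add)

lemma prod_mset_Var: "prod_mset (image_mset (\<lambda>a. Var (f a)) m) = Poly_Mapping.single (image_mset f m) 1"
  by (induction m) (auto simp: single_add_mset simp flip: zero_multiset_def)

text \<open>Transpositions suffice: they generate the permutations of a finite set.\<close>

definition sym_on :: "'a set \<Rightarrow> 'a mpoly \<Rightarrow> bool" where
  "sym_on A p \<longleftrightarrow> (\<forall>a\<in>A. \<forall>b\<in>A. msubst (\<lambda>x. Var (transpose a b x)) p = p)"

lemma mlookup_transpose:
  "mlookup (msubst (\<lambda>x. Var (transpose a b x)) p) m = mlookup p (image_mset (transpose a b) m)"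
proof (induction p rule: mpoly_linear_induct)
  case (single k c)
  have "image_mset (transpose a b) k = m \<longleftrightarrow> k = image_mset (transpose a b) m"
    by (auto simp: multiset.map_comp)
  then show ?case
    by (simp add: prod_mset_Var mlookup_Const_mult lookup_single when_def)
qed (simp_all add: lookup_add)

lemma sym_on_iff:
  "sym_on A p \<longleftrightarrow> (\<forall>a\<in>A. \<forall>b\<in>A. \<forall>m. mlookup p (image_mset (transpose a b) m) = mlookup p m)"
  unfolding sym_on_def by (simp add: poly_mapping_eq_iff fun_eq_iff mlookup_transpose)

lemma sym_onD:
  "sym_on A p \<Longrightarrow> a \<in> A \<Longrightarrow> b \<in> A \<Longrightarrow> mlookup p (image_mset (transpose a b) m) = mlookup p m"
  by (simp add: sym_on_iff)

lemma sym_on_simps [simp]: "sym_on A 0" "sym_on A (Const c)"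
  by (simp_all add: sym_on_def)

lemma sym_on_add: "sym_on A p \<Longrightarrow> sym_on A q \<Longrightarrow> sym_on A (p + q)"
  by (simp add: sym_on_def)

lemma sym_on_diff: "sym_on A p \<Longrightarrow> sym_on A q \<Longrightarrow> sym_on A (p - q)"
  by (simp add: sym_on_def)

lemma sym_on_mult: "sym_on A p \<Longrightarrow> sym_on A q \<Longrightarrow> sym_on A (p * q)"
  by (simp add: sym_on_def)

section \<open>Elementary symmetric polynomials and what they generate\<close>

definition esym :: "'a set \<Rightarrow> nat \<Rightarrow> 'a mpoly" where
  "esym A k = (\<Sum>B\<in>{B. B \<subseteq> A \<and> card B = k}. Poly_Mapping.single (mset_set B) 1)"

lemma sym_on_esym: "sym_on A (esym A k)"
  unfolding sym_on_def
proof (intro ballI)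
  fix a b assume ab: "a \<in> A" "b \<in> A"
  let ?t = "transpose a b"
  have t: "?t ` B \<subseteq> A \<longleftrightarrow> B \<subseteq> A" for B
    using ab by (auto simp: transpose_def image_subset_iff subset_iff split: if_splits)
  have "msubst (\<lambda>x. Var (?t x)) (esym A k)
      = (\<Sum>B\<in>{B. B \<subseteq> A \<and> card B = k}. Poly_Mapping.single (mset_set (?t ` B)) 1)"
    unfolding esym_def
    by (simp add: prod_mset_Var image_mset_mset_set[OF inj_on_transpose])
  also have "\<dots> = esym A k"
    unfolding esym_def
    by (rule sum.reindex_bij_witness[of _ "\<lambda>B. ?t ` B" "\<lambda>B. ?t ` B"])
      (auto simp: image_image t card_image)
  finally show "msubst (\<lambda>x. Var (?t x)) (esym A k) = esym A k" .
qed

lemma homog_esym: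
  assumes "finite A"
  shows "homog k (esym A k)"
  unfolding esym_def by (rule homog_sum) (auto simp: homog_def)

lemma vars_in_esym:
  assumes "finite A"
  shows "vars_in A (esym A k)"
  unfolding esym_def
proof (rule vars_in_sum)
  fix B assume "B \<in> {B. B \<subseteq> A \<and> card B = k}"
  then show "vars_in A (Poly_Mapping.single (mset_set B) 1)"
    using assms finite_subset[of B A] by (auto simp: vars_in_def)
qed

lemma esym_card:
  assumes "finite A"
  shows "esym A (card A) = Poly_Mapping.single (mset_set A) 1"
proof -
  have "{B. B \<subseteq> A \<and> card B = card A} = {A}"
    using assms by (auto dest: card_subset_eq)
  then show ?thesis by (simp add: esym_def)
qed

definition kill :: "'a \<Rightarrow> 'a mpoly \<Rightarrow> 'a mpoly" where
  "kill a = msubst (\<lambda>b. if b = a then 0 else Var b)"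

lemma kill_simps [simp]:
  "kill a 0 = 0" "kill a (Const c) = Const c" "kill a (p + q) = kill a p + kill a q"
  "kill a (p - q) = kill a p - kill a q" "kill a (p * q) = kill a p * kill a q"
  "kill a (sum f I) = (\<Sum>i\<in>I. kill a (f i))"
  by (simp_all add: kill_def)

lemma kill_single: "kill a (Poly_Mapping.single m c) = (if a \<in># m then 0 else Poly_Mapping.single m c)"
proof -
  have "kill a (Poly_Mapping.single m 1) = (if a \<in># m then 0 else Poly_Mapping.single m 1)"
    by (induction m) (auto simp: kill_def single_add_mset simp flip: zero_multiset_def)
  then show ?thesis
    using kill_simps(5)[of a "Const c" "Poly_Mapping.single m 1"]
    by (simp flip: single_conv_Const)
qed

lemma mlookup_kill: "mlookup (kill a p) m = (if a \<in># m then 0 else mlookup p m)"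
  by (induction p rule: mpoly_linear_induct) (auto simp: kill_single lookup_add lookup_single when_def)

lemma kill_esym:
  assumes "finite A" "a \<notin> A"
  shows "kill a (esym (insert a A) k) = esym A k"
proof -
  have "kill a (esym (insert a A) k)
      = (\<Sum>B\<in>{B. B \<subseteq> insert a A \<and> card B = k}. if a \<in> B then 0 else Poly_Mapping.single (mset_set B) 1)"
    unfolding esym_def kill_simps
  proof (rule sum.cong[OF refl])
    fix B assume "B \<in> {B. B \<subseteq> insert a A \<and> card B = k}"
    then have "finite B" using assms(1) finite_subset by auto
    then show "kill a (Poly_Mapping.single (mset_set B) 1) = (if a \<in> B then 0 else Poly_Mapping.single (mset_set B) 1)"
      by (simp add: kill_single)
  qed
  also have "\<dots> = esym A k"
    unfolding esym_def
    by (rule sum.mono_neutral_cong_right) (use assms in \<open>auto intro: finite_subset\<close>)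
  finally show ?thesis .
qed

text \<open>These are polynomials in the \<open>esym A k\<close> that are homogeneous when
  \<open>esym A k\<close> has weight \<open>k\<close>. Recording the weight allows each of them to
  be lifted later to an operator with a symbol in exactly that degree.\<close>

inductive gsym :: "'a set \<Rightarrow> nat \<Rightarrow> 'a mpoly \<Rightarrow> bool" for A where
  zero: "gsym A d 0"
| const: "gsym A 0 (Const c)"
| elem: "k \<in> {1..card A} \<Longrightarrow> gsym A k (esym A k)"
| add: "gsym A d p \<Longrightarrow> gsym A d q \<Longrightarrow> gsym A d (p + q)"
| mult: "gsym A d p \<Longrightarrow> gsym A e q \<Longrightarrow> gsym A (d + e) (p * q)"

lemma gsym_symmetric:
  assumes "gsym A d p" "finite A"
  shows "sym_on A p \<and> homog d p \<and> vars_in A p"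
  using assms
  by induction (auto simp: sym_on_esym homog_esym vars_in_esym
      intro: sym_on_add homog_add vars_in_add sym_on_mult homog_mult vars_in_mult)

text \<open>Replace each \<open>esym A k\<close> by \<open>esym (insert a A) k\<close>; setting the
  new variable to 0 undoes this.\<close>

lemma gsym_lift:
  assumes "gsym A d q" "finite A" "a \<notin> A"
  shows "\<exists>q'. gsym (insert a A) d q' \<and> kill a q' = q"
  using assms
proof induction
  case (zero d)
  then show ?case by (intro exI[of _ 0]) (auto intro: gsym.zero)
next
  case (const c)
  then show ?case by (intro exI[of _ "Const c"]) (auto intro: gsym.const)
next
  case (elem k)
  then show ?case by (intro exI[of _ "esym (insert a A) k"]) (auto intro!: gsym.elem simp: kill_esym)
next
  case (add d p q)
  then show ?case by (metis gsym.add kill_simps(3))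
next
  case (mult d p e q)
  then show ?case by (metis gsym.mult kill_simps(5))
qed

text \<open>
  Induction on the number of variables and on the degree: subtracting a lift of \<open>p\<close> with \<open>x\<^sub>a = 0\<close>
  leaves a symmetric polynomial divisible by \<open>x\<^sub>a\<close>, hence by the product of all variables.
\<close>

theorem symmetric_imp_gsym:
  assumes "finite A" "sym_on A p" "homog d p" "vars_in A p"
  shows "gsym A d p"
  using assms
proof (induction A arbitrary: p d rule: finite_induct)
  case empty
  have k: "m = {#} \<and> d = 0" if "m \<in> mkeys p" for m
    using empty that by (auto simp: homog_def vars_in_def)
  show ?case
  proof (cases "p = 0")
    case False
    then obtain m where "m \<in> mkeys p" by (metis keys_eq_empty ex_in_conv)
    then have "d = 0" using k by blast
    moreover have "p = Const (mlookup p {#})"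
      by (rule poly_mapping_eqI) (use k in \<open>auto simp: Const_def lookup_single when_def in_keys_iff\<close>)
    ultimately show ?thesis by (metis gsym.const)
  qed (simp add: gsym.zero)
next
  case (insert a A)
  let ?A = "insert a A"
  from insert.prems show ?case
  proof (induction d arbitrary: p rule: less_induct)
    case (less d)
    have "gsym A d (kill a p)"
    proof (rule insert.IH)
      show "sym_on A (kill a p)"
        unfolding sym_on_iff
      proof (intro ballI allI)
        fix x y m assume xy: "x \<in> A" "y \<in> A"
        have t: "transpose x y z = a \<longleftrightarrow> z = a" for z
          using xy insert.hyps by (auto simp: transpose_def split: if_splits)
        have "a \<in># image_mset (transpose x y) m \<longleftrightarrow> a \<in># m"
          using t by (auto simp: image_iff) (metis transpose_involutory)+
        then show "mlookup (kill a p) (image_mset (transpose x y) m) = mlookup (kill a p) m"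
          using less.prems(1) xy by (simp add: mlookup_kill sym_on_iff)
      qed
      have k: "m \<in> mkeys (kill a p) \<longleftrightarrow> m \<in> mkeys p \<and> a \<notin># m" for m
        by (simp add: in_keys_iff mlookup_kill)
      show "homog d (kill a p)"
        using less.prems(2) by (simp add: homog_def k)
      show "vars_in A (kill a p)"
        unfolding vars_in_def
      proof
        fix m assume "m \<in> mkeys (kill a p)"
        then have "m \<in> mkeys p" "a \<notin># m" by (simp_all add: k)
        then show "set_mset m \<subseteq> A" using vars_inD[OF less.prems(3)] by blast
      qed
    qed
    from gsym_lift[OF this insert.hyps(1,2)]
    obtain q where q: "gsym ?A d q" "kill a q = kill a p" by blast
    define r where "r = p - q"
    have qs: "sym_on ?A q" "homog d q" "vars_in ?A q"
      using gsym_symmetric[OF q(1)] insert.hyps(1) by auto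
    have r: "sym_on ?A r" "homog d r" "vars_in ?A r"
      unfolding r_def using qs less.prems insert.hyps
      by (auto intro: sym_on_diff homog_diff vars_in_diff)
    \<comment> \<open>If \<open>b\<close> were missing from \<open>m\<close>, the transposition of
      \<open>a\<close> and \<open>b\<close> would turn \<open>m\<close> into a monomial without
      \<open>a\<close>, with the same coefficient; but \<open>kill a r = 0\<close> says that there
      are none in \<open>r\<close>.\<close>
    have all: "b \<in># m" if m: "m \<in> mkeys r" and b: "b \<in> ?A" for m b
    proof (rule ccontr)
      assume "b \<notin># m"
      then have "a \<notin># image_mset (transpose a b) m"
        by (auto simp: transpose_def split: if_splits)
      moreover have "kill a r = 0" by (simp add: r_def q)
      ultimately have "mlookup r (image_mset (transpose a b) m) = 0"
        by (metis mlookup_kill lookup_zero)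
      then show False
        using sym_onD[OF r(1), of a b m] m b by (simp add: in_keys_iff)
    qed
    show ?case
    proof (cases "r = 0")
      case True
      then show ?thesis using q(1) by (simp add: r_def)
    next
      case False
      define M where "M = mset_set ?A"
      have sub: "M \<subseteq># m" if "m \<in> mkeys r" for m
        unfolding M_def using all[OF that] insert.hyps(1)
        by (auto simp: subseteq_mset_def count_mset_set' Suc_le_eq)
      define t where "t = Poly_Mapping.map_key (\<lambda>m. M + m) r"
      have lt: "mlookup t m = mlookup r (M + m)" for m
        unfolding t_def by (subst map_key.rep_eq) (auto simp: inj_def)
      have rt: "r = Poly_Mapping.single M 1 * t"
      proof (rule poly_mapping_eqI)
        fix m show "mlookup r m = mlookup (Poly_Mapping.single M 1 * t) m"
        proof (cases "M \<subseteq># m")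
          case True
          then obtain k where "m = M + k" by (metis mset_subset_eq_exists_conv)
          then show ?thesis by (simp add: mlookup_single_mult lt)
        next
          case False
          then show ?thesis using sub by (auto simp: mlookup_single_mult_notin in_keys_iff)
        qed
      qed
      have sM: "size M = card ?A" by (simp add: M_def)
      have tM: "image_mset (transpose x y) M = M" if "x \<in> ?A" "y \<in> ?A" for x y
      proof -
        have "transpose x y ` ?A = ?A"
          using that by (intro transpose_image_eq) auto
        then show ?thesis
          unfolding M_def by (subst image_mset_mset_set[OF inj_on_transpose]) simp
      qed
      have sz: "size m + card ?A = d" if m: "m \<in> mkeys t" for m
      proof -
        have "M + m \<in> mkeys r" using m by (simp add: in_keys_iff lt)
        from homogD[OF r(2) this] show ?thesis by (simp add: sM)
      qed
      have "t \<noteq> 0" using rt False by auto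
      then obtain m0 where "m0 \<in> mkeys t" by (metis keys_eq_empty ex_in_conv)
      \<comment> \<open>A monomial of \<open>t\<close> witnesses \<open>card ?A \<le> d\<close>, so
        the truncated subtraction is exact.\<close>
      then have d: "d = card ?A + (d - card ?A)"
        using sz by force
      have ht: "homog (d - card ?A) t"
        unfolding homog_def using sz by force
      have "card ?A > 0" using insert.hyps by simp
      then have "gsym ?A (d - card ?A) t"
      proof (intro less.IH ht)
        show "sym_on ?A t"
          unfolding sym_on_iff
        proof (intro ballI allI)
          fix x y m assume xy: "x \<in> ?A" "y \<in> ?A"
          have "mlookup t (image_mset (transpose x y) m) = mlookup r (image_mset (transpose x y) (M + m))"
            by (simp add: lt tM[OF xy])
          also have "\<dots> = mlookup t m"
            using sym_onD[OF r(1) xy, of "M + m"] by (simp add: lt)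
          finally show "mlookup t (image_mset (transpose x y) m) = mlookup t m" .
        qed
        show "vars_in ?A t"
          unfolding vars_in_def
        proof
          fix m assume "m \<in> mkeys t"
          then have "M + m \<in> mkeys r" by (simp add: in_keys_iff lt)
          from vars_inD[OF r(3) this] show "set_mset m \<subseteq> ?A" by simp
        qed
      qed (use d in linarith)
      \<comment> \<open>The product of all variables is the top elementary symmetric
        polynomial.\<close>
      moreover have "gsym ?A (card ?A) (Poly_Mapping.single M 1)"
        using gsym.elem[of "card ?A" ?A] insert.hyps esym_card[of ?A] by (simp add: M_def)
      ultimately have "gsym ?A d r"
        unfolding rt by (subst d) (rule gsym.mult)
      then have "gsym ?A d (q + r)"
        using q(1) by (intro gsym.add)
      then show ?thesis by (simp add: r_def)
    qed
  qed
qed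


section \<open>Invariants of the adjoint action\<close>

text \<open>The value is the Lie bracket of two matrix units, written as a linear form. Hence
  \<open>der (bracket l)\<close> is the adjoint action of \<open>l\<close> on the symmetric algebra
  of gl(n).\<close>

fun bracket :: "nat \<times> nat \<Rightarrow> nat \<times> nat \<Rightarrow> (nat \<times> nat) mpoly" where
  "bracket (i, j) (k, l) = (if j = k then Var (i, l) else 0) - (if l = i then Var (k, j) else 0)"

definition invariant :: "nat \<Rightarrow> (nat \<times> nat) mpoly \<Rightarrow> bool" where
  "invariant n p \<longleftrightarrow> (\<forall>l\<in>gl_letters n. der (bracket l) p = 0)"

definition diag :: "(nat \<times> nat) mpoly \<Rightarrow> (nat \<times> nat) mpoly" where
  "diag = msubst (\<lambda>(i, j). if i = j then Var (i, j) else 0)"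

lemma diag_simps [simp]:
  "diag 0 = 0" "diag 1 = 1" "diag (Const c) = Const c" "diag (p + q) = diag p + diag q"
  "diag (p - q) = diag p - diag q" "diag (p * q) = diag p * diag q"
  "diag (sum f I) = (\<Sum>i\<in>I. diag (f i))"
  "diag (Var (i, j)) = (if i = j then Var (i, j) else 0)"
  by (simp_all add: diag_def)

lemma diag_single:
  "diag (Poly_Mapping.single m c) =
    (if \<forall>x\<in>#m. fst x = snd x then Poly_Mapping.single m c else 0)"
proof -
  have "diag (Poly_Mapping.single m 1) =
    (if \<forall>x\<in>#m. fst x = snd x then Poly_Mapping.single m 1 else 0)"
    by (induction m) (auto simp: single_add_mset simp flip: zero_multiset_def)
  then show ?thesis
    using diag_simps(6)[of "Const c" "Poly_Mapping.single m 1"]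
    by (simp flip: single_conv_Const split: if_splits)
qed

lemma mlookup_diag:
  "mlookup (diag p) m = (if \<forall>x\<in>#m. fst x = snd x then mlookup p m else 0)"
  by (induction p rule: mpoly_linear_induct) (auto simp: diag_single lookup_add lookup_single when_def)

section \<open>Partial derivatives and the off-diagonal degree\<close>

lemma der_scale: "der (\<lambda>a. c * \<delta> a) p = c * der \<delta> p"
  by (induction p rule: mpoly_induct) (simp_all add: distrib_left mult.left_commute mult.commute)

lemma der_indicator_single:
  "der (\<lambda>a. if a = x then 1 else 0) (Poly_Mapping.single m 1)
    = Const (of_nat (count m x)) * Poly_Mapping.single (m - {#x#}) 1"
proof (induction m)
  case empty
  have "Poly_Mapping.single {#} (1::complex) = (1 :: 'a mpoly)"
    by (simp flip: zero_multiset_def)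
  then show ?case by simp
next
  case (add b m)
  have *: "Var x * Poly_Mapping.single (m - {#x#}) 1 = Poly_Mapping.single m 1" if "x \<in># m"
    using that by (simp flip: single_add_mset)
  show ?case
  proof (cases "b = x")
    case True
    show ?thesis
    proof (cases "x \<in># m")
      case True
      then show ?thesis
        using \<open>b = x\<close> * by (simp add: single_add_mset add.IH algebra_simps mult.left_commute[of "Var x"])
    next
      case False
      then show ?thesis
        using \<open>b = x\<close> by (simp add: single_add_mset add.IH not_in_iff)
    qed
  next
    case False
    then have "add_mset b m - {#x#} = add_mset b (m - {#x#})" if "x \<in># m"
      using that by simp
    then show ?thesis
      using False by (cases "x \<in># m") (auto simp: single_add_mset add.IH algebra_simps not_in_iff)
  qed
qed

text \<open>The indicator of \<open>x\<close> gives the partial derivative in \<open>x\<close>. The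
  factor \<open>Suc (count m x)\<close> is nonzero over the complex numbers, so a vanishing
  derivative excludes every monomial that contains \<open>x\<close>.\<close>

lemma mlookup_der_indicator:
  "mlookup (der (\<lambda>a. if a = x then 1 else 0) p) m = of_nat (Suc (count m x)) * mlookup p (add_mset x m)"
proof (induction p rule: mpoly_linear_induct)
  case (single k c)
  have "der (\<lambda>a. if a = x then 1 else 0) (Poly_Mapping.single k c)
      = Const c * Const (of_nat (count k x)) * Poly_Mapping.single (k - {#x#}) 1"
    by (subst single_conv_Const) (simp add: der_indicator_single mult.assoc)
  then show ?case
    by (cases "x \<in># k") (auto simp: mlookup_Const_mult lookup_single when_def mult.assoc not_in_iff)
qed (simp_all add: lookup_add algebra_simps)

definition offdiag :: "(nat \<times> nat) multiset \<Rightarrow> nat" where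
  "offdiag m = size (filter_mset (\<lambda>x. fst x \<noteq> snd x) m)"

lemma offdiag_simps [simp]:
  "offdiag (m + k) = offdiag m + offdiag k" "offdiag {#x#} = (if fst x = snd x then 0 else 1)"
  "offdiag {#} = 0"
  by (simp_all add: offdiag_def)

lemma offdiag_replace:
  assumes "x \<in># m"
  shows "offdiag (m - {#x#} + k) + offdiag {#x#} = offdiag m + offdiag k"
proof -
  have "offdiag (m - {#x#}) + offdiag {#x#} = offdiag m"
    by (metis assms offdiag_simps(1) insert_DiffM2)
  then show ?thesis by (simp only: offdiag_simps(1))
qed

lemma keys_Var [simp]: "mkeys (Var a) = {{#a#}}"
  by (simp add: Var_def)

text \<open>
  In the component of lowest off-diagonal degree, the operator \<open>bracket (i, j)\<close> acts as
  \<open>(x\<^sub>i\<^sub>i - x\<^sub>j\<^sub>j) \<partial>/\<partial>x\<^sub>j\<^sub>i\<close>, so that component of an invariant cannot contain off-diagonal variables.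
\<close>

theorem invariant_diag_eq_0:
  assumes p: "vars_in (gl_letters n) p" "invariant n p" "diag p = 0"
  shows "p = 0"
proof (rule ccontr)
  assume "p \<noteq> 0"
  define \<mu> where "\<mu> = Min (offdiag ` mkeys p)"
  have "\<mu> \<in> offdiag ` mkeys p"
    unfolding \<mu>_def using \<open>p \<noteq> 0\<close> by (intro Min_in) auto
  then obtain m0 where m0: "m0 \<in> mkeys p" "offdiag m0 = \<mu>" by auto
  have ge: "offdiag m \<ge> \<mu>" if "m \<in> mkeys p" for m
    unfolding \<mu>_def using that by (intro Min_le) auto
  have "\<not> (\<forall>x\<in>#m0. fst x = snd x)"
    using p(3) m0(1) mlookup_diag[of p m0] unfolding in_keys_iff by (metis lookup_zero)
  then obtain i j where ij: "(j, i) \<in># m0" "i \<noteq> j" by auto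
  then have pos: "\<mu> > 0"
    using offdiag_replace[OF ij(1), of "{#}"] m0 by auto
  have "(j, i) \<in> gl_letters n"
    using ij m0(1) p(1) unfolding vars_in_def by auto
  then have inv: "der (bracket (i, j)) p = 0"
    using p(2) unfolding invariant_def gl_letters_def by auto
  \<comment> \<open>The only variable that \<open>bracket (i, j)\<close> sends from off-diagonal to
    diagonal ones is \<open>(j, i)\<close>, whose image is x_ii - x_jj. So \<open>\<delta>\<close>
    lowers \<open>offdiag\<close> by one, while the remainder \<open>\<epsilon>\<close> never lowers
    it.\<close>
  define \<delta> :: "nat \<times> nat \<Rightarrow> (nat \<times> nat) mpoly"
    where "\<delta> = (\<lambda>a. if a = (j, i) then Var (i, i) - Var (j, j) else 0)"
  define \<epsilon> where "\<epsilon> = (\<lambda>a. bracket (i, j) a - \<delta> a)"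
  have \<delta>keys: "a = (j, i) \<and> offdiag k = 0" if "k \<in> mkeys (\<delta> a)" for k a
    using that keys_diff_subset[of "Var (i, i)" "Var (j, j)"]
    by (auto simp: \<delta>_def split: if_splits)
  have \<epsilon>keys: "offdiag k \<ge> offdiag {#a#}" if "k \<in> mkeys (\<epsilon> a)" for k a
  proof (cases "a = (j, i)")
    case True
    then show ?thesis using that ij(2) by (simp add: \<epsilon>_def \<delta>_def)
  next
    case False
    obtain k' l' where "a = (k', l')" by fastforce
    then show ?thesis
      using that False ij(2)
        keys_diff_subset[of "if j = k' then Var (i, l') else 0" "if l' = i then Var (k', j) else 0"]
      by (auto simp: \<epsilon>_def \<delta>_def split: if_splits)
  qed
  let ?T = "part (\<lambda>m. offdiag m = \<mu> - 1)"
  define q where "q = part (\<lambda>m. offdiag m = \<mu>) p"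
  define r where "r = part (\<lambda>m. offdiag m \<noteq> \<mu>) p"
  have split: "p = q + r"
    unfolding q_def r_def by (rule part_split)
  have sum: "der (bracket (i, j)) p = der \<delta> q + der \<delta> r + der \<epsilon> p"
    using der_add_fun[of \<delta> \<epsilon> p] split by (simp add: \<epsilon>_def flip: der_simps(5))
  have 1: "?T (der \<epsilon> p) = 0"
  proof (rule part_eq_0I)
    fix m assume "m \<in> mkeys (der \<epsilon> p)"
    then obtain m' a k where "m' \<in> mkeys p" "a \<in># m'" "k \<in> mkeys (\<epsilon> a)" "m = m' - {#a#} + k"
      using keys_der by blast
    then show "offdiag m \<noteq> \<mu> - 1"
      using \<epsilon>keys[of k a] offdiag_replace[of a m' k] ge[of m'] pos by arith
  qed
  have 2: "?T (der \<delta> r) = 0"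
  proof (rule part_eq_0I)
    fix m assume "m \<in> mkeys (der \<delta> r)"
    then obtain m' a k where "m' \<in> mkeys r" "a \<in># m'" "k \<in> mkeys (\<delta> a)" "m = m' - {#a#} + k"
      using keys_der by blast
    then show "offdiag m \<noteq> \<mu> - 1"
      using \<delta>keys[of k a] offdiag_replace[of a m' k] ge[of m'] pos ij(2) unfolding r_def by auto
  qed
  have 3: "?T (der \<delta> q) = der \<delta> q"
  proof (rule part_eq_selfI)
    fix m assume "m \<in> mkeys (der \<delta> q)"
    then obtain m' a k where "m' \<in> mkeys q" "a \<in># m'" "k \<in> mkeys (\<delta> a)" "m = m' - {#a#} + k"
      using keys_der by blast
    then show "offdiag m = \<mu> - 1"
      using \<delta>keys[of k a] offdiag_replace[of a m' k] ij(2) unfolding q_def by auto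
  qed
  let ?d = "der (\<lambda>a. if a = (j, i) then 1 else 0)"
  have \<delta>: "der \<delta> u = (Var (i, i) - Var (j, j)) * ?d u" for u
    unfolding der_scale[symmetric] \<delta>_def
    by (rule arg_cong[of _ _ "\<lambda>f. der f u"]) (auto simp: fun_eq_iff)
  \<comment> \<open>Off-diagonal degree \<open>\<mu> - 1\<close> can be reached only by
    \<open>\<delta>\<close> acting on the lowest component \<open>q\<close>.\<close>
  have "?T (der (bracket (i, j)) p) = der \<delta> q"
    unfolding sum part_simps 1 2 3 by simp
  then have "(Var (i, i) - Var (j, j)) * ?d q = 0"
    by (simp add: inv \<delta>)
  with ij(2) have "?d q = 0"
    by (metis Var_minus_Var_cancel prod.inject)
  then have "mlookup (?d q) (m0 - {#(j, i)#}) = 0" by simp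
  then have "mlookup q m0 = 0"
    using ij(1) by (simp only: mlookup_der_indicator) (auto simp: count_eq_zero_iff simp del: of_nat_Suc)
  then show False
    using m0 by (simp add: q_def in_keys_iff)
qed

text \<open>A vanishing partial derivative means that \<open>x\<close> does not occur in
  \<open>p\<close>, so its value is irrelevant.\<close>

lemma msubst_fun_upd:
  assumes "der (\<lambda>a. if a = x then 1 else 0) p = 0"
  shows "msubst (u(x := c)) p = msubst u p"
  unfolding evalm_def
proof (rule sum.cong[OF refl])
  fix m assume m: "m \<in> mkeys p"
  have "x \<notin># m"
  proof
    assume "x \<in># m"
    then have "of_nat (Suc (count (m - {#x#}) x)) * mlookup p m = 0"
      using mlookup_der_indicator[of x p "m - {#x#}"] assms by simp
    then show False
      using m by (simp add: in_keys_iff del: of_nat_Suc)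
  qed
  then show "Const (mlookup p m) * prod_mset (image_mset (u(x := c)) m)
      = Const (mlookup p m) * prod_mset (image_mset u m)"
    by (intro arg_cong[of _ _ "\<lambda>t. _ * prod_mset t"] image_mset_cong) auto
qed

text \<open>
  \<open>elem_conj i j s\<close> is the conjugation \<open>X \<mapsto> (1 + s E\<^sub>j\<^sub>i) X (1 - s E\<^sub>j\<^sub>i)\<close>, the flow of
  \<open>bracket (i, j)\<close> for \<open>i \<noteq> j\<close>.
\<close>

definition elem_conj :: "nat \<Rightarrow> nat \<Rightarrow> 'b::comm_ring_1 \<Rightarrow> (nat \<times> nat \<Rightarrow> 'b) \<Rightarrow> nat \<times> nat \<Rightarrow> 'b" where
  "elem_conj i j s v = (\<lambda>(k, l). v (k, l)
     + s * ((if k = j then v (i, l) else 0) - (if l = i then v (k, j) else 0))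
     - s\<^sup>2 * (if k = j \<and> l = i then v (i, j) else 0))"

text \<open>The time of the flow is a fresh variable \<open>None\<close>. The path \<open>V\<close>
  satisfies the flow equation of \<open>bracket (i, j)\<close>, so the chain rule makes the time
  derivative of \<open>p\<close> along \<open>V\<close> vanish; then \<open>p\<close> along
  \<open>V\<close> is free of \<open>None\<close>, and the times \<open>s\<close> and 0 give the
  same value.\<close>

lemma msubst_elem_conj:
  fixes v :: "nat \<times> nat \<Rightarrow> 'a mpoly"
  assumes "i \<noteq> j" "der (bracket (i, j)) p = 0"
  shows "msubst (elem_conj i j s v) p = msubst v p"
proof -
  define w :: "nat \<times> nat \<Rightarrow> 'a option mpoly" where "w x = msubst (\<lambda>a. Var (Some a)) (v x)" for x
  define V where "V = elem_conj i j (Var None) w"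
  let ?dt = "der (\<lambda>a. if a = None then 1 else 0)"
  have w: "?dt (w x) = 0" for x
  proof -
    have "?dt (msubst (\<lambda>a. Var (Some a)) q) = 0" for q :: "'a mpoly"
      by (induction q rule: mpoly_induct) auto
    then show ?thesis by (simp add: w_def)
  qed
  have gen: "?dt (V x) = msubst V (bracket (i, j) x)" for x
    by (cases x) (use assms(1) in \<open>auto simp: V_def elem_conj_def w power2_eq_square algebra_simps\<close>)
  have "?dt (msubst V q) = msubst V (der (bracket (i, j)) q)" for q
    by (induction q rule: mpoly_induct) (simp_all add: gen)
  then have const: "?dt (msubst V p) = 0" by (simp add: assms(2))
  define u where "u t = (case_option t Var :: 'a option \<Rightarrow> 'a mpoly)" for t
  have u: "msubst (u t) (w x) = v x" for t x
    by (simp add: w_def u_def msubst_msubst)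
  have "msubst (u t) (V x) = elem_conj i j t v x" for t x
    by (cases x) (auto simp: V_def elem_conj_def u power2_eq_square, simp_all add: u_def)
  then have ev: "msubst (u t) (msubst V p) = msubst (elem_conj i j t v) p" for t
    by (simp add: msubst_msubst)
  have "(u 0)(None := s) = u s"
    by (auto simp: u_def fun_eq_iff split: option.splits)
  then have "msubst (elem_conj i j s v) p = msubst (elem_conj i j 0 v) p"
    using msubst_fun_upd[OF const, of "u 0" s] by (simp add: ev)
  also have "elem_conj i j 0 v = v"
    by (auto simp: elem_conj_def fun_eq_iff)
  finally show ?thesis .
qed

lemma sym_on_diag:
  assumes "invariant n p"
  shows "sym_on ((\<lambda>i. (i, i)) ` {1..n}) (diag p)"
  unfolding sym_on_def
proof (intro ballI)
  fix a b assume "a \<in> (\<lambda>i. (i, i)) ` {1..n}" "b \<in> (\<lambda>i. (i, i)) ` {1..n}"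
  then obtain i j where ij: "i \<in> {1..n}" "j \<in> {1..n}" "a = (i, i)" "b = (j, j)" by auto
  show "msubst (\<lambda>x. Var (transpose a b x)) (diag p) = diag p"
  proof (cases "i = j")
    case False
    define D :: "nat \<times> nat \<Rightarrow> (nat \<times> nat) mpoly"
      where "D = (\<lambda>(i, j). if i = j then Var (i, j) else 0)"
    have D: "diag p = msubst D p" by (simp add: diag_def D_def)
    have z: "der (bracket (i, j)) p = 0" "der (bracket (j, i)) p = 0"
      using assms ij by (auto simp: invariant_def gl_letters_def)
    \<comment> \<open>The matrix (1 + E_ij)(1 - E_ji)(1 + E_ij) is a signed permutation matrix;
      conjugation by it exchanges the i-th and j-th entries of a diagonal matrix.\<close>
    have "msubst D p = msubst (elem_conj j i 1 (elem_conj i j (- 1) (elem_conj j i 1 D))) p"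
      using False z by (simp add: msubst_elem_conj)
    also have "elem_conj j i 1 (elem_conj i j (- 1) (elem_conj j i 1 D))
      = (\<lambda>x. msubst (\<lambda>x. Var (transpose a b x)) (D x))"
      using False by (auto simp: fun_eq_iff elem_conj_def D_def transpose_def ij)
    finally show ?thesis
      unfolding D by (simp add: msubst_msubst)
  qed (use ij in simp)
qed


section \<open>Rings of endomorphisms\<close>

text \<open>As a type under composition, endomorphisms form a \<open>ring_1\<close>, where
  \<open>sum\<close>, \<open>prod_list\<close> and rewriting for noncommutative rings are available
  without carrier conditions. Complex scalars are themselves elements,
  \<open>scal c\<close>.\<close>

typedef (overloaded) 'a endo = "{f :: 'a::ab_group_add \<Rightarrow> 'a. \<forall>x y. f (x + y) = f x + f y}"
  morphisms app Abs_endo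
  by (intro exI[of _ id]) simp

setup_lifting type_definition_endo

lemma app_add [simp]: "app a (x + y) = app a x + app a y"
  using app[of a] by blast

lemma app_zero [simp]: "app a 0 = 0"
  using app_add[of a 0 0] by simp

lemma app_uminus [simp]: "app a (- x) = - app a x"
  using app_add[of a x "- x"] by (simp add: add_eq_0_iff del: app_add)

lemma app_diff [simp]: "app a (x - y) = app a x - app a y"
  using app_add[of a x "- y"] by (simp del: app_add)

lemma app_sum [simp]: "app a (sum f I) = (\<Sum>i\<in>I. app a (f i))"
  by (induction I rule: infinite_finite_induct) auto

lemma endo_eqI: "(\<And>x. app a x = app b x) \<Longrightarrow> a = b"
  by (simp add: app_inject[symmetric] fun_eq_iff)

instantiation endo :: (comm_ring_1) ring_1
begin

lift_definition zero_endo :: "'a endo" is "\<lambda>x. 0" by simp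
lift_definition one_endo :: "'a endo" is "\<lambda>x. x" by simp
lift_definition plus_endo :: "'a endo \<Rightarrow> 'a endo \<Rightarrow> 'a endo" is "\<lambda>f g x. f x + g x"
  by (simp add: algebra_simps)
lift_definition minus_endo :: "'a endo \<Rightarrow> 'a endo \<Rightarrow> 'a endo" is "\<lambda>f g x. f x - g x"
  by (simp add: algebra_simps)
lift_definition uminus_endo :: "'a endo \<Rightarrow> 'a endo" is "\<lambda>f x. - f x"
  by (simp add: algebra_simps)
lift_definition times_endo :: "'a endo \<Rightarrow> 'a endo \<Rightarrow> 'a endo" is "\<lambda>f g x. f (g x)"
  by simp

instance
proof
  show "(0 :: 'a endo) \<noteq> 1"
    by transfer (auto simp: fun_eq_iff intro!: exI[of _ 1])
  fix a b c :: "'a endo"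
  show "a + b + c = a + (b + c)" "a + b = b + a" "0 + a = a" "- a + a = 0" "a - b = a + - b"
    "a * b * c = a * (b * c)" "1 * a = a" "a * 1 = a" "(a + b) * c = a * c + b * c"
    by (transfer; simp add: fun_eq_iff algebra_simps)+
  show "a * (b + c) = a * b + a * c"
    by transfer (simp add: fun_eq_iff algebra_simps)
qed

end

lemma app_simps [simp]:
  "app (0 :: 'a::comm_ring_1 endo) x = 0" "app (1 :: 'a::comm_ring_1 endo) x = x"
  "app (a + b) x = app a x + app b x" "app (a - b) x = app a x - app b x"
  "app (- a) x = - app a x" "app (a * b) x = app a (app b x)"
  for a b :: "'a::comm_ring_1 endo"
  by (transfer, simp)+

lemma app_sum_left [simp]: "app (sum f I) x = (\<Sum>i\<in>I. app (f i) x)"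
  for f :: "'i \<Rightarrow> 'a::comm_ring_1 endo"
  by (induction I rule: infinite_finite_induct) auto


section \<open>Linear extension of multiplicative maps on words\<close>

definition ext :: "(complex \<Rightarrow> 'r::ring_1) \<Rightarrow> ('a \<Rightarrow> 'r) \<Rightarrow> ('a list \<Rightarrow> complex) \<Rightarrow> 'r" where
  "ext s g f = (\<Sum>w | f w \<noteq> 0. s (f w) * prod_list (map g w))"

text \<open>Instantiated twice: with operators (\<open>rho\<close>) and with commuting variables
  (\<open>ab\<close>). Scalars must commute with the letters, but the letters need not commute with
  each other.\<close>

locale word_rep =
  fixes s :: "complex \<Rightarrow> 'r::ring_1" and g :: "'a \<Rightarrow> 'r"
  assumes s_0: "s 0 = 0" and s_1: "s 1 = 1" and s_add: "s (x + y) = s x + s y"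
    and s_mult: "s (x * y) = s x * s y" and s_comm: "s x * g a = g a * s x"
begin

lemma s_prod_list: "s x * prod_list (map g w) = prod_list (map g w) * s x"
  by (induction w) (auto simp: s_comm mult.assoc, metis s_comm mult.assoc)

lemma s_prod_list_left: "s x * (prod_list (map g w) * z) = prod_list (map g w) * (s x * z)"
  by (simp add: s_prod_list flip: mult.assoc)

lemma s_sum: "s (sum f I) = (\<Sum>i\<in>I. s (f i))"
  by (induction I rule: infinite_finite_induct) (auto simp: s_0 s_add)

lemma s_uminus: "s (- x) = - s x"
  using s_add[of x "- x"] by (simp add: s_0 add_eq_0_iff)

lemma ext_cover:
  assumes "finite W" "{w. f w \<noteq> 0} \<subseteq> W"
  shows "ext s g f = (\<Sum>w\<in>W. s (f w) * prod_list (map g w))"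
  unfolding ext_def
  by (rule sum.mono_neutral_left) (use assms in \<open>auto simp: s_0\<close>)

lemma ext_zero: "ext s g (\<lambda>w. 0) = 0"
  by (simp add: ext_def)

lemma ext_word: "ext s g (\<lambda>w. c * word u w) = s c * prod_list (map g u)"
  by (subst ext_cover[of "{u}"]) (auto simp: word_def)

lemma ext_word': "ext s g (word u) = prod_list (map g u)"
  using ext_word[of 1 u] by (simp add: s_1)

lemma ext_add:
  assumes "finite {w. f w \<noteq> 0}" "finite {w. h w \<noteq> 0}"
  shows "ext s g (\<lambda>w. f w + h w) = ext s g f + ext s g h"
proof -
  let ?W = "{w. f w \<noteq> 0} \<union> {w. h w \<noteq> 0}"
  have "ext s g (\<lambda>w. f w + h w) = (\<Sum>w\<in>?W. s (f w + h w) * prod_list (map g w))"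
    by (rule ext_cover) (use assms in auto)
  also have "\<dots> = ext s g f + ext s g h"
    using assms by (simp add: ext_cover[of ?W f] ext_cover[of ?W h] s_add distrib_right sum.distrib)
  finally show ?thesis .
qed

lemma ext_scale: "ext s g (\<lambda>w. c * f w) = s c * ext s g f"
proof (cases "c = 0")
  case True
  then show ?thesis by (simp add: ext_def s_0)
next
  case False
  then show ?thesis by (simp add: ext_def s_mult mult.assoc sum_distrib_left)
qed

lemma ext_diff:
  assumes "finite {w. f w \<noteq> 0}" "finite {w. h w \<noteq> 0}"
  shows "ext s g (\<lambda>w. f w - h w) = ext s g f - ext s g h"
  using ext_add[of f "\<lambda>w. (- 1) * h w"] assms unfolding ext_scale by (simp add: s_uminus s_1)

lemma ext_conv:
  assumes f: "finite {w. f w \<noteq> 0}" and h: "finite {w. h w \<noteq> 0}"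
  shows "ext s g (\<lambda>w. \<Sum>i\<le>length w. f (take i w) * h (drop i w)) = ext s g f * ext s g h"
proof -
  let ?U = "{w. f w \<noteq> 0}" and ?V = "{w. h w \<noteq> 0}"
  define W where "W = (\<lambda>(u, v). u @ v) ` (?U \<times> ?V)"
  have finW: "finite W" using f h by (simp add: W_def)
  define F where "F u v = s (f u) * s (h v) * prod_list (map g (u @ v))" for u v
  have "ext s g (\<lambda>w. \<Sum>i\<le>length w. f (take i w) * h (drop i w))
      = (\<Sum>w\<in>W. \<Sum>i\<le>length w. F (take i w) (drop i w))"
    by (subst ext_cover[OF finW])
      (use conv_support[of f h] in \<open>auto simp: W_def s_sum s_mult sum_distrib_right F_def\<close>)
  also have "\<dots> = (\<Sum>(w, i)\<in>Sigma W (\<lambda>w. {..length w}). F (take i w) (drop i w))"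
    by (rule sum.Sigma) (use finW in auto)
  \<comment> \<open>A cut \<open>(w, i)\<close> contributes only if both pieces lie in the supports,
    and a pair \<open>(u, v)\<close> is recovered from \<open>(u @ v, length u)\<close>.\<close>
  also have "\<dots> = (\<Sum>(w, i)\<in>(\<lambda>(u, v). (u @ v, length u)) ` (?U \<times> ?V). F (take i w) (drop i w))"
  proof (rule sum.mono_neutral_right)
    show "finite (Sigma W (\<lambda>w. {..length w}))"
      using finW by simp
    show "(\<lambda>(u, v). (u @ v, length u)) ` (?U \<times> ?V) \<subseteq> Sigma W (\<lambda>w. {..length w})"
      by (auto simp: W_def)
    show "\<forall>x\<in>Sigma W (\<lambda>w. {..length w}) - (\<lambda>(u, v). (u @ v, length u)) ` (?U \<times> ?V).
        (case x of (w, i) \<Rightarrow> F (take i w) (drop i w)) = 0"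
    proof clarify
      fix w i
      assume i: "i \<le> length w" and n: "(w, i) \<notin> (\<lambda>(u, v). (u @ v, length u)) ` (?U \<times> ?V)"
      have "f (take i w) = 0 \<or> h (drop i w) = 0"
      proof (rule ccontr)
        assume "\<not> ?thesis"
        then have "(take i w, drop i w) \<in> ?U \<times> ?V" by simp
        then have "(take i w @ drop i w, length (take i w)) \<in> (\<lambda>(u, v). (u @ v, length u)) ` (?U \<times> ?V)"
          by (rule rev_image_eqI) simp
        then show False using n i by simp
      qed
      then show "F (take i w) (drop i w) = 0" by (auto simp: F_def s_0)
    qed
  qed
  also have "\<dots> = (\<Sum>(u, v)\<in>?U \<times> ?V. F u v)"
    by (subst sum.reindex) (auto simp: inj_on_def intro!: sum.cong)
  also have "\<dots> = (\<Sum>u\<in>?U. \<Sum>v\<in>?V. (s (f u) * prod_list (map g u)) * (s (h v) * prod_list (map g v)))"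
    unfolding sum.cartesian_product[symmetric] F_def
  proof (intro sum.cong refl)
    fix u v
    show "s (f u) * s (h v) * prod_list (map g (u @ v))
        = (s (f u) * prod_list (map g u)) * (s (h v) * prod_list (map g v))"
      by (simp only: map_append prod_list.append mult.assoc s_prod_list_left[of "h v" u "prod_list (map g v)"])
  qed
  also have "\<dots> = ext s g f * ext s g h"
    by (simp add: ext_def sum_product)
  finally show ?thesis .
qed

end


section \<open>The enveloping algebra acting on polynomials\<close>

definition mul_op :: "'a::comm_ring_1 \<Rightarrow> 'a endo" where
  "mul_op q = Abs_endo (\<lambda>p. q * p)"

definition der_op :: "('a \<Rightarrow> 'a mpoly) \<Rightarrow> 'a mpoly endo" where
  "der_op \<delta> = Abs_endo (der \<delta>)"

lemma app_ops [simp]: "app (mul_op q) p = q * p" "app (der_op \<delta>) r = der \<delta> r"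
  by (simp_all add: mul_op_def der_op_def Abs_endo_inverse distrib_left)

type_synonym op = "(nat \<times> nat) mpoly endo"

definition scal :: "complex \<Rightarrow> op" where
  "scal c = mul_op (Const c)"

fun row_op :: "nat \<times> nat \<Rightarrow> nat \<times> nat \<Rightarrow> (nat \<times> nat) mpoly" where
  "row_op (i, j) (k, l) = (if j = k then Var (i, l) else 0)"

text \<open>
  On functions of a matrix \<open>X\<close>, \<open>der (row_op (i, j))\<close> is the operator \<open>\<Sum>\<^sub>l x\<^sub>i\<^sub>l \<partial>/\<partial>x\<^sub>j\<^sub>l\<close>.  The
  extra term comes from conjugating it with \<open>exp (\<Sum>\<^sub>j y\<^sub>j x\<^sub>j\<^sub>j)\<close>, for a diagonal matrix \<open>y\<close>.
  With all \<open>y\<^sub>j = 1\<close> the letter \<open>(i, j)\<close> acts as multiplication by \<open>x\<^sub>i\<^sub>j\<close> up to terms of lower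
  degree; where \<open>y\<^sub>j = 0\<close> it kills the constants.
\<close>

definition letter_op :: "(nat \<Rightarrow> complex) \<Rightarrow> nat \<times> nat \<Rightarrow> op" where
  "letter_op y l = der_op (row_op l) + mul_op (Const (y (snd l)) * Var l)"

lemma app_letter_op [simp]:
  "app (letter_op y l) p = der (row_op l) p + Const (y (snd l)) * Var l * p"
  by (simp add: letter_op_def)

lemma app_scal [simp]: "app (scal c) p = Const c * p"
  by (simp add: scal_def)

lemma der_zero_fun [simp]: "der (\<lambda>a. 0) p = 0"
  using der_scale[of 0 "\<lambda>a. 0" p] by simp

lemma der_diff_fun: "der (\<lambda>a. \<delta> a - \<epsilon> a) p = der \<delta> p - der \<epsilon> p"
  using der_add_fun[of \<delta> "\<lambda>a. (- 1) * \<epsilon> a" p] by (simp only: der_scale) simp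

text \<open>The derivations satisfy the relations because their values on variables do, and the
  multiplications commute with each other. A derivation for (i, j) with the multiplication for (k,
  l) yields y_l x_il when j = k, which is the multiplication part of the letter (i, l).\<close>

lemma letter_op_commutator:
  "letter_op y (i, j) * letter_op y (k, l) - letter_op y (k, l) * letter_op y (i, j)
    = (if j = k then letter_op y (i, l) else 0) - (if l = i then letter_op y (k, j) else 0)"
proof (rule endo_eqI)
  fix p :: "(nat \<times> nat) mpoly"
  have "der (row_op (i, j)) (der (row_op (k, l)) p) - der (row_op (k, l)) (der (row_op (i, j)) p)
    = der (\<lambda>a. (if j = k then row_op (i, l) a else 0) - (if l = i then row_op (k, j) a else 0)) p"
    unfolding der_commutator by (rule arg_cong[of _ _ "\<lambda>d. der d p"]) (auto simp: fun_eq_iff)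
  also have "\<dots> = (if j = k then der (row_op (i, l)) p else 0) - (if l = i then der (row_op (k, j)) p else 0)"
    unfolding der_diff_fun by simp
  finally have *: "der (row_op (i, j)) (der (row_op (k, l)) p) = der (row_op (k, l)) (der (row_op (i, j)) p)
    + ((if j = k then der (row_op (i, l)) p else 0) - (if l = i then der (row_op (k, j)) p else 0))"
    by (simp add: algebra_simps)
  show "app (letter_op y (i, j) * letter_op y (k, l) - letter_op y (k, l) * letter_op y (i, j)) p
    = app ((if j = k then letter_op y (i, l) else 0) - (if l = i then letter_op y (k, j) else 0)) p"
    by (auto simp: * algebra_simps)
qed

interpretation rho: word_rep scal "letter_op y"
  by unfold_locales (auto intro!: endo_eqI simp: algebra_simps)

interpretation ab: word_rep Const "Var :: 'a \<Rightarrow> 'a mpoly"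
  by unfold_locales (auto simp: mult.commute)

abbreviation rho :: "(nat \<Rightarrow> complex) \<Rightarrow> ((nat \<times> nat) list \<Rightarrow> complex) \<Rightarrow> op" where
  "rho y \<equiv> ext scal (letter_op y)"

text \<open>Letting the letters commute. For words of length at most \<open>d\<close>, the component
  of degree \<open>d\<close> of \<open>ab f\<close> is the symbol.\<close>

abbreviation ab :: "('a list \<Rightarrow> complex) \<Rightarrow> 'a mpoly" where
  "ab \<equiv> ext Const Var"

section \<open>Degrees and leading forms\<close>

abbreviation comp_deg :: "nat \<Rightarrow> 'a mpoly \<Rightarrow> 'a mpoly" where
  "comp_deg d \<equiv> part (\<lambda>m. size m = d)"

definition degle :: "nat \<Rightarrow> 'a mpoly \<Rightarrow> bool" where
  "degle d p \<longleftrightarrow> (\<forall>m\<in>mkeys p. size m \<le> d)"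

lemma degleD: "degle d p \<Longrightarrow> m \<in> mkeys p \<Longrightarrow> size m \<le> d"
  by (simp add: degle_def)

lemma degle_simps [simp]: "degle d 0" "degle d 1" "degle d (Const c)"
  by (auto simp: degle_def Const_def)

lemma degle_add: "degle d p \<Longrightarrow> degle d q \<Longrightarrow> degle d (p + q)"
  unfolding degle_def using Poly_Mapping.keys_add[of p q] by blast

lemma degle_mult:
  assumes "degle d p" "degle e q"
  shows "degle (d + e) (p * q)"
  unfolding degle_def
proof
  fix m assume "m \<in> mkeys (p * q)"
  then obtain k l where "m = k + l" "k \<in> mkeys p" "l \<in> mkeys q"
    using Poly_Mapping.keys_mult[of p q] by blast
  then show "size m \<le> d + e"
    using degleD[OF assms(1)] degleD[OF assms(2)] by (simp add: add_mono)
qed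

lemma degle_mono: "degle d p \<Longrightarrow> d \<le> e \<Longrightarrow> degle e p"
  unfolding degle_def by fastforce

lemma degle_Var [simp]: "degle (Suc d) (Var a)"
  by (auto simp: degle_def)

lemma degle_sum: "(\<And>i. i \<in> I \<Longrightarrow> degle d (f i)) \<Longrightarrow> degle d (sum f I)"
  by (induction I rule: infinite_finite_induct) (auto intro: degle_add)

lemma comp_deg_eq_0: "degle d p \<Longrightarrow> d < e \<Longrightarrow> comp_deg e p = 0"
  by (rule part_eq_0I) (auto dest: degleD)

lemma comp_deg_homog: "homog d p \<Longrightarrow> comp_deg d p = p"
  by (rule part_eq_selfI) (auto dest: homogD)

lemma comp_deg_homog_neq: "homog d p \<Longrightarrow> d \<noteq> e \<Longrightarrow> comp_deg e p = 0"
  by (rule part_eq_0I) (auto dest: homogD)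

lemma homog_comp_deg: "homog d (comp_deg d p)"
  by (simp add: homog_def)

lemma degle_split:
  assumes "degle d p"
  obtains q where "p = comp_deg d p + q" "\<And>m. m \<in> mkeys q \<Longrightarrow> size m < d"
proof
  show "p = comp_deg d p + part (\<lambda>m. size m \<noteq> d) p" by (rule part_split)
  show "size m < d" if "m \<in> mkeys (part (\<lambda>m. size m \<noteq> d) p)" for m
    using that degleD[OF assms, of m] by auto
qed

lemma comp_deg_mult:
  assumes "degle d p" "degle e q"
  shows "comp_deg (d + e) (p * q) = comp_deg d p * comp_deg e q"
proof -
  obtain p' where p: "p = comp_deg d p + p'" and p': "\<And>m. m \<in> mkeys p' \<Longrightarrow> size m < d"
    using degle_split[OF assms(1)] by blast
  obtain q' where q: "q = comp_deg e q + q'" and q': "\<And>m. m \<in> mkeys q' \<Longrightarrow> size m < e"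
    using degle_split[OF assms(2)] by blast
  have pq: "p * q = comp_deg d p * comp_deg e q + (p' * q + comp_deg d p * q')"
    by (subst (1) p, subst (1) q, subst (3) q) (simp add: algebra_simps del: part_simps)
  have 1: "comp_deg (d + e) (p' * q) = 0"
  proof (rule part_eq_0I)
    fix m assume "m \<in> mkeys (p' * q)"
    then obtain k l where "m = k + l" "k \<in> mkeys p'" "l \<in> mkeys q"
      using Poly_Mapping.keys_mult[of p' q] by blast
    then show "size m \<noteq> d + e"
      using p'[of k] degleD[OF assms(2), of l] by simp
  qed
  have 2: "comp_deg (d + e) (comp_deg d p * q') = 0"
  proof (rule part_eq_0I)
    fix m assume "m \<in> mkeys (comp_deg d p * q')"
    then obtain k l where "m = k + l" "k \<in> mkeys (comp_deg d p)" "l \<in> mkeys q'"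
      using Poly_Mapping.keys_mult[of "comp_deg d p" q'] by blast
    then show "size m \<noteq> d + e"
      using q'[of l] by simp
  qed
  show ?thesis
    by (subst pq) (simp add: 1 2 comp_deg_homog[OF homog_mult[OF homog_comp_deg homog_comp_deg]])
qed

lemma homog_Var_keys:
  assumes "k \<in> mkeys (row_op l a)"
  shows "size k = 1"
  using assms by (cases l; cases a) (auto split: if_splits)

lemma der_degree:
  assumes "\<And>a k. k \<in> mkeys (\<delta> a) \<Longrightarrow> size k = 1"
  shows "degle d p \<Longrightarrow> degle d (der \<delta> p)" "homog d p \<Longrightarrow> homog d (der \<delta> p)"
proof -
  have "\<exists>m'\<in>mkeys p. size m = size m'" if m: "m \<in> mkeys (der \<delta> p)" for m
  proof -
    obtain m' a k where *: "m' \<in> mkeys p" "a \<in># m'" "k \<in> mkeys (\<delta> a)" "m = m' - {#a#} + k"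
      using subsetD[OF keys_der m] by blast
    have "size m = size (m' - {#a#}) + 1"
      using assms[OF *(3)] by (simp only: *(4) size_union)
    also have "\<dots> = size m'"
      using *(2) by (metis Suc_eq_plus1 insert_DiffM size_add_mset)
    finally show ?thesis using *(1) by blast
  qed
  then show "degle d p \<Longrightarrow> degle d (der \<delta> p)" "homog d p \<Longrightarrow> homog d (der \<delta> p)"
    unfolding degle_def homog_def by metis+
qed

text \<open>The derivation part of a letter keeps the degree and the multiplication part raises it
  by one, so the degree \<open>length w\<close> is reached only by multiplying every time.\<close>

lemma word_op_one:
  "degle (length w) (app (prod_list (map (letter_op (\<lambda>_. 1)) w)) 1) \<and>
   comp_deg (length w) (app (prod_list (map (letter_op (\<lambda>_. 1)) w)) 1) = Poly_Mapping.single (mset w) 1"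
proof (induction w)
  case Nil
  have "Poly_Mapping.single {#} (1::complex) = (1 :: (nat \<times> nat) mpoly)"
    by (simp flip: zero_multiset_def)
  moreover have "comp_deg 0 (1 :: (nat \<times> nat) mpoly) = 1"
    using comp_deg_homog[of 0 "Const 1 :: (nat \<times> nat) mpoly"] homog_simps(2)[of 1] by simp
  ultimately show ?case by simp
next
  case (Cons a w)
  define q where "q = app (prod_list (map (letter_op (\<lambda>_. 1)) w)) 1"
  have q: "degle (length w) q" "comp_deg (length w) q = Poly_Mapping.single (mset w) 1"
    using Cons.IH by (simp_all add: q_def)
  have d: "degle (length w) (der (row_op a) q)"
    by (rule der_degree(1)[OF homog_Var_keys q(1)])
  have "degle (Suc (length w)) (Var a * q)"
    using degle_mult[of 1 "Var a" "length w" q] q(1) by simp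
  moreover have "comp_deg (Suc (length w)) (Var a * q) = Var a * Poly_Mapping.single (mset w) 1"
    using comp_deg_mult[of 1 "Var a" "length w" q] q comp_deg_homog[OF homog_simps(3)[of a]] by simp
  ultimately show ?case
    using d comp_deg_eq_0[OF d, of "Suc (length w)"]
    by (auto simp flip: q_def simp: single_add_mset intro!: degle_add intro: degle_mono)
qed

lemma ab_word: "prod_list (map Var w) = Poly_Mapping.single (mset w) 1"
  by (induction w) (auto simp: single_add_mset simp flip: zero_multiset_def)

text \<open>The left-hand side depends on \<open>f\<close> only through its operator. This is what
  makes the symbol an invariant of the class of \<open>f\<close>.\<close>

lemma rho_one_symbol:
  assumes "finite {w. f w \<noteq> 0}" "\<And>w. f w \<noteq> 0 \<Longrightarrow> length w \<le> d"
  shows "degle d (app (rho (\<lambda>_. 1) f) 1)"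
    and "comp_deg d (app (rho (\<lambda>_. 1) f) 1) = comp_deg d (ab f)"
proof -
  let ?t = "\<lambda>w. app (prod_list (map (letter_op (\<lambda>_. 1)) w)) 1"
  have e: "app (rho (\<lambda>_. 1) f) 1 = (\<Sum>w | f w \<noteq> 0. Const (f w) * ?t w)"
    by (simp add: ext_def)
  show "degle d (app (rho (\<lambda>_. 1) f) 1)"
    unfolding e
  proof (rule degle_sum)
    fix w assume "w \<in> {w. f w \<noteq> 0}"
    then have "degle d (?t w)"
      using word_op_one[of w] assms(2) degle_mono by blast
    then show "degle d (Const (f w) * ?t w)"
      using degle_mult[of 0 "Const (f w)" d] by simp
  qed
  have "comp_deg d (?t w) = comp_deg d (Poly_Mapping.single (mset w) 1)" if "f w \<noteq> 0" for w
  proof (cases "length w = d")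
    case True
    then show ?thesis
      using word_op_one[of w] comp_deg_homog[of d "Poly_Mapping.single (mset w) 1"]
      by (auto simp: homog_def)
  next
    case False
    then show ?thesis
      using word_op_one[of w] assms(2)[OF that] comp_deg_eq_0[of "length w" "?t w" d]
        comp_deg_homog_neq[of "length w" "Poly_Mapping.single (mset w) 1" d]
      by (auto simp: homog_def)
  qed
  then show "comp_deg d (app (rho (\<lambda>_. 1) f) 1) = comp_deg d (ab f)"
    unfolding e ext_def ab_word by (auto intro!: sum.cong)
qed

section \<open>The Poincare-Birkhoff-Witt property\<close>

abbreviation Fgl :: "nat \<Rightarrow> ((nat \<times> nat) list \<Rightarrow> complex) ring" where
  "Fgl n \<equiv> free_algebra (gl_letters n)"

definition conv :: "('a list \<Rightarrow> complex) \<Rightarrow> ('a list \<Rightarrow> complex) \<Rightarrow> 'a list \<Rightarrow> complex" where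
  "conv f g = (\<lambda>w. \<Sum>i\<le>length w. f (take i w) * g (drop i w))"

lemma free_algebra_carrier:
  "f \<in> carrier (free_algebra S) \<longleftrightarrow> finite {w. f w \<noteq> 0} \<and> (\<forall>w. f w \<noteq> 0 \<longrightarrow> w \<in> lists S)"
  by (auto simp: free_algebra_def)

lemma free_algebra_ops:
  "f \<otimes>\<^bsub>free_algebra S\<^esub> g = conv f g"
  "f \<oplus>\<^bsub>free_algebra S\<^esub> g = (\<lambda>w. f w + g w)"
  "\<zero>\<^bsub>free_algebra S\<^esub> = (\<lambda>w. 0)"
  "\<one>\<^bsub>free_algebra S\<^esub> = word []"
  by (simp_all add: free_algebra_def word_def conv_def)

lemma carrier_finite: "f \<in> carrier (free_algebra S) \<Longrightarrow> finite {w. f w \<noteq> 0}"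
  by (simp add: free_algebra_carrier)

lemma carrier_add:
  "f \<in> carrier (free_algebra S) \<Longrightarrow> g \<in> carrier (free_algebra S) \<Longrightarrow> (\<lambda>w. f w + g w) \<in> carrier (free_algebra S)"
  using ring.ring_simprules(1)[OF ring_free_algebra] by (simp add: free_algebra_ops)

lemma carrier_conv:
  "f \<in> carrier (free_algebra S) \<Longrightarrow> g \<in> carrier (free_algebra S) \<Longrightarrow> conv f g \<in> carrier (free_algebra S)"
  using ring.ring_simprules(5)[OF ring_free_algebra] by (simp add: free_algebra_ops)

lemma carrier_scale:
  "f \<in> carrier (free_algebra S) \<Longrightarrow> (\<lambda>w. c * f w) \<in> carrier (free_algebra S)"
  by (auto simp: free_algebra_carrier elim: rev_finite_subset)

lemma carrier_word: "w \<in> lists S \<Longrightarrow> word w \<in> carrier (free_algebra S)"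
  by (auto simp: free_algebra_carrier word_def)

lemma carrier_diff:
  assumes "f \<in> carrier (free_algebra S)" "g \<in> carrier (free_algebra S)"
  shows "(\<lambda>w. f w - g w) \<in> carrier (free_algebra S)"
  using carrier_add[OF assms(1) carrier_scale[OF assms(2), of "-1"]] by simp

lemma carrier_zero: "(\<lambda>w. 0) \<in> carrier (free_algebra S)"
  by (auto simp: free_algebra_carrier)

lemma carrier_if:
  "(P \<Longrightarrow> f \<in> carrier (free_algebra S)) \<Longrightarrow> (\<lambda>w. if P then f w else 0) \<in> carrier (free_algebra S)"
  by (cases P) (auto intro: carrier_zero)

lemma conv_word_Nil [simp]: "conv (word []) f = f"
proof
  fix w
  have "conv (word []) f w = (\<Sum>i\<in>{0}. word [] (take i w) * f (drop i w))"
    unfolding conv_def by (rule sum.mono_neutral_right) (auto simp: word_def)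
  then show "conv (word []) f w = f w" by (simp add: word_def)
qed

lemma conv_scale: "conv (\<lambda>w. c * f w) g = (\<lambda>w. c * conv f g w)"
  "conv f (\<lambda>w. c * g w) = (\<lambda>w. c * conv f g w)"
  by (simp_all add: conv_def sum_distrib_left mult_ac)

lemma conv_diff: "conv (\<lambda>w. f w - h w) g = (\<lambda>w. conv f g w - conv h g w)"
  "conv g (\<lambda>w. f w - h w) = (\<lambda>w. conv g f w - conv g h w)"
  by (simp_all add: conv_def algebra_simps sum_subtractf)

lemma conv_word_word [simp]: "conv (word u) (word v) = word (u @ v)"
proof
  fix w
  have "conv (word u) (word v) w = (\<Sum>i\<le>length w. if i = length u \<and> w = u @ v then 1 else 0)"
    unfolding conv_def by (intro sum.cong refl) (auto simp: word_def)
  also have "\<dots> = word (u @ v) w"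
    by (cases "w = u @ v") (auto simp: word_def)
  finally show "conv (word u) (word v) w = word (u @ v) w" .
qed

section \<open>Reordering words modulo the relations\<close>

lemma gl_ideal_carrier: "f \<in> gl_ideal n \<Longrightarrow> f \<in> carrier (Fgl n)"
  using ideal.Icarr[OF gl_ideal_ideal] .

lemma gl_ideal_add: "f \<in> gl_ideal n \<Longrightarrow> g \<in> gl_ideal n \<Longrightarrow> (\<lambda>w. f w + g w) \<in> gl_ideal n"
  using additive_subgroup.a_closed[OF ideal.axioms(1)[OF gl_ideal_ideal]] by (simp add: free_algebra_ops)

lemma gl_ideal_zero: "(\<lambda>w. 0) \<in> gl_ideal n"
  using additive_subgroup.zero_closed[OF ideal.axioms(1)[OF gl_ideal_ideal]] by (simp add: free_algebra_ops)

lemma gl_ideal_conv_left: "f \<in> gl_ideal n \<Longrightarrow> x \<in> carrier (Fgl n) \<Longrightarrow> conv x f \<in> gl_ideal n"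
  using ideal.I_l_closed[OF gl_ideal_ideal] by (simp add: free_algebra_ops)

lemma gl_ideal_conv_right: "f \<in> gl_ideal n \<Longrightarrow> x \<in> carrier (Fgl n) \<Longrightarrow> conv f x \<in> gl_ideal n"
  using ideal.I_r_closed[OF gl_ideal_ideal] by (simp add: free_algebra_ops)

lemma gl_ideal_scale: "f \<in> gl_ideal n \<Longrightarrow> (\<lambda>w. c * f w) \<in> gl_ideal n"
  using gl_ideal_conv_left[of f n "\<lambda>w. c * word [] w"] carrier_scale[OF carrier_word[of "[]" "gl_letters n"]]
  by (simp add: conv_scale)

lemma gl_ideal_diff: "f \<in> gl_ideal n \<Longrightarrow> g \<in> gl_ideal n \<Longrightarrow> (\<lambda>w. f w - g w) \<in> gl_ideal n"
  using gl_ideal_add[OF _ gl_ideal_scale[of g n "-1"]] by simp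

lemma gl_relation_carrier:
  assumes "(i, j) \<in> gl_letters n" "(k, l) \<in> gl_letters n"
  shows "gl_relation i j k l \<in> carrier (Fgl n)"
  unfolding gl_relation_def
  using assms by (intro carrier_diff carrier_word carrier_if) (auto simp: gl_letters_def)

lemma gl_relation_in_ideal:
  assumes "(i, j) \<in> gl_letters n" "(k, l) \<in> gl_letters n"
  shows "gl_relation i j k l \<in> gl_ideal n"
  unfolding gl_ideal_def
  by (rule subsetD[OF ring.genideal_self[OF ring_free_algebra]]) (use gl_relation_carrier assms in blast)+

text \<open>In the quotient this is the filtration by word length. For \<open>d = 0\<close> it
  amounts to membership in \<open>gl_ideal n\<close>.\<close>

definition lower :: "nat \<Rightarrow> nat \<Rightarrow> ((nat \<times> nat) list \<Rightarrow> complex) \<Rightarrow> bool" where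
  "lower n d f \<longleftrightarrow> (\<exists>g\<in>carrier (Fgl n). (\<forall>w. g w \<noteq> 0 \<longrightarrow> length w < d) \<and> (\<lambda>w. f w - g w) \<in> gl_ideal n)"

lemma lowerI:
  "f \<in> carrier (Fgl n) \<Longrightarrow> (\<And>w. f w \<noteq> 0 \<Longrightarrow> length w < d) \<Longrightarrow> lower n d f"
  unfolding lower_def by (intro bexI[of _ f]) (auto intro: gl_ideal_zero)

lemma lower_ideal: "f \<in> gl_ideal n \<Longrightarrow> lower n d f"
  unfolding lower_def by (intro bexI[of _ "\<lambda>w. 0"]) (auto intro: carrier_zero)

lemma lower_add:
  assumes "lower n d f" "lower n d g"
  shows "lower n d (\<lambda>w. f w + g w)"
proof -
  obtain f' where f': "f' \<in> carrier (Fgl n)" "\<And>w. f' w \<noteq> 0 \<Longrightarrow> length w < d"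
    "(\<lambda>w. f w - f' w) \<in> gl_ideal n"
    using assms(1) unfolding lower_def by blast
  obtain g' where g': "g' \<in> carrier (Fgl n)" "\<And>w. g' w \<noteq> 0 \<Longrightarrow> length w < d"
    "(\<lambda>w. g w - g' w) \<in> gl_ideal n"
    using assms(2) unfolding lower_def by blast
  have "(\<lambda>w. (f w + g w) - (f' w + g' w)) \<in> gl_ideal n"
    using gl_ideal_add[OF f'(3) g'(3)] by (simp add: algebra_simps)
  moreover have "length w < d" if "f' w + g' w \<noteq> 0" for w
    using that f'(2)[of w] g'(2)[of w] by (cases "f' w = 0") auto
  ultimately show ?thesis
    unfolding lower_def by (intro bexI[of _ "\<lambda>w. f' w + g' w"] carrier_add f' g') auto
qed

lemma lower_scale:
  assumes "lower n d f"
  shows "lower n d (\<lambda>w. c * f w)"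
proof -
  obtain f' where f': "f' \<in> carrier (Fgl n)" "\<And>w. f' w \<noteq> 0 \<Longrightarrow> length w < d"
    "(\<lambda>w. f w - f' w) \<in> gl_ideal n"
    using assms unfolding lower_def by blast
  have "(\<lambda>w. c * f w - c * f' w) \<in> gl_ideal n"
    using gl_ideal_scale[OF f'(3), of c] by (simp add: algebra_simps)
  then show ?thesis
    unfolding lower_def by (intro bexI[of _ "\<lambda>w. c * f' w"] carrier_scale f') (use f' in auto)
qed

lemma lower_sum:
  "(\<And>i. i \<in> A \<Longrightarrow> lower n d (f i)) \<Longrightarrow> lower n d (\<lambda>w. \<Sum>i\<in>A. f i w)"
  by (induction A rule: infinite_finite_induct)
    (auto intro: lower_add lower_ideal gl_ideal_zero)

lemma conv_length:
  assumes "conv f g w \<noteq> 0" "\<And>w. f w \<noteq> 0 \<Longrightarrow> length w \<le> a" "\<And>w. g w \<noteq> 0 \<Longrightarrow> length w < b"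
  shows "length w < a + b"
proof -
  have "w \<in> (\<lambda>(u, v). u @ v) ` ({w. f w \<noteq> 0} \<times> {w. g w \<noteq> 0})"
    using conv_support[of f g] assms(1) unfolding conv_def by blast
  then obtain u v where "w = u @ v" "f u \<noteq> 0" "g v \<noteq> 0" by auto
  then show ?thesis using assms(2)[of u] assms(3)[of v] by simp
qed

lemma lower_conv_letter:
  assumes "lower n d f" "a \<in> gl_letters n"
  shows "lower n (Suc d) (conv (word [a]) f)"
proof -
  obtain f' where f': "f' \<in> carrier (Fgl n)" "\<And>w. f' w \<noteq> 0 \<Longrightarrow> length w < d"
    "(\<lambda>w. f w - f' w) \<in> gl_ideal n"
    using assms unfolding lower_def by blast
  have a: "word [a] \<in> carrier (Fgl n)" using assms(2) by (intro carrier_word) auto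
  have "(\<lambda>w. conv (word [a]) f w - conv (word [a]) f' w) \<in> gl_ideal n"
    using gl_ideal_conv_left[OF f'(3) a] by (simp only: conv_diff)
  moreover have "length w < Suc d" if "conv (word [a]) f' w \<noteq> 0" for w
    using conv_length[OF that, of 1 d] f'(2) by (fastforce simp: word_def split: if_splits)
  ultimately show ?thesis
    unfolding lower_def by (intro bexI[of _ "conv (word [a]) f'"] carrier_conv a f') auto
qed

text \<open>Multiply a defining relation by \<open>word v\<close>: exchanging the first two letters
  costs a bracket, which is linear in the letters, times \<open>v\<close>.\<close>

lemma lower_swap:
  assumes "a \<in> gl_letters n" "b \<in> gl_letters n" "v \<in> lists (gl_letters n)"
  shows "lower n (length v + 2) (\<lambda>w. word (a # b # v) w - word (b # a # v) w)"
proof -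
  obtain i j where a: "a = (i, j)" by fastforce
  obtain k l where b: "b = (k, l)" by fastforce
  define h where "h = (\<lambda>w. (if j = k then word [(i, l)] w else 0) - (if l = i then word [(k, j)] w else 0))"
  have h: "h \<in> carrier (Fgl n)"
    unfolding h_def using assms a b
    by (intro carrier_diff carrier_word carrier_if) (auto simp: gl_letters_def)
  have hl: "length w \<le> 1" if "h w \<noteq> 0" for w
    using that by (auto simp: h_def word_def split: if_splits)
  have v: "word v \<in> carrier (Fgl n)" using assms(3) by (rule carrier_word)
  have r: "gl_relation i j k l \<in> gl_ideal n"
    using assms a b by (intro gl_relation_in_ideal) auto
  have "conv (gl_relation i j k l) (word v)
      = (\<lambda>w. conv (\<lambda>w. word [a, b] w - word [b, a] w) (word v) w - conv h (word v) w)"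
    unfolding conv_diff[symmetric] by (simp add: gl_relation_def h_def a b)
  then have "(\<lambda>w. conv (gl_relation i j k l) (word v) w + conv h (word v) w)
      = (\<lambda>w. word (a # b # v) w - word (b # a # v) w)"
    unfolding conv_diff conv_word_word by (simp add: fun_eq_iff)
  moreover have "lower n (length v + 2) (\<lambda>w. conv (gl_relation i j k l) (word v) w + conv h (word v) w)"
  proof (rule lower_add)
    show "lower n (length v + 2) (conv (gl_relation i j k l) (word v))"
      by (intro lower_ideal gl_ideal_conv_right r v)
    show "lower n (length v + 2) (conv h (word v))"
    proof (intro lowerI carrier_conv h v)
      fix w assume *: "conv h (word v) w \<noteq> 0"
      have "length x < Suc (length v)" if "word v x \<noteq> 0" for x
        using that by (auto simp: word_def split: if_splits)
      from conv_length[OF * hl this] show "length w < length v + 2" by simp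
    qed
  qed
  ultimately show ?thesis by simp
qed

lemma lower_move:
  assumes "a \<in> gl_letters n" "u \<in> lists (gl_letters n)" "v \<in> lists (gl_letters n)"
  shows "lower n (Suc (length (u @ v))) (\<lambda>w. word (a # u @ v) w - word (u @ a # v) w)"
  using assms(2)
proof (induction u rule: list.induct)
  case Nil
  then show ?case by (simp add: lower_ideal gl_ideal_zero)
next
  case (Cons b u)
  have b: "b \<in> gl_letters n" and u: "u \<in> lists (gl_letters n)" using Cons.prems by auto
  have 1: "lower n (length (u @ v) + 2) (\<lambda>w. word (a # b # u @ v) w - word (b # a # u @ v) w)"
    using lower_swap[OF assms(1) b, of "u @ v"] u assms(3) by simp
  have 2: "lower n (Suc (Suc (length (u @ v)))) (\<lambda>w. word (b # a # u @ v) w - word (b # u @ a # v) w)"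
    using lower_conv_letter[OF Cons.IH[OF u] b] by (simp only: conv_diff conv_word_word append_Cons append_Nil)
  show ?case
    using lower_add[OF 1[simplified] 2[simplified]] by simp
qed

lemma lower_permute:
  assumes "mset w = mset w'" "w \<in> lists (gl_letters n)"
  shows "lower n (length w) (\<lambda>x. word w x - word w' x)"
  using assms
proof (induction w arbitrary: w')
  case Nil
  then show ?case by (simp add: lower_ideal gl_ideal_zero)
next
  case (Cons a t)
  have "a \<in> set w'" using Cons.prems(1) by (metis list.set_intros(1) mset_eq_setD)
  then obtain u v where w': "w' = u @ a # v" by (auto simp: in_set_conv_decomp)
  have t: "mset t = mset (u @ v)" using Cons.prems(1) w' by simp
  have a: "a \<in> gl_letters n" "t \<in> lists (gl_letters n)" using Cons.prems(2) by auto
  have "set (u @ v) = set t" using t by (metis mset_eq_setD)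
  then have uv: "u \<in> lists (gl_letters n)" "v \<in> lists (gl_letters n)" using a(2) by auto
  have len: "length t = length (u @ v)" using t by (metis mset_eq_length)
  have 1: "lower n (Suc (length t)) (\<lambda>w. word (a # t) w - word (a # u @ v) w)"
    using lower_conv_letter[OF Cons.IH[OF t a(2)] a(1)]
    by (simp only: conv_diff conv_word_word append_Cons append_Nil)
  have 2: "lower n (Suc (length t)) (\<lambda>w. word (a # u @ v) w - word (u @ a # v) w)"
    using lower_move[OF a(1) uv] by (simp add: len)
  show ?case
    using lower_add[OF 1 2] by (simp add: w')
qed

lemma mlookup_ab:
  "mlookup (ab f) m = (\<Sum>w | f w \<noteq> 0. if mset w = m then f w else 0)"
  unfolding ext_def ab_word
  by (auto simp: lookup_sum mlookup_Const_mult lookup_single when_def intro!: sum.cong)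

text \<open>Reorder each word of length \<open>d\<close> into a word \<open>rep\<close> chosen for
  its multiset, which costs only shorter words. The coefficients that accumulate at the chosen words
  are those of the symbol, hence 0.\<close>

lemma lower_if_symbol_0:
  assumes f: "f \<in> carrier (Fgl n)" "\<And>w. f w \<noteq> 0 \<Longrightarrow> length w \<le> d" and s: "comp_deg d (ab f) = 0"
  shows "lower n d f"
proof -
  define W where "W = {w. f w \<noteq> 0}"
  define V where "V = {w \<in> W. length w = d}"
  have fin: "finite W" "finite V" using f(1) by (auto simp: W_def V_def free_algebra_carrier)
  have lists: "w \<in> lists (gl_letters n)" if "w \<in> W" for w
    using that f(1) by (auto simp: W_def free_algebra_carrier)
  define rep :: "(nat \<times> nat) multiset \<Rightarrow> (nat \<times> nat) list" where "rep m = (SOME w. mset w = m)" for m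
  have rep: "mset (rep m) = m" for m
    unfolding rep_def by (metis (mono_tags) ex_mset someI_ex)
  \<comment> \<open>Only a chosen word \<open>x\<close> of length \<open>d\<close> can receive a
    contribution, and what it receives is the coefficient of \<open>mset x\<close> in
    \<open>comp_deg d (ab f)\<close>.\<close>
  have V0: "(\<Sum>w\<in>V. f w * word (rep (mset w)) x) = 0" for x
  proof (cases "x = rep (mset x) \<and> length x = d")
    case True
    have "(\<Sum>w\<in>V. f w * word (rep (mset w)) x) = (\<Sum>w\<in>V. if mset w = mset x then f w else 0)"
      by (intro sum.cong refl) (use True rep in \<open>auto simp: word_def\<close>)
    also have "\<dots> = (\<Sum>w\<in>W. if mset w = mset x then f w else 0)"
    proof (rule sum.mono_neutral_left)
      show "\<forall>w\<in>W - V. (if mset w = mset x then f w else 0) = 0"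
        using True by (auto simp: V_def dest: mset_eq_length)
    qed (use fin in \<open>auto simp: V_def\<close>)
    also have "\<dots> = mlookup (comp_deg d (ab f)) (mset x)"
      using True by (simp add: mlookup_ab W_def)
    finally show ?thesis by (simp add: s)
  next
    case False
    then have "word (rep (mset w)) x = 0" if "w \<in> V" for w
      using that rep[of "mset w"] by (auto simp: word_def V_def dest: mset_eq_length)
    then show ?thesis by simp
  qed
  have "f x = (\<Sum>w\<in>V. f w * (word w x - word (rep (mset w)) x)) + (\<Sum>w\<in>W - V. f w * word w x)" for x
  proof -
    have "f x = (\<Sum>w\<in>W. f w * word w x)"
    proof (cases "x \<in> W")
      case True
      then have "(\<Sum>w\<in>W. f w * word w x) = (\<Sum>w\<in>{x}. f w * word w x)"
        by (intro sum.mono_neutral_right) (use fin in \<open>auto simp: word_def\<close>)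
      then show ?thesis by (simp add: word_def)
    next
      case False
      then show ?thesis
        unfolding W_def word_def by (subst sum.neutral) auto
    qed
    also have "\<dots> = (\<Sum>w\<in>V. f w * word w x) + (\<Sum>w\<in>W - V. f w * word w x)"
      using fin by (subst sum.subset_diff[of V W]) (auto simp: V_def)
    finally show ?thesis
      using V0[of x] by (simp add: right_diff_distrib sum_subtractf)
  qed
  then have eq: "f = (\<lambda>x. (\<Sum>w\<in>V. f w * (word w x - word (rep (mset w)) x)) + (\<Sum>w\<in>W - V. f w * word w x))"
    by (rule HOL.ext)
  have low: "lower n d (\<lambda>x. (\<Sum>w\<in>V. f w * (word w x - word (rep (mset w)) x)) + (\<Sum>w\<in>W - V. f w * word w x))"
  proof (intro lower_add lower_sum lower_scale)
    fix w assume "w \<in> V"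
    then have "w \<in> W" "length w = d" by (auto simp: V_def)
    then show "lower n d (\<lambda>x. word w x - word (rep (mset w)) x)"
      using lower_permute[of w "rep (mset w)" n] lists[of w] rep[of "mset w"] by simp
  next
    fix w assume w: "w \<in> W - V"
    then have "length w < d" using f(2)[of w] by (auto simp: W_def V_def)
    then show "lower n d (word w)"
      using w lists by (intro lowerI carrier_word) (auto simp: word_def split: if_splits)
  qed
  show ?thesis by (subst eq) (rule low)
qed

lemma rho_add:
  "f \<in> carrier (free_algebra S) \<Longrightarrow> g \<in> carrier (free_algebra S) \<Longrightarrow> rho y (\<lambda>w. f w + g w) = rho y f + rho y g"
  by (intro rho.ext_add carrier_finite)

lemma rho_diff:
  "f \<in> carrier (free_algebra S) \<Longrightarrow> g \<in> carrier (free_algebra S) \<Longrightarrow> rho y (\<lambda>w. f w - g w) = rho y f - rho y g"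
  by (intro rho.ext_diff carrier_finite)

lemma rho_conv:
  "f \<in> carrier (free_algebra S) \<Longrightarrow> g \<in> carrier (free_algebra S) \<Longrightarrow> rho y (conv f g) = rho y f * rho y g"
  unfolding conv_def by (intro rho.ext_conv carrier_finite)

lemma finite_word: "finite {w. word u w \<noteq> 0}"
  by (auto simp: word_def)

lemma rho_gl_relation: "rho y (gl_relation i j k l) = 0"
proof -
  have fin: "finite {w. (if P then word u w else 0) \<noteq> 0}" for P and u :: "(nat \<times> nat) list"
    by (simp add: finite_word)
  have "rho y (\<lambda>w. if P then word u w else 0) = (if P then prod_list (map (letter_op y) u) else 0)" for P u
    by (simp add: rho.ext_word' rho.ext_zero)
  moreover have "finite {w. f w - h w \<noteq> 0}" if "finite {w. f w \<noteq> 0}" "finite {w. h w \<noteq> 0}"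
    for f h :: "(nat \<times> nat) list \<Rightarrow> complex"
    by (rule finite_subset[OF _ finite_UnI[OF that]]) auto
  ultimately have "rho y (gl_relation i j k l)
    = letter_op y (i, j) * letter_op y (k, l) - letter_op y (k, l) * letter_op y (i, j)
      - ((if j = k then letter_op y (i, l) else 0) - (if l = i then letter_op y (k, j) else 0))"
    unfolding gl_relation_def by (simp add: rho.ext_diff fin finite_word rho.ext_word')
  then show ?thesis by (simp add: letter_op_commutator)
qed

lemma rho_gl_ideal:
  assumes "f \<in> gl_ideal n"
  shows "rho y f = 0"
proof -
  let ?K = "{f \<in> carrier (Fgl n). rho y f = 0}"
  interpret F: ring "Fgl n" by (rule ring_free_algebra)
  have inv: "\<ominus>\<^bsub>Fgl n\<^esub> f = (\<lambda>w. - f w)" if "f \<in> carrier (Fgl n)" for f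
    using F.minus_equality[of "\<lambda>w. - f w" f] that carrier_scale[OF that, of "-1"]
    by (simp add: free_algebra_ops)
  have "ideal ?K (Fgl n)"
  proof (rule idealI[OF ring_free_algebra])
    show "subgroup ?K (add_monoid (Fgl n))"
    proof (rule F.add.subgroupI)
      show "?K \<subseteq> carrier (Fgl n)" by auto
      show "?K \<noteq> {}" using carrier_zero rho.ext_zero by blast
    next
      fix a assume "a \<in> ?K"
      then show "\<ominus>\<^bsub>Fgl n\<^esub> a \<in> ?K"
        using carrier_scale[of a _ "-1"] rho.ext_scale[of y "-1" a] by (simp add: inv)
    next
      fix a b assume "a \<in> ?K" "b \<in> ?K"
      then show "a \<oplus>\<^bsub>Fgl n\<^esub> b \<in> ?K"
        using carrier_add[of a _ b] rho_add[of a "gl_letters n" b y] by (simp add: free_algebra_ops)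
    qed
  next
    fix a x assume "a \<in> ?K" "x \<in> carrier (Fgl n)"
    then show "x \<otimes>\<^bsub>Fgl n\<^esub> a \<in> ?K" "a \<otimes>\<^bsub>Fgl n\<^esub> x \<in> ?K"
      using carrier_conv[of a "gl_letters n" x] carrier_conv[of x "gl_letters n" a]
        rho_conv[of a "gl_letters n" x y] rho_conv[of x "gl_letters n" a y]
      by (simp_all add: free_algebra_ops)
  qed
  moreover have "{gl_relation i j k l | i j k l. (i, j) \<in> gl_letters n \<and> (k, l) \<in> gl_letters n} \<subseteq> ?K"
    using gl_relation_carrier rho_gl_relation by blast
  ultimately have "gl_ideal n \<subseteq> ?K"
    unfolding gl_ideal_def by (rule F.genideal_minimal)
  then show ?thesis using assms by blast
qed

lemma carrier_bounded:
  assumes "f \<in> carrier (free_algebra S)"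
  obtains d where "\<And>w. f w \<noteq> 0 \<Longrightarrow> length w \<le> d"
proof
  show "length w \<le> Max (length ` {w. f w \<noteq> 0})" if "f w \<noteq> 0" for w
    using that carrier_finite[OF assms] by (intro Max_ge) auto
qed

text \<open>If 1 is sent to 0, the top symbol vanishes, so \<open>f\<close> is congruent to a
  combination of shorter words with the same operator. Descending on the length ends at 0. This is
  the faithfulness behind every later comparison of classes.\<close>

theorem gl_ideal_iff:
  assumes "f \<in> carrier (Fgl n)"
  shows "f \<in> gl_ideal n \<longleftrightarrow> app (rho (\<lambda>_. 1) f) 1 = 0"
proof
  assume "app (rho (\<lambda>_. 1) f) 1 = 0"
  moreover obtain d where "\<And>w. f w \<noteq> 0 \<Longrightarrow> length w < d"
    by (metis carrier_bounded[OF assms] less_Suc_eq_le)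
  ultimately show "f \<in> gl_ideal n"
    using assms
  proof (induction d arbitrary: f)
    case 0
    then have "f = (\<lambda>w. 0)" by auto
    then show ?case by (simp add: gl_ideal_zero)
  next
    case (Suc d)
    have len: "\<And>w. f w \<noteq> 0 \<Longrightarrow> length w \<le> d" using Suc.prems(2) by (simp add: less_Suc_eq_le)
    have "comp_deg d (ab f) = 0"
      using rho_one_symbol(2)[OF carrier_finite[OF Suc.prems(3)] len] Suc.prems(1) by simp
    from lower_if_symbol_0[OF Suc.prems(3) len this]
    obtain g where g: "g \<in> carrier (Fgl n)" "\<And>w. g w \<noteq> 0 \<Longrightarrow> length w < d"
      "(\<lambda>w. f w - g w) \<in> gl_ideal n"
      unfolding lower_def by blast
    have "rho (\<lambda>_. 1) g = rho (\<lambda>_. 1) f"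
      using rho_gl_ideal[OF g(3)] rho_diff[OF Suc.prems(3) g(1)] by simp
    then have "g \<in> gl_ideal n"
      using Suc.IH[of g] Suc.prems(1) g by simp
    then show ?case
      using gl_ideal_add[OF g(3), of g] by simp
  qed
qed (simp add: rho_gl_ideal)

section \<open>Capelli elements are central\<close>

definition commutator :: "'r::ring_1 \<Rightarrow> 'r \<Rightarrow> 'r" where
  "commutator x y = x * y - y * x"

lemma commutator_simps [simp]:
  "commutator x 0 = 0" "commutator x 1 = 0" "commutator x (y + z) = commutator x y + commutator x z"
  "commutator x (y - z) = commutator x y - commutator x z"
  "commutator x (- y) = - commutator x y" "commutator x (of_int c) = 0" "commutator x (of_nat n) = 0"
  by (simp_all add: commutator_def algebra_simps mult_of_int_commute mult_of_nat_commute)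

lemma commutator_mult: "commutator x (y * z) = commutator x y * z + y * commutator x z"
  by (simp add: commutator_def algebra_simps)

lemma commutator_sum [simp]: "commutator x (sum f I) = (\<Sum>i\<in>I. commutator x (f i))"
  by (induction I rule: infinite_finite_induct) auto

definition prod_range :: "(nat \<Rightarrow> 'r::monoid_mult) \<Rightarrow> nat \<Rightarrow> nat \<Rightarrow> 'r" where
  "prod_range f m n = prod_list (map f [m..<n])"

lemma prod_range_cong: "(\<And>s. m \<le> s \<Longrightarrow> s < n \<Longrightarrow> f s = g s) \<Longrightarrow> prod_range f m n = prod_range g m n"
  unfolding prod_range_def by (intro arg_cong[of _ _ prod_list] map_cong) auto

lemma prod_range_split:
  assumes "m \<le> s" "s < n"
  shows "prod_range f m n = prod_range f m s * f s * prod_range f (Suc s) n"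
proof -
  have "[m..<n] = [m..<s] @ s # [Suc s..<n]"
    using assms upt_add_eq_append[of m s "n - s"] upt_conv_Cons[of s n] by simp
  then show ?thesis by (simp add: prod_range_def mult.assoc)
qed

lemma commutator_prod_range:
  "commutator x (prod_range f m n)
    = (\<Sum>s=m..<n. prod_range f m s * commutator x (f s) * prod_range f (Suc s) n)"
proof (induction n)
  case 0
  then show ?case by (simp add: prod_range_def)
next
  case (Suc n)
  show ?case
  proof (cases "m \<le> n")
    case True
    have p: "prod_range f k (Suc n) = prod_range f k n * f n" if "k \<le> n" for k
      using that by (simp add: prod_range_def)
    have 1: "prod_range f (Suc n) (Suc n) = 1" by (simp add: prod_range_def)
    have "(\<Sum>s=m..<n. prod_range f m s * commutator x (f s) * prod_range f (Suc s) (Suc n))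
      = (\<Sum>s=m..<n. prod_range f m s * commutator x (f s) * prod_range f (Suc s) n) * f n"
      unfolding sum_distrib_right by (intro sum.cong refl) (simp add: p mult.assoc)
    then show ?thesis
      using True by (simp add: p 1 commutator_mult Suc.IH)
  next
    case False
    then show ?thesis by (simp add: prod_range_def)
  qed
qed

text \<open>\<open>torsion_free\<close> is what allows division by 2 in the sign rules for minors
  and by \<open>fact k\<close> at the end. The indices are unrestricted, so one set of minors serves
  every n.\<close>

locale gl_rep =
  fixes e :: "nat \<times> nat \<Rightarrow> 'r::ring_1"
  assumes relation: "e (i, j) * e (k, l) - e (k, l) * e (i, j)
      = (if j = k then e (i, l) else 0) - (if l = i then e (k, j) else 0)"
    and torsion_free: "of_nat (Suc m) * (x::'r) = 0 \<Longrightarrow> x = 0"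
begin

text \<open>The shift sits where the indices agree, not the positions. For an injective index
  sequence used for both rows and columns this is the Capelli shift; for repeated indices it
  preserves the commutation and exchange rules below.\<close>

definition E :: "int \<Rightarrow> nat \<Rightarrow> nat \<Rightarrow> 'r" where
  "E c i j = e (i, j) + (if i = j then of_int c else 0)"

lemma commutator_E:
  "commutator (e (i, j)) (E c p q) = (if p = j then E c i q else 0) - (if q = i then E c p j else 0)"
proof -
  have "commutator (e (i, j)) (E c p q) = commutator (e (i, j)) (e (p, q))"
    by (simp add: E_def)
  also have "\<dots> = (if j = p then e (i, q) else 0) - (if q = i then e (p, j) else 0)"
    unfolding commutator_def by (rule relation)
  also have "\<dots> = (if p = j then E c i q else 0) - (if q = i then E c p j else 0)"
    by (auto simp: E_def)
  finally show ?thesis .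
qed

text \<open>A column determinant with row indices \<open>a\<close> and column indices
  \<open>b\<close>. Sequences instead of sets allow a single index to be replaced, even by one that
  is already present.\<close>

definition minor :: "nat \<Rightarrow> (nat \<Rightarrow> nat) \<Rightarrow> (nat \<Rightarrow> nat) \<Rightarrow> 'r" where
  "minor k a b = (\<Sum>\<sigma> | \<sigma> permutes {1..k}.
     of_int (sign \<sigma>) * prod_range (\<lambda>s. E (int k - int s) (a (\<sigma> s)) (b s)) 1 (k + 1))"

lemma minor_cong:
  assumes "\<And>s. s \<in> {1..k} \<Longrightarrow> a s = a' s" "\<And>s. s \<in> {1..k} \<Longrightarrow> b s = b' s"
  shows "minor k a b = minor k a' b'"
  unfolding minor_def
proof (intro sum.cong refl arg_cong2[of _ _ _ _ "(*)"] prod_range_cong)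
  fix \<sigma> s assume "\<sigma> \<in> {\<sigma>. \<sigma> permutes {1..k}}" "1 \<le> s" "s < k + 1"
  then have "\<sigma> s \<in> {1..k}" "s \<in> {1..k}"
    using permutes_in_image[of \<sigma> "{1..k}" s] by auto
  then show "E (int k - int s) (a (\<sigma> s)) (b s) = E (int k - int s) (a' (\<sigma> s)) (b' s)"
    using assms by simp
qed

text \<open>Commuting with e_ij is a derivation and does not see the scalar shifts. On one factor it
  turns a row index j into i, or, with a minus sign, a column index i into j.\<close>

lemma commutator_minor:
  "commutator (e (i, j)) (minor k a b) =
     (\<Sum>r\<in>{1..k}. if a r = j then minor k (a(r := i)) b else 0)
     - (\<Sum>s\<in>{1..k}. if b s = i then minor k a (b(s := j)) else 0)"
proof -
  let ?P = "{\<sigma>. \<sigma> permutes {1..k}}"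
  define T where "T \<sigma> a b = of_int (sign \<sigma>) * prod_range (\<lambda>s. E (int k - int s) (a (\<sigma> s)) (b s)) 1 (k + 1)"
    for \<sigma> a b
  have summand: "commutator (e (i, j)) (T \<sigma> a b) =
     (\<Sum>s\<in>{1..k}. (if a (\<sigma> s) = j then T \<sigma> (a(\<sigma> s := i)) b else 0)
       - (if b s = i then T \<sigma> a (b(s := j)) else 0))" if \<sigma>: "\<sigma> permutes {1..k}" for \<sigma>
  proof -
    let ?f = "\<lambda>s. E (int k - int s) (a (\<sigma> s)) (b s)"
    have inj: "\<sigma> t = \<sigma> s \<longleftrightarrow> t = s" for s t
      using permutes_inj[OF \<sigma>] by (auto simp: inj_def)
    have A: "T \<sigma> (a(\<sigma> s := i)) b = of_int (sign \<sigma>) *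
        (prod_range ?f 1 s * E (int k - int s) i (b s) * prod_range ?f (Suc s) (k + 1))"
      if "s \<in> {1..k}" for s
    proof -
      have "prod_range (\<lambda>t. E (int k - int t) ((a(\<sigma> s := i)) (\<sigma> t)) (b t)) 1 s = prod_range ?f 1 s"
        "prod_range (\<lambda>t. E (int k - int t) ((a(\<sigma> s := i)) (\<sigma> t)) (b t)) (Suc s) (k + 1) = prod_range ?f (Suc s) (k + 1)"
        by (rule prod_range_cong; simp add: inj)+
      then show ?thesis
        unfolding T_def using that by (subst prod_range_split[of 1 s]) auto
    qed
    have B: "T \<sigma> a (b(s := j)) = of_int (sign \<sigma>) *
        (prod_range ?f 1 s * E (int k - int s) (a (\<sigma> s)) j * prod_range ?f (Suc s) (k + 1))"
      if "s \<in> {1..k}" for s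
    proof -
      have "prod_range (\<lambda>t. E (int k - int t) (a (\<sigma> t)) ((b(s := j)) t)) 1 s = prod_range ?f 1 s"
        "prod_range (\<lambda>t. E (int k - int t) (a (\<sigma> t)) ((b(s := j)) t)) (Suc s) (k + 1) = prod_range ?f (Suc s) (k + 1)"
        by (rule prod_range_cong; simp)+
      then show ?thesis
        unfolding T_def using that by (subst prod_range_split[of 1 s]) auto
    qed
    have "commutator (e (i, j)) (T \<sigma> a b) = of_int (sign \<sigma>) *
      (\<Sum>s=1..<k + 1. prod_range ?f 1 s * commutator (e (i, j)) (?f s) * prod_range ?f (Suc s) (k + 1))"
      unfolding T_def commutator_mult commutator_prod_range by simp
    also have "{1..<k + 1} = {1..k}" by auto
    also have "of_int (sign \<sigma>) *
      (\<Sum>s\<in>{1..k}. prod_range ?f 1 s * commutator (e (i, j)) (?f s) * prod_range ?f (Suc s) (k + 1))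
      = (\<Sum>s\<in>{1..k}. (if a (\<sigma> s) = j then T \<sigma> (a(\<sigma> s := i)) b else 0)
       - (if b s = i then T \<sigma> a (b(s := j)) else 0))"
      unfolding sum_distrib_left
      by (rule sum.cong[OF refl]) (simp add: A B commutator_E algebra_simps)
    finally show ?thesis .
  qed
  have reindex: "(\<Sum>s\<in>{1..k}. if a (\<sigma> s) = j then T \<sigma> (a(\<sigma> s := i)) b else 0)
     = (\<Sum>r\<in>{1..k}. if a r = j then T \<sigma> (a(r := i)) b else 0)" if "\<sigma> permutes {1..k}" for \<sigma>
    by (rule sum.reindex_bij_betw[OF permutes_imp_bij[OF that]])
  have swap: "(\<Sum>r\<in>{1..k}. if P r then minor k (u r) (v r) else 0)
      = (\<Sum>\<sigma>\<in>?P. \<Sum>r\<in>{1..k}. if P r then T \<sigma> (u r) (v r) else 0)" for P u v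
    by (subst sum.swap, rule sum.cong[OF refl]) (auto simp: minor_def T_def)
  have "commutator (e (i, j)) (minor k a b) = (\<Sum>\<sigma>\<in>?P. commutator (e (i, j)) (T \<sigma> a b))"
    by (simp add: minor_def T_def)
  also have "\<dots> = (\<Sum>\<sigma>\<in>?P. (\<Sum>r\<in>{1..k}. if a r = j then T \<sigma> (a(r := i)) b else 0)
      - (\<Sum>s\<in>{1..k}. if b s = i then T \<sigma> a (b(s := j)) else 0))"
    by (rule sum.cong[OF refl]) (simp add: summand sum_subtractf reindex del: One_nat_def)
  also have "\<dots> = (\<Sum>r\<in>{1..k}. if a r = j then minor k (a(r := i)) b else 0)
     - (\<Sum>s\<in>{1..k}. if b s = i then minor k a (b(s := j)) else 0)"
    by (simp only: swap sum_subtractf)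
  finally show ?thesis .
qed

text \<open>The order of the factors is fixed by the columns, so permuting rows only reindexes the
  sum.\<close>

lemma minor_permute_rows:
  assumes \<tau>: "\<tau> permutes {1..k}"
  shows "minor k (a \<circ> \<tau>) b = of_int (sign \<tau>) * minor k a b"
proof -
  have "minor k a b = (\<Sum>\<sigma> | \<sigma> permutes {1..k}.
      of_int (sign (\<tau> \<circ> \<sigma>)) * prod_range (\<lambda>s. E (int k - int s) (a ((\<tau> \<circ> \<sigma>) s)) (b s)) 1 (k + 1))"
    unfolding minor_def by (rule setum_permutations_compose_left[OF \<tau>])
  also have "\<dots> = of_int (sign \<tau>) * minor k (a \<circ> \<tau>) b"
    unfolding minor_def sum_distrib_left
    by (rule sum.cong[OF refl])
      (use \<tau> in \<open>simp add: sign_compose permutes_imp_permutation[OF finite_atLeastAtMost] mult.assoc\<close>)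
  finally show ?thesis
    by (simp flip: mult.assoc of_int_mult)
qed

text \<open>This is antisymmetry in the columns for a product of two columns that is already
  antisymmetrised in the rows. The commutator terms cancel because the shift drops by exactly 1 from
  one column to the next, which explains the Capelli shifts \<open>k - s\<close>.\<close>

lemma E_exchange:
  "E c p q * E (c - 1) p' q' - E c p' q * E (c - 1) p q'
    + E c p q' * E (c - 1) p' q - E c p' q' * E (c - 1) p q = 0"
proof -
  define F where "F = E (c - 1)"
  have E: "E c i j = F i j + (if i = j then 1 else 0)" for i j
    by (simp add: F_def E_def)
  have F: "F i j * F k l - F k l * F i j = (if k = j then F i l else 0) - (if l = i then F k j else 0)" for i j k l
  proof -
    have "F i j * F k l - F k l * F i j = commutator (e (i, j)) (F k l)"
      unfolding F_def E_def[of _ i j] commutator_def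
      by (simp add: distrib_left distrib_right mult_of_int_commute[of "c - 1"] del: of_int_diff)
    then show ?thesis by (simp add: F_def commutator_E)
  qed
  have "E c p q * F p' q' - E c p' q * F p q' + E c p q' * F p' q - E c p' q' * F p q
    = (F p q * F p' q' - F p' q' * F p q) + (F p q' * F p' q - F p' q * F p q')
      + (if p = q then F p' q' else 0) - (if p' = q then F p q' else 0)
      + (if p = q' then F p' q else 0) - (if p' = q' then F p q else 0)"
    by (simp add: E distrib_right)
  also have "\<dots> = 0"
    unfolding F by auto
  finally show ?thesis by (simp add: F_def)
qed

lemma double_eq_0: "x + x = (0::'r) \<Longrightarrow> x = 0"
  using torsion_free[of 1 x] by (simp add: mult_2)

text \<open>Pairing \<open>\<sigma>\<close> with \<open>\<sigma> \<circ> ?t\<close> isolates the two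
  adjacent columns, where \<open>E_exchange\<close> applies. Each summand is counted twice, hence
  the division by 2.\<close>

lemma minor_swap_adjacent:
  assumes s: "1 \<le> s" "s < k"
  shows "minor k a (b \<circ> transpose s (Suc s)) = - minor k a b"
proof -
  let ?t = "transpose s (Suc s)"
  let ?P = "{\<sigma>. \<sigma> permutes {1..k}}"
  have t: "?t permutes {1..k}" using s by (intro permutes_swap_id) auto
  define T where "T \<sigma> b = of_int (sign \<sigma>) * prod_range (\<lambda>s. E (int k - int s) (a (\<sigma> s)) (b s)) 1 (k + 1)"
    for \<sigma> b
  define L where "L \<sigma> = prod_range (\<lambda>s. E (int k - int s) (a (\<sigma> s)) (b s)) 1 s" for \<sigma>
  define R where "R \<sigma> = prod_range (\<lambda>s. E (int k - int s) (a (\<sigma> s)) (b s)) (Suc (Suc s)) (k + 1)" for \<sigma>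
  define c where "c = int k - int s"
  have split: "prod_range f 1 (k + 1) = prod_range f 1 s * (f s * f (Suc s)) * prod_range f (Suc (Suc s)) (k + 1)"
    for f :: "nat \<Rightarrow> 'r"
    using s prod_range_split[of 1 s "k + 1" f] prod_range_split[of "Suc s" "Suc s" "k + 1" f]
    by (simp add: mult.assoc prod_range_def)
  have Lt: "L (\<sigma> \<circ> ?t) = L \<sigma>" and Rt: "R (\<sigma> \<circ> ?t) = R \<sigma>" for \<sigma>
    unfolding L_def R_def by (rule prod_range_cong; simp)+
  have Lb: "prod_range (\<lambda>x. E (int k - int x) (a (\<sigma> x)) ((b \<circ> ?t) x)) 1 s = L \<sigma>"
    and Rb: "prod_range (\<lambda>x. E (int k - int x) (a (\<sigma> x)) ((b \<circ> ?t) x)) (Suc (Suc s)) (k + 1) = R \<sigma>" for \<sigma>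
    unfolding L_def R_def by (rule prod_range_cong; simp)+
  have c1: "int k - int (Suc s) = c - 1" by (simp add: c_def)
  have T1: "T \<sigma> b = of_int (sign \<sigma>) *
      (L \<sigma> * (E c (a (\<sigma> s)) (b s) * E (c - 1) (a (\<sigma> (Suc s))) (b (Suc s))) * R \<sigma>)" for \<sigma>
    unfolding T_def split L_def[symmetric] R_def[symmetric] c1 by (simp add: c_def)
  have T2: "T \<sigma> (b \<circ> ?t) = of_int (sign \<sigma>) *
      (L \<sigma> * (E c (a (\<sigma> s)) (b (Suc s)) * E (c - 1) (a (\<sigma> (Suc s))) (b s)) * R \<sigma>)" for \<sigma>
    unfolding T_def split Lb Rb c1 by (simp add: c_def)
  have sg: "sign (\<sigma> \<circ> ?t) = - sign \<sigma>" if "\<sigma> permutes {1..k}" for \<sigma>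
    using that t by (simp add: sign_compose permutes_imp_permutation[OF finite_atLeastAtMost] sign_swap_id)
  have zero: "T \<sigma> b + T (\<sigma> \<circ> ?t) b + (T \<sigma> (b \<circ> ?t) + T (\<sigma> \<circ> ?t) (b \<circ> ?t)) = 0"
    if "\<sigma> permutes {1..k}" for \<sigma>
  proof -
    let ?p = "a (\<sigma> s)" and ?p' = "a (\<sigma> (Suc s))" and ?q = "b s" and ?q' = "b (Suc s)"
    have "T \<sigma> b + T (\<sigma> \<circ> ?t) b + (T \<sigma> (b \<circ> ?t) + T (\<sigma> \<circ> ?t) (b \<circ> ?t)) = of_int (sign \<sigma>) *
      (L \<sigma> * (E c ?p ?q * E (c - 1) ?p' ?q' - E c ?p' ?q * E (c - 1) ?p ?q'
        + E c ?p ?q' * E (c - 1) ?p' ?q - E c ?p' ?q' * E (c - 1) ?p ?q) * R \<sigma>)"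
      unfolding T1 T2 Lt Rt sg[OF that] by (simp add: algebra_simps)
    then show ?thesis unfolding E_exchange by simp
  qed
  have m: "minor k a b' = (\<Sum>\<sigma>\<in>?P. T \<sigma> b')" for b'
    by (simp add: minor_def T_def)
  have m': "minor k a b' = (\<Sum>\<sigma>\<in>?P. T (\<sigma> \<circ> ?t) b')" for b'
    unfolding m by (rule sum_permutations_compose_right[OF t])
  let ?x = "minor k a b + minor k a (b \<circ> ?t)"
  have "?x + ?x = (\<Sum>\<sigma>\<in>?P. T \<sigma> b) + (\<Sum>\<sigma>\<in>?P. T (\<sigma> \<circ> ?t) b)
      + ((\<Sum>\<sigma>\<in>?P. T \<sigma> (b \<circ> ?t)) + (\<Sum>\<sigma>\<in>?P. T (\<sigma> \<circ> ?t) (b \<circ> ?t)))"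
    unfolding m[symmetric] m'[symmetric] by (simp add: algebra_simps)
  also have "\<dots> = (\<Sum>\<sigma>\<in>?P. T \<sigma> b + T (\<sigma> \<circ> ?t) b + (T \<sigma> (b \<circ> ?t) + T (\<sigma> \<circ> ?t) (b \<circ> ?t)))"
    by (simp add: sum.distrib)
  also have "\<dots> = 0"
    by (rule sum.neutral) (simp add: zero)
  finally have "?x = 0" by (rule double_eq_0)
  then show ?thesis by (simp add: add_eq_0_iff2 add_eq_0_iff)
qed

text \<open>Induction on the gap \<open>d\<close>: a distant transposition is a closer one
  conjugated by an adjacent one, and three sign changes amount to one.\<close>

lemma minor_swap_columns:
  assumes "1 \<le> s" "s + d < k"
  shows "minor k a (b \<circ> transpose s (Suc (s + d))) = - minor k a b"
  using assms(2)
proof (induction d arbitrary: b)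
  case 0
  then have "s < k" by simp
  from minor_swap_adjacent[OF assms(1) this] show ?case by (simp only: add_0_right)
next
  case (Suc d)
  let ?t = "Suc (s + d)"
  have A: "minor k a (c \<circ> transpose ?t (Suc ?t)) = - minor k a c" for c
    using minor_swap_adjacent[of ?t k a c] Suc.prems assms(1) by linarith
  have B: "minor k a (c \<circ> transpose s ?t) = - minor k a c" for c
    using Suc.IH[of c] Suc.prems by linarith
  have "transpose s (Suc ?t) = transpose ?t (Suc ?t) \<circ> transpose s ?t \<circ> transpose ?t (Suc ?t)"
    by (auto simp: fun_eq_iff transpose_def)
  then have "minor k a (b \<circ> transpose s (Suc ?t))
      = minor k a (((b \<circ> transpose ?t (Suc ?t)) \<circ> transpose s ?t) \<circ> transpose ?t (Suc ?t))"
    by (simp add: comp_assoc)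
  also have "\<dots> = - minor k a b"
    by (simp only: A B minus_minus)
  finally show ?case by (simp only: add_Suc_right)
qed

lemma minor_permute_columns:
  assumes \<tau>: "\<tau> permutes {1..k}"
  shows "minor k a (b \<circ> \<tau>) = of_int (sign \<tau>) * minor k a b"
proof -
  have "\<forall>b. minor k a (b \<circ> \<tau>) = of_int (sign \<tau>) * minor k a b"
    using \<tau> finite_atLeastAtMost
  proof (induction rule: permutes_induct)
    case id
    then show ?case by simp
  next
    case (swap s t p)
    have lt: "minor k a (b \<circ> transpose u v) = - minor k a b" if "u < v" "u \<in> {1..k}" "v \<in> {1..k}" for u v b
      using minor_swap_columns[of u "v - u - 1" k a b] that by simp
    have sw: "minor k a (b \<circ> transpose s t) = - minor k a b" for b
    proof (cases "s < t")
      case True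
      then show ?thesis using lt swap(1,2) by blast
    next
      case False
      then show ?thesis using lt[of t s b] swap(1-3) by (simp add: transpose_commute)
    qed
    have "permutation p"
      using swap(4) permutes_imp_permutation[OF finite_atLeastAtMost] by blast
    then have "sign (transpose s t \<circ> p) = - sign p"
      by (subst sign_compose) (simp_all add: permutation_swap_id sign_swap_id swap(3))
    then show ?case
      using swap(5) by (simp only: comp_assoc[symmetric] sw of_int_minus mult_minus_left mult_minus_right) blast
  qed
  then show ?thesis by blast
qed

lemma minor_permute:
  assumes "\<tau> permutes {1..k}"
  shows "minor k (a \<circ> \<tau>) (a \<circ> \<tau>) = minor k a a"
  by (simp add: minor_permute_rows[OF assms] minor_permute_columns[OF assms] flip: mult.assoc of_int_mult)

lemma minor_not_inj:
  assumes "\<not> inj_on a {1..k}"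
  shows "minor k a b = 0"
proof -
  obtain s t where st: "s \<in> {1..k}" "t \<in> {1..k}" "s \<noteq> t" "a s = a t"
    using assms unfolding inj_on_def by blast
  have "a \<circ> transpose s t = a"
    using st(4) by (auto simp: fun_eq_iff transpose_def)
  then have "minor k a b = - minor k a b"
    using minor_permute_rows[of "transpose s t" k a b] st permutes_swap_id[OF st(1,2)]
    by (simp add: sign_swap_id)
  then show ?thesis using double_eq_0 by (metis add.right_inverse)
qed

text \<open>Arbitrary sequences, possibly with repetitions: this index set is stable under the
  replacements in \<open>commutator_minor\<close>.\<close>

definition all_minors :: "nat \<Rightarrow> nat \<Rightarrow> 'r" where
  "all_minors k n = (\<Sum>a\<in>{1..k} \<rightarrow>\<^sub>E {1..n}. minor k a a)"

text \<open>Replacing j by i at position \<open>r\<close> matches the sequences with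
  \<open>a r = j\<close> and those with \<open>a r = i\<close>. Under this bijection the row terms
  become the column terms, and they cancel.\<close>

lemma commutator_all_minors:
  assumes ij: "i \<in> {1..n}" "j \<in> {1..n}"
  shows "commutator (e (i, j)) (all_minors k n) = 0"
proof -
  let ?F = "{1..k} \<rightarrow>\<^sub>E {1..n}"
  have fin: "finite ?F" by (intro finite_PiE) auto
  have "(\<Sum>a\<in>?F. if a r = j then minor k (a(r := i)) a else 0)
      = (\<Sum>a\<in>?F. if a r = i then minor k a (a(r := j)) else 0)" if r: "r \<in> {1..k}" for r
  proof -
    have "(\<Sum>a\<in>{a \<in> ?F. a r = j}. minor k (a(r := i)) a) = (\<Sum>a\<in>{a \<in> ?F. a r = i}. minor k a (a(r := j)))"
      by (rule sum.reindex_bij_witness[of _ "\<lambda>a. a(r := j)" "\<lambda>a. a(r := i)"])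
        (use r ij in \<open>auto simp: PiE_iff extensional_def\<close>)
    then show ?thesis
      by (simp only: sum.inter_filter[OF fin])
  qed
  then have "(\<Sum>r\<in>{1..k}. \<Sum>a\<in>?F. if a r = j then minor k (a(r := i)) a else 0)
      = (\<Sum>r\<in>{1..k}. \<Sum>a\<in>?F. if a r = i then minor k a (a(r := j)) else 0)"
    by (rule sum.cong[OF refl])
  then show ?thesis
    unfolding all_minors_def commutator_sum commutator_minor sum_subtractf
    by (subst (1 2) sum.swap) simp
qed

abbreviation nth_elem :: "nat set \<Rightarrow> nat \<Rightarrow> nat" where
  "nth_elem I r \<equiv> sorted_list_of_set I ! (r - 1)"

definition capelli :: "nat \<Rightarrow> nat \<Rightarrow> 'r" where
  "capelli k n = (\<Sum>I\<in>{I. I \<subseteq> {1..n} \<and> card I = k}. minor k (nth_elem I) (nth_elem I))"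

lemma nth_elem_bij:
  assumes "finite I" "card I = k"
  shows "bij_betw (nth_elem I) {1..k} I"
proof -
  have "bij_betw (\<lambda>r. r - 1) {1..k} {..<k}"
    by (rule bij_betw_byWitness[of _ Suc]) auto
  moreover have "bij_betw ((!) (sorted_list_of_set I)) {..<k} I"
    using bij_betw_nth[of "sorted_list_of_set I" "{..<k}" I] assms by simp
  ultimately show ?thesis
    using bij_betw_trans by (fastforce simp: comp_def)
qed

text \<open>Sequences with a repetition contribute 0. An injective one is the increasing enumeration
  of its image composed with a permutation, and permuting rows and columns together changes nothing,
  as the sign occurs twice.\<close>

lemma all_minors_eq: "all_minors k n = of_nat (fact k) * capelli k n"
proof -
  let ?F = "{1..k} \<rightarrow>\<^sub>E {1..n}"
  let ?S = "{I. I \<subseteq> {1..n} \<and> card I = k}"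
  let ?P = "{\<tau>. \<tau> permutes {1..k}}"
  have fin: "finite ?F" by (intro finite_PiE) auto
  have bij: "bij_betw (nth_elem I) {1..k} I" if "I \<in> ?S" for I
    using that finite_subset[of I "{1..n}"] by (intro nth_elem_bij) auto
  have "all_minors k n = (\<Sum>a\<in>{a \<in> ?F. inj_on a {1..k}}. minor k a a)"
    unfolding all_minors_def
    by (rule sum.mono_neutral_right) (use fin in \<open>auto simp: minor_not_inj\<close>)
  also have "\<dots> = (\<Sum>(I, \<tau>)\<in>?S \<times> ?P. minor k (nth_elem I \<circ> \<tau>) (nth_elem I \<circ> \<tau>))"
  proof (rule sum.reindex_bij_witness[symmetric, of _
        "\<lambda>a. (a ` {1..k}, \<lambda>r. if r \<in> {1..k} then inv_into {1..k} (nth_elem (a ` {1..k})) (a r) else r)"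
        "\<lambda>(I, \<tau>). restrict (nth_elem I \<circ> \<tau>) {1..k}"])
    fix x assume x: "x \<in> ?S \<times> ?P"
    then obtain I \<tau> where I: "x = (I, \<tau>)" "I \<in> ?S" "\<tau> permutes {1..k}" by auto
    let ?a = "restrict (nth_elem I \<circ> \<tau>) {1..k}"
    have a: "bij_betw ?a {1..k} I"
    proof (rule iffD2[OF bij_betw_cong])
      show "bij_betw (nth_elem I \<circ> \<tau>) {1..k} I"
        by (rule bij_betw_trans[OF permutes_imp_bij[OF I(3)] bij[OF I(2)]])
    qed simp
    then have im: "?a ` {1..k} = I" by (simp only: bij_betw_def)
    have "(if r \<in> {1..k} then inv_into {1..k} (nth_elem I) (?a r) else r) = \<tau> r" for r
      using permutes_in_image[OF I(3), of r] permutes_not_in[OF I(3), of r]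
        bij_betw_inv_into_left[OF bij[OF I(2)], of "\<tau> r"] by simp
    then show "(case case x of (I, \<tau>) \<Rightarrow> restrict (nth_elem I \<circ> \<tau>) {1..k} of
        a \<Rightarrow> (a ` {1..k}, \<lambda>r. if r \<in> {1..k} then inv_into {1..k} (nth_elem (a ` {1..k})) (a r) else r)) = x"
      unfolding I(1) prod.case im by (simp only: prod.inject fun_eq_iff) simp
    show "(case x of (I, \<tau>) \<Rightarrow> restrict (nth_elem I \<circ> \<tau>) {1..k}) \<in> {a \<in> ?F. inj_on a {1..k}}"
    proof -
      have "?a r \<in> {1..n}" if "r \<in> {1..k}" for r
        using im that I(2) by blast
      then have "?a \<in> ?F"
        by (auto simp: PiE_iff simp del: One_nat_def)
      then show ?thesis
        using a unfolding I(1) bij_betw_def by simp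
    qed
    show "minor k (case x of (I, \<tau>) \<Rightarrow> restrict (nth_elem I \<circ> \<tau>) {1..k})
        (case x of (I, \<tau>) \<Rightarrow> restrict (nth_elem I \<circ> \<tau>) {1..k})
      = (case x of (I, \<tau>) \<Rightarrow> minor k (nth_elem I \<circ> \<tau>) (nth_elem I \<circ> \<tau>))"
      unfolding I(1) prod.case by (rule minor_cong) auto
  next
    fix a assume "a \<in> {a \<in> ?F. inj_on a {1..k}}"
    then have a: "a \<in> ?F" "inj_on a {1..k}" by auto
    let ?I = "a ` {1..k}"
    let ?\<tau> = "\<lambda>r. if r \<in> {1..k} then inv_into {1..k} (nth_elem ?I) (a r) else r"
    have I: "?I \<in> ?S" using a by (auto simp: card_image)
    have ab: "bij_betw a {1..k} ?I" using a(2) by (simp add: bij_betw_def)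
    have "bij_betw ?\<tau> {1..k} {1..k}"
    proof (rule iffD2[OF bij_betw_cong])
      show "bij_betw (inv_into {1..k} (nth_elem ?I) \<circ> a) {1..k} {1..k}"
        by (rule bij_betw_trans[OF ab bij_betw_inv_into[OF bij[OF I]]])
    qed simp
    then have \<tau>: "?\<tau> permutes {1..k}"
      by (rule bij_imp_permutes) (simp only: if_False)
    have "nth_elem ?I (?\<tau> r) = a r" if "r \<in> {1..k}" for r
      using bij_betw_inv_into_right[OF bij[OF I], of "a r"] that by simp
    then have "restrict (nth_elem ?I \<circ> ?\<tau>) {1..k} = a"
      using a(1) by (auto simp: fun_eq_iff PiE_iff extensional_def)
    then show "(case (?I, ?\<tau>) of (I, \<tau>) \<Rightarrow> restrict (nth_elem I \<circ> \<tau>) {1..k}) = a"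
      by simp
    show "(?I, ?\<tau>) \<in> ?S \<times> ?P" using I \<tau> by blast
  qed
  also have "\<dots> = (\<Sum>I\<in>?S. \<Sum>\<tau>\<in>?P. minor k (nth_elem I) (nth_elem I))"
    unfolding sum.cartesian_product[symmetric]
    by (intro sum.cong refl minor_permute) auto
  also have "\<dots> = of_nat (fact k) * capelli k n"
    by (simp add: capelli_def sum_distrib_left card_permutations[of "{1..k}" k] del: One_nat_def)
  finally show ?thesis .
qed

theorem commutator_capelli:
  assumes "i \<in> {1..n}" "j \<in> {1..n}"
  shows "commutator (e (i, j)) (capelli k n) = 0"
proof -
  have "of_nat (fact k) * commutator (e (i, j)) (capelli k n) = commutator (e (i, j)) (all_minors k n)"
    by (simp add: all_minors_eq commutator_mult)
  also have "\<dots> = 0" by (rule commutator_all_minors[OF assms])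
  finally have z: "of_nat (fact k) * commutator (e (i, j)) (capelli k n) = 0" .
  obtain m where "fact k = Suc m" by (metis fact_nonzero not0_implies_Suc)
  with z show ?thesis using torsion_free by metis
qed

end

section \<open>Capelli elements generate the centre\<close>

abbreviation gl_op :: "nat \<times> nat \<Rightarrow> op" where
  "gl_op \<equiv> letter_op (\<lambda>_. 1)"

abbreviation rho1 :: "((nat \<times> nat) list \<Rightarrow> complex) \<Rightarrow> op" where
  "rho1 \<equiv> rho (\<lambda>_. 1)"

lemma scal_simps [simp]:
  "scal 0 = 0" "scal 1 = 1" "scal (a + b) = scal a + scal b" "scal (a * b) = scal a * scal b"
  "scal (- a) = - scal a"
  by (simp_all add: rho.s_0 rho.s_1 rho.s_add rho.s_mult rho.s_uminus)

lemma scal_of_nat: "scal (of_nat n) = of_nat n"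
  by (induction n) auto

lemma scal_of_int: "scal (of_int c) = of_int c"
  by (cases c rule: int_cases2) (simp_all add: scal_of_nat)

interpretation gl: gl_rep gl_op
proof
  show "gl_op (i, j) * gl_op (k, l) - gl_op (k, l) * gl_op (i, j)
      = (if j = k then gl_op (i, l) else 0) - (if l = i then gl_op (k, j) else 0)" for i j k l
    by (rule letter_op_commutator)
next
  fix m and x :: op
  assume "of_nat (Suc m) * x = 0"
  then have "scal (1 / of_nat (Suc m)) * (scal (of_nat (Suc m)) * x) = 0"
    by (simp only: scal_of_nat mult_zero_right)
  then have "scal (1 / of_nat (Suc m) * of_nat (Suc m)) * x = 0"
    by (simp only: scal_simps(4) mult.assoc)
  then show "x = 0" by (simp del: of_nat_Suc scal_simps(4))
qed

text \<open>Here \<open>d\<close> is only an upper bound for the order, and \<open>p\<close> may be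
  0. Sums, products and commutators can thus be treated uniformly even when leading terms
  cancel.\<close>

definition symbol_rel :: "nat \<Rightarrow> nat \<Rightarrow> op \<Rightarrow> (nat \<times> nat) mpoly \<Rightarrow> bool" where
  "symbol_rel n d a p \<longleftrightarrow> (\<exists>f\<in>carrier (Fgl n). (\<forall>w. f w \<noteq> 0 \<longrightarrow> length w \<le> d) \<and>
     rho1 f = a \<and> comp_deg d (ab f) = p)"

lemma symbol_relE:
  assumes "symbol_rel n d a p"
  obtains f where "f \<in> carrier (Fgl n)" "\<And>w. f w \<noteq> 0 \<Longrightarrow> length w \<le> d" "rho1 f = a" "comp_deg d (ab f) = p"
  using assms unfolding symbol_rel_def by blast

lemma symbol_relI:
  assumes "f \<in> carrier (Fgl n)" "\<And>w. f w \<noteq> 0 \<Longrightarrow> length w \<le> d" "rho1 f = a" "comp_deg d (ab f) = p"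
  shows "symbol_rel n d a p"
  using assms unfolding symbol_rel_def by blast

lemma symbol_rel_unique:
  assumes "symbol_rel n d a p" "symbol_rel n d a q"
  shows "p = q"
proof -
  have "r = comp_deg d (app a 1)" if "symbol_rel n d a r" for r
    using that
  proof (rule symbol_relE)
    fix f assume f: "f \<in> carrier (Fgl n)" "\<And>w. f w \<noteq> 0 \<Longrightarrow> length w \<le> d" "rho1 f = a" "comp_deg d (ab f) = r"
    show ?thesis
      using rho_one_symbol(2)[OF carrier_finite[OF f(1)] f(2)] f(3,4) by simp
  qed
  from this[OF assms(1)] this[OF assms(2)] show ?thesis by simp
qed

lemma degle_ab:
  assumes "\<And>w. f w \<noteq> 0 \<Longrightarrow> length w \<le> d"
  shows "degle d (ab f)"
  unfolding ext_def ab_word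
  by (rule degle_sum) (use assms in \<open>auto simp: degle_def in_keys_iff mlookup_Const_mult lookup_single when_def split: if_splits\<close>)

lemma vars_in_ab:
  assumes "f \<in> carrier (free_algebra S)"
  shows "vars_in S (ab f)"
  unfolding ext_def ab_word
proof (rule vars_in_sum, rule vars_in_mult)
  fix w assume "w \<in> {w. f w \<noteq> 0}"
  then have "w \<in> lists S" using assms by (simp add: free_algebra_carrier)
  then show "vars_in S (Poly_Mapping.single (mset w) 1)"
    by (auto simp: vars_in_def)
qed simp

lemma symbol_rel_homog: "symbol_rel n d a p \<Longrightarrow> homog d p"
  by (elim symbol_relE) (use homog_comp_deg in blast)

lemma symbol_rel_vars:
  assumes "symbol_rel n d a p"
  shows "vars_in (gl_letters n) p"
proof -
  obtain f where f: "f \<in> carrier (Fgl n)" "comp_deg d (ab f) = p"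
    using assms by (rule symbol_relE)
  show ?thesis
    unfolding vars_in_def f(2)[symmetric]
    using vars_inD[OF vars_in_ab[OF f(1)]] by auto
qed

lemma symbol_rel_add:
  assumes "symbol_rel n d a p" "symbol_rel n d b q"
  shows "symbol_rel n d (a + b) (p + q)"
proof -
  obtain f where f: "f \<in> carrier (Fgl n)" "\<And>w. f w \<noteq> 0 \<Longrightarrow> length w \<le> d" "rho1 f = a" "comp_deg d (ab f) = p"
    using assms(1) by (rule symbol_relE) blast
  obtain g where g: "g \<in> carrier (Fgl n)" "\<And>w. g w \<noteq> 0 \<Longrightarrow> length w \<le> d" "rho1 g = b" "comp_deg d (ab g) = q"
    using assms(2) by (rule symbol_relE) blast
  show ?thesis
  proof (rule symbol_relI[OF carrier_add[OF f(1) g(1)]])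
    show "length w \<le> d" if "f w + g w \<noteq> 0" for w
      using that f(2)[of w] g(2)[of w] by (cases "f w = 0") auto
    show "rho1 (\<lambda>w. f w + g w) = a + b"
      by (simp only: rho_add[OF f(1) g(1)] f(3) g(3))
    show "comp_deg d (ab (\<lambda>w. f w + g w)) = p + q"
      by (simp only: ab.ext_add[OF carrier_finite[OF f(1)] carrier_finite[OF g(1)]] part_simps f(4) g(4))
  qed
qed

lemma symbol_rel_scale:
  assumes "symbol_rel n d a p"
  shows "symbol_rel n d (scal c * a) (Const c * p)"
proof -
  obtain f where f: "f \<in> carrier (Fgl n)" "\<And>w. f w \<noteq> 0 \<Longrightarrow> length w \<le> d" "rho1 f = a" "comp_deg d (ab f) = p"
    using assms by (rule symbol_relE) blast
  show ?thesis
    by (rule symbol_relI[OF carrier_scale[OF f(1)]])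
      (use f in \<open>auto simp: rho.ext_scale ab.ext_scale\<close>)
qed

lemma symbol_rel_diff:
  assumes "symbol_rel n d a p" "symbol_rel n d b q"
  shows "symbol_rel n d (a - b) (p - q)"
  using symbol_rel_add[OF assms(1) symbol_rel_scale[OF assms(2), of "-1"]] by simp

lemma symbol_rel_mult:
  assumes "symbol_rel n d a p" "symbol_rel n e b q"
  shows "symbol_rel n (d + e) (a * b) (p * q)"
proof -
  obtain f where f: "f \<in> carrier (Fgl n)" "\<And>w. f w \<noteq> 0 \<Longrightarrow> length w \<le> d" "rho1 f = a" "comp_deg d (ab f) = p"
    using assms(1) by (rule symbol_relE) blast
  obtain g where g: "g \<in> carrier (Fgl n)" "\<And>w. g w \<noteq> 0 \<Longrightarrow> length w \<le> e" "rho1 g = b" "comp_deg e (ab g) = q"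
    using assms(2) by (rule symbol_relE) blast
  show ?thesis
  proof (rule symbol_relI[OF carrier_conv[OF f(1) g(1)]])
    show "length w \<le> d + e" if "conv f g w \<noteq> 0" for w
    proof -
      have "length w < d + Suc e"
        by (rule conv_length[OF that f(2)]) (auto simp: less_Suc_eq_le g(2))
      then show ?thesis by simp
    qed
    show "rho1 (conv f g) = a * b"
      by (simp only: rho_conv[OF f(1) g(1)] f(3) g(3))
    have "ab (conv f g) = ab f * ab g"
      unfolding conv_def by (rule ab.ext_conv[OF carrier_finite[OF f(1)] carrier_finite[OF g(1)]])
    moreover have "degle d (ab f)" "degle e (ab g)"
      by (rule degle_ab; fact f(2) g(2))+
    ultimately show "comp_deg (d + e) (ab (conv f g)) = p * q"
      using comp_deg_mult[of d "ab f" e "ab g"] f(4) g(4) by simp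
  qed
qed

lemma symbol_rel_letter:
  assumes "l \<in> gl_letters n"
  shows "symbol_rel n 1 (gl_op l) (Var l)"
proof (rule symbol_relI)
  show "word [l] \<in> carrier (Fgl n)" using assms by (intro carrier_word) auto
  show "length w \<le> 1" if "word [l] w \<noteq> 0" for w
    using that by (auto simp: word_def split: if_splits)
  show "rho1 (word [l]) = gl_op l" by (simp add: rho.ext_word')
  show "comp_deg 1 (ab (word [l])) = Var l"
    unfolding ab.ext_word' using comp_deg_homog[OF homog_simps(3)[of l]] by simp
qed

lemma symbol_rel_const: "symbol_rel n 0 (scal c) (Const c)"
proof (rule symbol_relI)
  show "(\<lambda>w. c * word [] w) \<in> carrier (Fgl n)" by (intro carrier_scale carrier_word) auto
  show "length w \<le> 0" if "c * word [] w \<noteq> 0" for w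
    using that by (auto simp: word_def split: if_splits)
  show "rho1 (\<lambda>w. c * word [] w) = scal c" by (simp add: rho.ext_word)
  show "comp_deg 0 (ab (\<lambda>w. c * word [] w)) = Const c"
    unfolding ab.ext_word using comp_deg_homog[OF homog_simps(2)[of c]] by simp
qed

lemma symbol_rel_zero: "symbol_rel n d 0 0"
  by (rule symbol_relI[OF carrier_zero]) (auto simp: rho.ext_zero ab.ext_zero)

lemma symbol_rel_raise:
  assumes "symbol_rel n d a p" "d < e"
  shows "symbol_rel n e a 0"
proof -
  obtain f where f: "f \<in> carrier (Fgl n)" "\<And>w. f w \<noteq> 0 \<Longrightarrow> length w \<le> d" "rho1 f = a"
    using assms(1) by (rule symbol_relE) blast
  have "length w \<le> e" if "f w \<noteq> 0" for w using f(2)[OF that] assms(2) by simp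
  moreover have "comp_deg e (ab f) = 0"
    by (rule comp_deg_eq_0[OF degle_ab[OF f(2)] assms(2)])
  ultimately show ?thesis
    using f(1,3) by (intro symbol_relI)
qed

lemma symbol_rel_sum:
  "(\<And>i. i \<in> I \<Longrightarrow> symbol_rel n d (f i) (g i)) \<Longrightarrow> symbol_rel n d (sum f I) (sum g I)"
  by (induction I rule: infinite_finite_induct) (auto intro: symbol_rel_zero symbol_rel_add)

lemma symbol_rel_prod_list:
  "(\<And>x. x \<in> set xs \<Longrightarrow> symbol_rel n 1 (f x) (g x)) \<Longrightarrow>
    symbol_rel n (length xs) (prod_list (map f xs)) (prod_list (map g xs))"
proof (induction xs)
  case Nil
  then show ?case using symbol_rel_const[of n 1] by simp
next
  case (Cons x xs)
  then show ?case using symbol_rel_mult[of n 1 "f x" "g x" "length xs"] by simp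
qed

text \<open>The descent step: a zero symbol means that the words of length \<open>d\<close> can be
  reordered away.\<close>

lemma symbol_rel_lower:
  assumes "symbol_rel n d a 0"
  shows "a = 0 \<or> (\<exists>d' p. d' < d \<and> symbol_rel n d' a p)"
proof -
  obtain f where f: "f \<in> carrier (Fgl n)" "\<And>w. f w \<noteq> 0 \<Longrightarrow> length w \<le> d" "rho1 f = a" "comp_deg d (ab f) = 0"
    using assms by (rule symbol_relE) blast
  obtain g where g: "g \<in> carrier (Fgl n)" "\<And>w. g w \<noteq> 0 \<Longrightarrow> length w < d" "(\<lambda>w. f w - g w) \<in> gl_ideal n"
    using lower_if_symbol_0[OF f(1,2,4)] unfolding lower_def by blast
  have ag: "rho1 g = a"
    using rho_gl_ideal[OF g(3)] rho_diff[OF f(1) g(1)] f(3) by simp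
  show ?thesis
  proof (cases d)
    case 0
    then have "g = (\<lambda>w. 0)" using g(2) by auto
    then show ?thesis using ag rho.ext_zero by simp
  next
    case (Suc d')
    have "length w \<le> d'" if "g w \<noteq> 0" for w
      using g(2)[OF that] Suc by simp
    then have "symbol_rel n d' a (comp_deg d' (ab g))"
      using g(1) ag by (intro symbol_relI[of g]) auto
    then show ?thesis using Suc by blast
  qed
qed

lemma symbol_rel_bracket:
  assumes "l \<in> gl_letters n" "x \<in> gl_letters n"
  shows "symbol_rel n 1 (commutator (gl_op l) (gl_op x)) (bracket l x)"
proof -
  obtain i j where l: "l = (i, j)" by fastforce
  obtain k m where x: "x = (k, m)" by fastforce
  have "symbol_rel n 1 ((if j = k then gl_op (i, m) else 0) - (if m = i then gl_op (k, j) else 0))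
      ((if j = k then Var (i, m) else 0) - (if m = i then Var (k, j) else 0))"
    using assms unfolding l x
    by (intro symbol_rel_diff) (auto simp: gl_letters_def intro!: symbol_rel_letter[simplified] symbol_rel_zero)
  then show ?thesis
    unfolding commutator_def l x letter_op_commutator by simp
qed

lemma symbol_rel_commutator_word:
  assumes "l \<in> gl_letters n" "w \<in> lists (gl_letters n)"
  shows "symbol_rel n (length w) (commutator (gl_op l) (prod_list (map gl_op w)))
    (der (bracket l) (Poly_Mapping.single (mset w) 1))"
  using assms(2)
proof (induction w rule: list.induct)
  case Nil
  have "Poly_Mapping.single {#} (1::complex) = (1 :: (nat \<times> nat) mpoly)"
    by (simp flip: zero_multiset_def)
  then show ?case by (simp add: symbol_rel_zero)
next
  case (Cons x w)
  have x: "x \<in> gl_letters n" and w: "w \<in> lists (gl_letters n)" using Cons.prems by auto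
  have W: "symbol_rel n (length w) (prod_list (map gl_op w)) (Poly_Mapping.single (mset w) 1)"
    unfolding ab_word[symmetric] using w by (intro symbol_rel_prod_list symbol_rel_letter) auto
  show ?case
    using symbol_rel_add[OF symbol_rel_mult[OF symbol_rel_bracket[OF assms(1) x] W]
        symbol_rel_mult[OF symbol_rel_letter[OF x] Cons.IH[OF w]]]
    by (simp add: commutator_mult single_add_mset)
qed

lemma commutator_scal: "commutator (gl_op l) (scal c * x) = scal c * commutator (gl_op l) x"
proof -
  have "commutator (gl_op l) (scal c) = 0" by (simp add: commutator_def rho.s_comm)
  then show ?thesis by (simp add: commutator_mult)
qed

text \<open>The bracket of two letters is again linear in the letters, so a commutator with a letter
  does not raise the order; on symbols it is the adjoint derivation.\<close>

lemma symbol_rel_commutator: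
  assumes l: "l \<in> gl_letters n" and a: "symbol_rel n d a p"
  shows "symbol_rel n d (commutator (gl_op l) a) (der (bracket l) p)"
proof -
  obtain f where f: "f \<in> carrier (Fgl n)" "\<And>w. f w \<noteq> 0 \<Longrightarrow> length w \<le> d" "rho1 f = a" "comp_deg d (ab f) = p"
    using a by (rule symbol_relE) blast
  let ?W = "{w. f w \<noteq> 0}"
  have 1: "commutator (gl_op l) a = (\<Sum>w\<in>?W. scal (f w) * commutator (gl_op l) (prod_list (map gl_op w)))"
    by (simp add: f(3)[symmetric] ext_def commutator_scal)
  have 2: "der (bracket l) p = (\<Sum>w\<in>?W. Const (f w) * der (bracket l) (comp_deg d (Poly_Mapping.single (mset w) 1)))"
    by (simp add: f(4)[symmetric] ext_def ab_word)
  show ?thesis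
    unfolding 1 2
  proof (intro symbol_rel_sum symbol_rel_scale)
    fix w assume w: "w \<in> ?W"
    then have wl: "w \<in> lists (gl_letters n)" using f(1) by (simp add: free_algebra_carrier)
    note sw = symbol_rel_commutator_word[OF l wl]
    have h: "homog (length w) (Poly_Mapping.single (mset w) 1)" by (simp add: homog_def)
    show "symbol_rel n d (commutator (gl_op l) (prod_list (map gl_op w)))
        (der (bracket l) (comp_deg d (Poly_Mapping.single (mset w) 1)))"
    proof (cases "length w = d")
      case True
      then show ?thesis using sw comp_deg_homog[OF h] by simp
    next
      case False
      then have "length w < d" using f(2)[of w] w by simp
      then show ?thesis
        using symbol_rel_raise[OF sw] comp_deg_homog_neq[OF h False] by simp
    qed
  qed
qed

section \<open>Symbols of the Capelli elements\<close>

definition diag_letters :: "nat \<Rightarrow> (nat \<times> nat) set" where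
  "diag_letters n = (\<lambda>i. (i, i)) ` {1..n}"

text \<open>A permutation that moves some position produces an off-diagonal factor, which vanishes
  on diagonal matrices.\<close>

lemma diag_prod_range:
  assumes \<sigma>: "\<sigma> permutes {1..k}" and a: "inj_on a {1..k}"
  shows "diag (prod_range (\<lambda>s. Var (a (\<sigma> s), a s)) 1 (k + 1))
    = (if \<sigma> = id then Poly_Mapping.single (mset_set ((\<lambda>s. (a s, a s)) ` {1..k})) 1 else 0)"
proof (cases "\<sigma> = id")
  case True
  have inj: "inj_on (\<lambda>s. (a s, a s)) {1..k}"
    by (rule inj_onI) (use a in \<open>simp only: prod.inject inj_on_eq_iff\<close>)
  have "prod_range (\<lambda>s. Var (a (\<sigma> s), a s)) 1 (k + 1) = prod_list (map Var (map (\<lambda>s. (a s, a s)) [1..<k + 1]))"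
    by (simp add: True prod_range_def comp_def)
  also have "\<dots> = Poly_Mapping.single (image_mset (\<lambda>s. (a s, a s)) (mset_set {1..k})) 1"
  proof -
    have "{1..<k + 1} = {1..k}" by auto
    then show ?thesis
      unfolding ab_word by (simp add: mset_upt del: upt_Suc One_nat_def)
  qed
  also have "\<dots> = Poly_Mapping.single (mset_set ((\<lambda>s. (a s, a s)) ` {1..k})) 1"
    by (simp only: image_mset_mset_set[OF inj])
  finally have *: "prod_range (\<lambda>s. Var (a (\<sigma> s), a s)) 1 (k + 1)
      = Poly_Mapping.single (mset_set ((\<lambda>s. (a s, a s)) ` {1..k})) 1" .
  show ?thesis unfolding * by (auto simp: True diag_single)
next
  case False
  then obtain s where "\<sigma> s \<noteq> s" by (auto simp: fun_eq_iff)
  then have s: "s \<in> {1..k}" "\<sigma> s \<in> {1..k}"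
    using \<sigma> permutes_not_in permutes_in_image by metis+
  have "a (\<sigma> s) \<noteq> a s" using inj_onD[OF a _ s(2) s(1)] \<open>\<sigma> s \<noteq> s\<close> by blast
  then have "diag (Var (a (\<sigma> s), a s)) = 0" by simp
  then show ?thesis
    using False s by (subst prod_range_split[of 1 s]) auto
qed

text \<open>The shifts have order 0 and drop out of the symbol, which is therefore an ordinary
  principal minor.\<close>

lemma symbol_rel_minor:
  assumes a: "bij_betw a {1..k} I" and I: "I \<subseteq> {1..n}"
  shows "\<exists>p. symbol_rel n k (gl.minor k a a) p \<and> diag p = Poly_Mapping.single (mset_set ((\<lambda>i. (i, i)) ` I)) 1"
proof -
  let ?P = "{\<sigma>. \<sigma> permutes {1..k}}"
  define p :: "(nat \<times> nat) mpoly" where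
    "p = (\<Sum>\<sigma>\<in>?P. Const (of_int (sign \<sigma>)) * prod_range (\<lambda>s. Var (a (\<sigma> s), a s)) 1 (k + 1))"
  have an: "a s \<in> {1..n}" if "s \<in> {1..k}" for s
    using bij_betwE[OF a] I that by blast
  have "symbol_rel n k (gl.minor k a a) p"
    unfolding gl.minor_def p_def scal_of_int[symmetric]
  proof (intro symbol_rel_sum symbol_rel_scale)
    fix \<sigma> assume "\<sigma> \<in> ?P"
    then have \<sigma>: "\<sigma> permutes {1..k}" by simp
    have "symbol_rel n (length [1..<k + 1])
        (prod_list (map (\<lambda>s. gl.E (int k - int s) (a (\<sigma> s)) (a s)) [1..<k + 1]))
        (prod_list (map (\<lambda>s. Var (a (\<sigma> s), a s)) [1..<k + 1]))"
    proof (rule symbol_rel_prod_list)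
      fix s assume "s \<in> set [1..<k + 1]"
      then have s: "s \<in> {1..k}" by auto
      then have "\<sigma> s \<in> {1..k}" using permutes_in_image[OF \<sigma>] by blast
      then have l: "(a (\<sigma> s), a s) \<in> gl_letters n" using s an by (auto simp: gl_letters_def)
      have "symbol_rel n 1 (if a (\<sigma> s) = a s then scal (of_int (int k - int s)) else 0) 0"
        using symbol_rel_raise[OF symbol_rel_const, of 1] symbol_rel_zero by simp
      from symbol_rel_add[OF symbol_rel_letter[OF l] this]
      show "symbol_rel n 1 (gl.E (int k - int s) (a (\<sigma> s)) (a s)) (Var (a (\<sigma> s), a s))"
        unfolding gl.E_def scal_of_int by simp
    qed
    then show "symbol_rel n k (prod_range (\<lambda>s. gl.E (int k - int s) (a (\<sigma> s)) (a s)) 1 (k + 1))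
        (prod_range (\<lambda>s. Var (a (\<sigma> s), a s)) 1 (k + 1))"
      unfolding prod_range_def by (simp del: upt_Suc)
  qed
  moreover have "diag p = Poly_Mapping.single (mset_set ((\<lambda>i. (i, i)) ` I)) 1"
  proof -
    have "diag p = (\<Sum>\<sigma>\<in>?P. if \<sigma> = id then Poly_Mapping.single (mset_set ((\<lambda>s. (a s, a s)) ` {1..k})) 1 else 0)"
      unfolding p_def diag_simps
      by (rule sum.cong[OF refl]) (use a in \<open>auto simp: diag_prod_range bij_betw_def simp del: One_nat_def\<close>)
    also have "\<dots> = Poly_Mapping.single (mset_set ((\<lambda>s. (a s, a s)) ` {1..k})) 1"
      by (simp add: sum.delta finite_permutations permutes_id)
    also have "(\<lambda>s. (a s, a s)) ` {1..k} = (\<lambda>i. (i, i)) ` I"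
      using a by (auto simp: bij_betw_def)
    finally show ?thesis .
  qed
  ultimately show ?thesis by blast
qed

lemma symbol_rel_capelli:
  "\<exists>p. symbol_rel n k (gl.capelli k n) p \<and> diag p = esym (diag_letters n) k"
proof -
  let ?S = "{I. I \<subseteq> {1..n} \<and> card I = k}"
  have "\<forall>I\<in>?S. \<exists>p. symbol_rel n k (gl.minor k (gl.nth_elem I) (gl.nth_elem I)) p
      \<and> diag p = Poly_Mapping.single (mset_set ((\<lambda>i. (i, i)) ` I)) 1"
  proof
    fix I assume I: "I \<in> ?S"
    then have "finite I" by (auto intro: finite_subset)
    then show "\<exists>p. symbol_rel n k (gl.minor k (gl.nth_elem I) (gl.nth_elem I)) p
      \<and> diag p = Poly_Mapping.single (mset_set ((\<lambda>i. (i, i)) ` I)) 1"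
      using I by (intro symbol_rel_minor gl.nth_elem_bij) auto
  qed
  from bchoice[OF this] obtain p where p: "\<And>I. I \<in> ?S \<Longrightarrow> symbol_rel n k (gl.minor k (gl.nth_elem I) (gl.nth_elem I)) (p I)"
    "\<And>I. I \<in> ?S \<Longrightarrow> diag (p I) = Poly_Mapping.single (mset_set ((\<lambda>i. (i, i)) ` I)) 1"
    by blast
  have "symbol_rel n k (gl.capelli k n) (sum p ?S)"
    unfolding gl.capelli_def by (rule symbol_rel_sum) (rule p(1))
  moreover have "diag (sum p ?S) = (\<Sum>I\<in>?S. Poly_Mapping.single (mset_set ((\<lambda>i. (i, i)) ` I)) 1)"
    using p(2) by simp
  moreover have "\<dots> = esym (diag_letters n) k"
    unfolding esym_def diag_letters_def
  proof (rule sum.reindex_bij_witness[of _ "\<lambda>B. fst ` B" "\<lambda>I. (\<lambda>i. (i, i)) ` I"])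
    fix B assume B: "B \<in> {B. B \<subseteq> (\<lambda>i. (i, i)) ` {1..n} \<and> card B = k}"
    show "(\<lambda>i. (i, i)) ` fst ` B = B" using B by (force simp: image_image)
    have "snd x = fst x" if "x \<in> B" for x using B that by auto
    then have "inj_on fst B" by (intro inj_onI) (metis prod.expand)
    then show "fst ` B \<in> ?S" using B by (auto simp: card_image)
  next
    fix I assume "I \<in> ?S"
    then show "(\<lambda>i. (i, i)) ` I \<in> {B. B \<subseteq> (\<lambda>i. (i, i)) ` {1..n} \<and> card B = k}"
      by (auto simp: card_image inj_on_def)
  qed (auto simp: image_image)
  ultimately show ?thesis by metis
qed

text \<open>By \<open>zeta_iff\<close> this turns out to be the image of the centre; induction over
  it then replaces any argument with polynomials in the Capelli elements.\<close>

inductive_set capelli_alg :: "nat \<Rightarrow> op set" for n where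
  scal: "scal c \<in> capelli_alg n"
| capelli: "k \<in> {1..n} \<Longrightarrow> gl.capelli k n \<in> capelli_alg n"
| add: "a \<in> capelli_alg n \<Longrightarrow> b \<in> capelli_alg n \<Longrightarrow> a + b \<in> capelli_alg n"
| mult: "a \<in> capelli_alg n \<Longrightarrow> b \<in> capelli_alg n \<Longrightarrow> a * b \<in> capelli_alg n"

lemma capelli_alg_central:
  assumes "a \<in> capelli_alg n" "l \<in> gl_letters n"
  shows "commutator (gl_op l) a = 0"
  using assms(1)
proof induction
  case (scal c)
  then show ?case using commutator_scal[of l c 1] by simp
next
  case (capelli k)
  then show ?case using gl.commutator_capelli assms(2) by (auto simp: gl_letters_def)
qed (auto simp: commutator_mult)

text \<open>Read a polynomial in the elementary symmetric functions as the same expression in the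
  Capelli elements; weights match orders, so symbols follow along.\<close>

lemma gsym_imp_capelli_alg:
  "gsym (diag_letters n) d q \<Longrightarrow> \<exists>b\<in>capelli_alg n. \<exists>p. symbol_rel n d b p \<and> diag p = q"
proof (induction rule: gsym.induct)
  case (zero d)
  then show ?case
    using capelli_alg.scal[of 0 n] symbol_rel_zero[of n d] by (intro bexI[of _ 0] exI[of _ 0]) auto
next
  case (const c)
  then show ?case
    using capelli_alg.scal[of c n] symbol_rel_const[of n c] by (intro bexI[of _ "scal c"] exI[of _ "Const c"]) auto
next
  case (elem k)
  have "card (diag_letters n) = n"
    unfolding diag_letters_def by (subst card_image) (auto simp: inj_on_def)
  then show ?case
    using elem symbol_rel_capelli[of n k] capelli_alg.capelli[of k n] by auto
next
  case (add d p q)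
  then obtain a u b v where "a \<in> capelli_alg n" "b \<in> capelli_alg n" "symbol_rel n d a u" "symbol_rel n d b v"
    "diag u = p" "diag v = q" by blast
  then show ?case
    by (intro bexI[of _ "a + b"] exI[of _ "u + v"]) (auto intro: capelli_alg.add symbol_rel_add)
next
  case (mult d p e q)
  then obtain a u b v where "a \<in> capelli_alg n" "b \<in> capelli_alg n" "symbol_rel n d a u" "symbol_rel n e b v"
    "diag u = p" "diag v = q" by blast
  then show ?case
    by (intro bexI[of _ "a * b"] exI[of _ "u * v"]) (auto intro: capelli_alg.mult symbol_rel_mult)
qed

lemma central_symbol_invariant:
  assumes "symbol_rel n d a p" "\<And>l. l \<in> gl_letters n \<Longrightarrow> commutator (gl_op l) a = 0"
  shows "invariant n p"
  unfolding invariant_def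
proof
  fix l assume l: "l \<in> gl_letters n"
  show "der (bracket l) p = 0"
    using symbol_rel_commutator[OF l assms(1)] assms(2)[OF l] symbol_rel_zero symbol_rel_unique by metis
qed

theorem central_imp_capelli_alg:
  assumes "symbol_rel n d a p" "\<And>l. l \<in> gl_letters n \<Longrightarrow> commutator (gl_op l) a = 0"
  shows "a \<in> capelli_alg n"
  using assms
proof (induction d arbitrary: a p rule: less_induct)
  case (less d)
  note inv = central_symbol_invariant[OF less.prems]
  have "gsym (diag_letters n) d (diag p)"
  proof (rule symmetric_imp_gsym)
    show "finite (diag_letters n)" by (simp add: diag_letters_def)
    show "sym_on (diag_letters n) (diag p)"
      unfolding diag_letters_def by (rule sym_on_diag[OF inv])
    have k: "m \<in> mkeys p \<and> (\<forall>x\<in>#m. fst x = snd x)" if "m \<in> mkeys (diag p)" for m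
      using that by (auto simp: in_keys_iff mlookup_diag split: if_splits)
    show "homog d (diag p)"
      unfolding homog_def using k homogD[OF symbol_rel_homog[OF less.prems(1)]] by blast
    show "vars_in (diag_letters n) (diag p)"
      unfolding vars_in_def
    proof (intro ballI subsetI)
      fix m x assume m: "m \<in> mkeys (diag p)" "x \<in># m"
      then have "x \<in> gl_letters n" "fst x = snd x"
        using k[OF m(1)] vars_inD[OF symbol_rel_vars[OF less.prems(1)]] by blast+
      then show "x \<in> diag_letters n"
        by (cases x) (auto simp: gl_letters_def diag_letters_def)
    qed
  qed
  then obtain b q where b: "b \<in> capelli_alg n" "symbol_rel n d b q" "diag q = diag p"
    using gsym_imp_capelli_alg by blast
  have cb: "commutator (gl_op l) b = 0" if "l \<in> gl_letters n" for l
    by (rule capelli_alg_central[OF b(1) that])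
  have ab: "symbol_rel n d (a - b) (p - q)"
    by (rule symbol_rel_diff[OF less.prems(1) b(2)])
  have cab: "commutator (gl_op l) (a - b) = 0" if "l \<in> gl_letters n" for l
    using less.prems(2)[OF that] cb[OF that] by simp
  \<comment> \<open>The difference is an invariant that vanishes on diagonal matrices. So
    \<open>a - b\<close> has zero symbol, its order bound drops, and the induction hypothesis
    applies to it.\<close>
  have "p - q = 0"
    by (rule invariant_diag_eq_0[OF symbol_rel_vars[OF ab] central_symbol_invariant[OF ab cab]])
      (use b(3) in auto)
  with symbol_rel_lower[of n d "a - b"] ab
  have "a - b = 0 \<or> (\<exists>d' p'. d' < d \<and> symbol_rel n d' (a - b) p')" by simp
  then have "a - b \<in> capelli_alg n"
  proof
    assume "a - b = 0"
    then show ?thesis using capelli_alg.scal[of 0 n] by simp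
  next
    assume "\<exists>d' p'. d' < d \<and> symbol_rel n d' (a - b) p'"
    then show ?thesis using less.IH cab by blast
  qed
  from capelli_alg.add[OF this b(1)] show ?case by simp
qed

section \<open>Transfer to the enveloping algebra\<close>

definition cls :: "nat \<Rightarrow> ((nat \<times> nat) list \<Rightarrow> complex) \<Rightarrow> U_elem" where
  "cls n f = gl_ideal n +>\<^bsub>Fgl n\<^esub> f"

lemma cls_conv_image: "cls n f = (\<lambda>i w. i w + f w) ` gl_ideal n"
  by (auto simp: cls_def a_r_coset_def' free_algebra_ops)

lemma U_carrier: "carrier (U_gl n) = cls n ` carrier (Fgl n)"
  by (auto simp: U_gl_def FactRing_def A_RCOSETS_def' cls_def)

lemma cls_ops:
  assumes "f \<in> carrier (Fgl n)" "g \<in> carrier (Fgl n)"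
  shows "cls n f \<otimes>\<^bsub>U_gl n\<^esub> cls n g = cls n (conv f g)"
    and "cls n f \<oplus>\<^bsub>U_gl n\<^esub> cls n g = cls n (\<lambda>w. f w + g w)"
  using ring_hom_mult[OF ideal.rcos_ring_hom[OF gl_ideal_ideal] assms]
    ring_hom_add[OF ideal.rcos_ring_hom[OF gl_ideal_ideal] assms]
  by (simp_all add: cls_def U_gl_def free_algebra_ops)

lemma cls_one: "\<one>\<^bsub>U_gl n\<^esub> = cls n (word [])"
  using ring_hom_one[OF ideal.rcos_ring_hom[OF gl_ideal_ideal[of n]]]
  by (simp add: cls_def U_gl_def free_algebra_ops)

lemma cls_eqI:
  assumes "f \<in> carrier (Fgl n)" "g \<in> carrier (Fgl n)" "(\<lambda>w. f w - g w) \<in> gl_ideal n"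
  shows "cls n f = cls n g"
proof -
  have "(\<lambda>w. i w + f w) \<in> cls n g" if "i \<in> gl_ideal n" for i
    unfolding cls_conv_image using gl_ideal_add[OF that assms(3)]
    by (rule rev_image_eqI) (simp add: fun_eq_iff)
  moreover have "(\<lambda>w. i w + g w) \<in> cls n f" if "i \<in> gl_ideal n" for i
    unfolding cls_conv_image using gl_ideal_diff[OF that assms(3)]
    by (rule rev_image_eqI) (simp add: fun_eq_iff)
  ultimately show ?thesis
    by (auto simp: cls_conv_image[of n f] cls_conv_image[of n g])
qed

lemma U_cases:
  assumes "X \<in> carrier (U_gl n)"
  obtains f where "f \<in> carrier (Fgl n)" "X = cls n f"
  using assms unfolding U_carrier by blast

text \<open>Any representative will do, because \<open>rho y\<close> kills the relations. As
  \<open>n\<close> is not a parameter, the enveloping algebras of all ranks are mapped to one ring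
  of operators.\<close>

definition phi :: "(nat \<Rightarrow> complex) \<Rightarrow> U_elem \<Rightarrow> op" where
  "phi y X = rho y (SOME f. f \<in> X)"

abbreviation phi1 :: "U_elem \<Rightarrow> op" where
  "phi1 \<equiv> phi (\<lambda>_. 1)"

lemma phi_cls:
  assumes "f \<in> carrier (Fgl n)"
  shows "phi y (cls n f) = rho y f"
proof -
  have "(\<lambda>w. (0::complex) + f w) \<in> cls n f"
    unfolding cls_conv_image using gl_ideal_zero by (rule rev_image_eqI) simp
  then have "(SOME g. g \<in> cls n f) \<in> cls n f"
    by (rule someI[of "\<lambda>g. g \<in> cls n f"])
  then obtain i where i: "i \<in> gl_ideal n" "(SOME g. g \<in> cls n f) = (\<lambda>w. i w + f w)"
    unfolding cls_conv_image by blast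
  show ?thesis
    unfolding phi_def i(2) rho_add[OF gl_ideal_carrier[OF i(1)] assms] rho_gl_ideal[OF i(1)] by simp
qed

lemma phi_add:
  assumes "X \<in> carrier (U_gl n)" "Y \<in> carrier (U_gl n)"
  shows "phi y (X \<oplus>\<^bsub>U_gl n\<^esub> Y) = phi y X + phi y Y"
  using assms by (elim U_cases) (simp add: cls_ops phi_cls carrier_add rho_add)

lemma phi_mult:
  assumes "X \<in> carrier (U_gl n)" "Y \<in> carrier (U_gl n)"
  shows "phi y (X \<otimes>\<^bsub>U_gl n\<^esub> Y) = phi y X * phi y Y"
  using assms by (elim U_cases) (simp add: cls_ops phi_cls carrier_conv rho_conv)

lemma phi_one: "phi y \<one>\<^bsub>U_gl n\<^esub> = 1"
  unfolding cls_one by (subst phi_cls) (auto simp: carrier_word rho.ext_word')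

lemma phi_zero: "phi y \<zero>\<^bsub>U_gl n\<^esub> = 0"
proof -
  interpret U: ring "U_gl n" by (rule ring_U_gl)
  show ?thesis using phi_add[OF U.zero_closed U.zero_closed, of y] by simp
qed

lemma phi_uminus:
  assumes "X \<in> carrier (U_gl n)"
  shows "phi y (\<ominus>\<^bsub>U_gl n\<^esub> X) = - phi y X"
proof -
  interpret U: ring "U_gl n" by (rule ring_U_gl)
  show ?thesis
    using phi_add[OF assms U.a_inv_closed[OF assms], of y] assms
    by (simp add: U.r_neg phi_zero eq_neg_iff_add_eq_0 add.commute)
qed

lemma phi_minus:
  assumes "X \<in> carrier (U_gl n)" "Y \<in> carrier (U_gl n)"
  shows "phi y (X \<ominus>\<^bsub>U_gl n\<^esub> Y) = phi y X - phi y Y"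
proof -
  interpret U: ring "U_gl n" by (rule ring_U_gl)
  show ?thesis using assms by (simp add: a_minus_def phi_add phi_uminus)
qed

text \<open>Sharper than injectivity of \<open>phi1\<close>; in \<open>last_ideal_unique\<close> the
  values at 1 are the only information at hand.\<close>

lemma phi_one_inj:
  assumes "X \<in> carrier (U_gl n)" "Y \<in> carrier (U_gl n)" "app (phi1 X) 1 = app (phi1 Y) 1"
  shows "X = Y"
proof -
  obtain f where f: "f \<in> carrier (Fgl n)" "X = cls n f" using assms(1) by (rule U_cases)
  obtain g where g: "g \<in> carrier (Fgl n)" "Y = cls n g" using assms(2) by (rule U_cases)
  have "(\<lambda>w. f w - g w) \<in> gl_ideal n"
    unfolding gl_ideal_iff[OF carrier_diff[OF f(1) g(1)]] rho_diff[OF f(1) g(1)]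
    using assms(3) by (simp add: f g phi_cls)
  then show ?thesis unfolding f g by (rule cls_eqI[OF f(1) g(1)])
qed

lemma phi1_inj:
  "X \<in> carrier (U_gl n) \<Longrightarrow> Y \<in> carrier (U_gl n) \<Longrightarrow> phi1 X = phi1 Y \<Longrightarrow> X = Y"
  by (rule phi_one_inj) auto

lemma scalar_closed: "cls n (\<lambda>w. c * word [] w) \<in> carrier (U_gl n)"
  unfolding U_carrier by (intro imageI carrier_scale carrier_word) auto

lemma U_smult_closed:
  assumes "X \<in> carrier (U_gl n)"
  shows "U_smult n c X \<in> carrier (U_gl n)"
proof -
  interpret U: ring "U_gl n" by (rule ring_U_gl)
  show ?thesis unfolding U_smult_def cls_def[symmetric] using assms scalar_closed by simp
qed

lemma phi_smult:
  assumes "X \<in> carrier (U_gl n)"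
  shows "phi y (U_smult n c X) = scal c * phi y X"
proof -
  have "phi y (cls n (\<lambda>w. c * word [] w)) = scal c"
    by (subst phi_cls) (auto intro!: carrier_scale carrier_word simp: rho.ext_word)
  then show ?thesis
    unfolding U_smult_def cls_def[symmetric] using phi_mult[OF scalar_closed assms] by simp
qed

lemma gen_closed: "(i, j) \<in> gl_letters n \<Longrightarrow> gen n i j \<in> carrier (U_gl n)"
  unfolding gen_def cls_def[symmetric] U_carrier by (intro imageI carrier_word) auto

lemma phi_gen: "(i, j) \<in> gl_letters n \<Longrightarrow> phi y (gen n i j) = letter_op y (i, j)"
  unfolding gen_def cls_def[symmetric]
  by (subst phi_cls) (auto intro!: carrier_word simp: rho.ext_word')

lemma Fgl_mono: "f \<in> carrier (Fgl n) \<Longrightarrow> f \<in> carrier (Fgl (n + 1))"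
proof -
  have "gl_letters n \<subseteq> gl_letters (n + 1)" by (auto simp: gl_letters_def)
  then show "f \<in> carrier (Fgl n) \<Longrightarrow> f \<in> carrier (Fgl (n + 1))"
    using lists_mono by (fastforce simp: free_algebra_carrier)
qed

text \<open>Membership in the ideals of both ranks is tested by the same operator at 1.\<close>

lemma gl_ideal_mono: "f \<in> gl_ideal n \<Longrightarrow> f \<in> gl_ideal (n + 1)"
  using gl_ideal_iff[of f "n + 1"] gl_ideal_iff[of f n] gl_ideal_carrier[of f n] Fgl_mono[of f n] by blast

lemma U_incl_cls: "U_incl n (cls n f) = cls (n + 1) f"
proof -
  have "U_incl n (cls n f) = (\<Union>i\<in>gl_ideal (n + 1). \<Union>k\<in>gl_ideal n. {\<lambda>w. i w + (k w + f w)})"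
    unfolding U_incl_def set_add_def' cls_conv_image by (simp add: free_algebra_ops)
  also have "\<dots> = (\<lambda>i w. i w + f w) ` gl_ideal (n + 1)"
  proof (intro equalityI subsetI)
    fix x assume "x \<in> (\<Union>i\<in>gl_ideal (n + 1). \<Union>k\<in>gl_ideal n. {\<lambda>w. i w + (k w + f w)})"
    then obtain i k where ik: "i \<in> gl_ideal (n + 1)" "k \<in> gl_ideal n" "x = (\<lambda>w. i w + (k w + f w))"
      by blast
    show "x \<in> (\<lambda>i w. i w + f w) ` gl_ideal (n + 1)"
      using gl_ideal_add[OF ik(1) gl_ideal_mono[OF ik(2)]]
      by (rule rev_image_eqI) (simp add: ik(3) fun_eq_iff)
  next
    fix x assume "x \<in> (\<lambda>i w. i w + f w) ` gl_ideal (n + 1)"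
    then obtain i where i: "i \<in> gl_ideal (n + 1)" "x = (\<lambda>w. i w + f w)" by blast
    then have "x \<in> {\<lambda>w. i w + ((\<lambda>w. 0) w + f w)}" by simp
    then show "x \<in> (\<Union>i\<in>gl_ideal (n + 1). \<Union>k\<in>gl_ideal n. {\<lambda>w. i w + (k w + f w)})"
      using i(1) gl_ideal_zero by blast
  qed
  finally show ?thesis unfolding cls_conv_image .
qed

lemma U_incl_closed: "X \<in> carrier (U_gl n) \<Longrightarrow> U_incl n X \<in> carrier (U_gl (n + 1))"
  by (elim U_cases) (use Fgl_mono in \<open>auto simp: U_incl_cls U_carrier\<close>)

lemma phi_incl: "X \<in> carrier (U_gl n) \<Longrightarrow> phi y (U_incl n X) = phi y X"
proof (elim U_cases)
  fix f assume f: "f \<in> carrier (Fgl n)" "X = cls n f"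
  show "phi y (U_incl n X) = phi y X"
    unfolding f(2) U_incl_cls phi_cls[OF f(1)] by (rule phi_cls[OF Fgl_mono[OF f(1)]])
qed

lemma phi_nat_add_pow:
  assumes "X \<in> carrier (U_gl n)"
  shows "phi y (add_pow (U_gl n) (m::nat) X) = of_nat m * phi y X"
proof -
  interpret U: ring "U_gl n" by (rule ring_U_gl)
  show ?thesis
    by (induction m) (use assms in \<open>auto simp: phi_zero phi_add algebra_simps\<close>)
qed

lemma phi_int_add_pow:
  assumes "X \<in> carrier (U_gl n)"
  shows "phi y (add_pow (U_gl n) (z::int) X) = of_int z * phi y X"
proof -
  interpret U: ring "U_gl n" by (rule ring_U_gl)
  have "add_pow (U_gl n) z X =
      (if z < 0 then \<ominus>\<^bsub>U_gl n\<^esub> add_pow (U_gl n) (nat (- z)) X else add_pow (U_gl n) (nat z) X)"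
    by (simp only: add_pow_def int_pow_def2 a_inv_def)
  then show ?thesis
    using assms by (auto simp: phi_uminus phi_nat_add_pow)
qed

lemma phi_finsum:
  assumes "finite S" "\<And>i. i \<in> S \<Longrightarrow> g i \<in> carrier (U_gl n)"
  shows "finsum (U_gl n) g S \<in> carrier (U_gl n) \<and> phi y (finsum (U_gl n) g S) = (\<Sum>i\<in>S. phi y (g i))"
proof -
  interpret U: ring "U_gl n" by (rule ring_U_gl)
  show ?thesis
    using assms
  proof (induction S rule: finite_induct)
    case empty
    then show ?case by (simp add: phi_zero)
  next
    case (insert x S)
    then show ?case by (simp add: U.finsum_insert Pi_def phi_add)
  qed
qed

lemma phi_foldr:
  assumes "\<And>x. x \<in> set xs \<Longrightarrow> g x \<in> carrier (U_gl n)"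
  shows "foldr (\<otimes>\<^bsub>U_gl n\<^esub>) (map g xs) \<one>\<^bsub>U_gl n\<^esub> \<in> carrier (U_gl n) \<and>
    phi y (foldr (\<otimes>\<^bsub>U_gl n\<^esub>) (map g xs) \<one>\<^bsub>U_gl n\<^esub>) = prod_list (map (\<lambda>x. phi y (g x)) xs)"
proof -
  interpret U: ring "U_gl n" by (rule ring_U_gl)
  show ?thesis
    using assms by (induction xs) (auto simp: phi_one phi_mult)
qed

lemma phi_Capelli:
  "Capelli k n \<in> carrier (U_gl n) \<and> phi1 (Capelli k n) = gl.capelli k n"
proof -
  interpret U: ring "U_gl n" by (rule ring_U_gl)
  let ?S = "{I. I \<subseteq> {1..n} \<and> card I = k}"
  let ?P = "{\<sigma>. \<sigma> permutes {1..k}}"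
  define A where "A I r s = gen n (gl.nth_elem I r) (gl.nth_elem I s)
    \<oplus>\<^bsub>U_gl n\<^esub> (if r = s then add_pow (U_gl n) (int k - int s) \<one>\<^bsub>U_gl n\<^esub> else \<zero>\<^bsub>U_gl n\<^esub>)" for I r s
  define T where "T I \<sigma> = add_pow (U_gl n) (sign \<sigma>)
    (foldr (\<otimes>\<^bsub>U_gl n\<^esub>) (map (\<lambda>s. A I (\<sigma> s) s) [1..<k + 1]) \<one>\<^bsub>U_gl n\<^esub>)" for I and \<sigma> :: "nat \<Rightarrow> nat"
  have A: "A I r s \<in> carrier (U_gl n) \<and> phi1 (A I r s) = gl.E (int k - int s) (gl.nth_elem I r) (gl.nth_elem I s)"
    if I: "I \<in> ?S" and rs: "r \<in> {1..k}" "s \<in> {1..k}" for I r s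
  proof -
    have "finite I" using I by (auto intro: finite_subset)
    then have b: "bij_betw (gl.nth_elem I) {1..k} I" using I by (intro gl.nth_elem_bij) auto
    have "gl.nth_elem I r \<in> I" "gl.nth_elem I s \<in> I"
      using bij_betwE[OF b] rs by blast+
    then have l: "(gl.nth_elem I r, gl.nth_elem I s) \<in> gl_letters n"
      using I unfolding gl_letters_def by blast
    \<comment> \<open>The enumeration of \<open>I\<close> is injective, so the shift at equal
      positions is the shift at equal indices in \<open>gl.E\<close>.\<close>
    have eq: "gl.nth_elem I r = gl.nth_elem I s \<longleftrightarrow> r = s"
      using inj_on_eq_iff[OF bij_betw_imp_inj_on[OF b] rs] .
    define D where "D = (if r = s then add_pow (U_gl n) (int k - int s) \<one>\<^bsub>U_gl n\<^esub> else \<zero>\<^bsub>U_gl n\<^esub>)"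
    have D: "D \<in> carrier (U_gl n)" unfolding D_def by simp
    have pD: "phi1 D = (if r = s then of_int (int k - int s) else 0)"
      unfolding D_def using phi_int_add_pow[OF U.one_closed, of "\<lambda>_. 1" "int k - int s"]
      by (simp add: phi_zero phi_one del: of_int_diff)
    show ?thesis
      unfolding A_def D_def[symmetric] gl.E_def eq
      using phi_add[OF gen_closed[OF l] D] gen_closed[OF l] D by (simp only: U.add.m_closed phi_gen[OF l] pD simp_thms)
  qed
  have T: "T I \<sigma> \<in> carrier (U_gl n) \<and> phi1 (T I \<sigma>) = of_int (sign \<sigma>)
      * prod_range (\<lambda>s. gl.E (int k - int s) (gl.nth_elem I (\<sigma> s)) (gl.nth_elem I s)) 1 (k + 1)"
    if I: "I \<in> ?S" and \<sigma>: "\<sigma> \<in> ?P" for I \<sigma>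
  proof -
    let ?R = "foldr (\<otimes>\<^bsub>U_gl n\<^esub>) (map (\<lambda>s. A I (\<sigma> s) s) [1..<k + 1]) \<one>\<^bsub>U_gl n\<^esub>"
    have s: "\<sigma> s \<in> {1..k}" "s \<in> {1..k}" if "s \<in> set [1..<k + 1]" for s
    proof -
      show "s \<in> {1..k}" using that by auto
      then show "\<sigma> s \<in> {1..k}" using permutes_in_image[of \<sigma> "{1..k}" s] \<sigma> by blast
    qed
    have R: "?R \<in> carrier (U_gl n) \<and> phi1 ?R = prod_list (map (\<lambda>s. phi1 (A I (\<sigma> s) s)) [1..<k + 1])"
      by (rule phi_foldr) (use A[OF I s] in blast)
    have m: "map (\<lambda>s. phi1 (A I (\<sigma> s) s)) [1..<k + 1]
      = map (\<lambda>s. gl.E (int k - int s) (gl.nth_elem I (\<sigma> s)) (gl.nth_elem I s)) [1..<k + 1]"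
      by (rule map_cong[OF refl]) (use A[OF I s] in blast)
    show ?thesis
      unfolding T_def prod_range_def m[symmetric] using R phi_int_add_pow[of ?R n] by simp
  qed
  define C where "C I = (\<Oplus>\<^bsub>U_gl n\<^esub>\<sigma>\<in>?P. T I \<sigma>)" for I
  have C: "C I \<in> carrier (U_gl n) \<and> phi1 (C I) = gl.minor k (gl.nth_elem I) (gl.nth_elem I)"
    if I: "I \<in> ?S" for I
  proof -
    have "C I \<in> carrier (U_gl n) \<and> phi1 (C I) = (\<Sum>\<sigma>\<in>?P. phi1 (T I \<sigma>))"
      unfolding C_def by (rule phi_finsum) (use T[OF I] in \<open>auto simp: finite_permutations\<close>)
    moreover have "(\<Sum>\<sigma>\<in>?P. phi1 (T I \<sigma>)) = gl.minor k (gl.nth_elem I) (gl.nth_elem I)"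
      unfolding gl.minor_def by (rule sum.cong[OF refl]) (use T[OF I] in blast)
    ultimately show ?thesis by simp
  qed
  have "Capelli k n = (\<Oplus>\<^bsub>U_gl n\<^esub>I\<in>?S. C I)"
    unfolding Capelli_def cdet_def C_def T_def A_def ..
  moreover have "(\<Oplus>\<^bsub>U_gl n\<^esub>I\<in>?S. C I) \<in> carrier (U_gl n) \<and> phi1 (\<Oplus>\<^bsub>U_gl n\<^esub>I\<in>?S. C I) = (\<Sum>I\<in>?S. phi1 (C I))"
    by (rule phi_finsum) (use C in auto)
  moreover have "(\<Sum>I\<in>?S. phi1 (C I)) = gl.capelli k n"
    unfolding gl.capelli_def by (rule sum.cong[OF refl]) (use C in blast)
  ultimately show ?thesis by simp
qed

section \<open>The centre and the left ideal in the operator ring\<close>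

definition gl_ops :: "nat \<Rightarrow> op set" where
  "gl_ops n = phi1 ` carrier (U_gl n)"

lemma gl_opsE:
  assumes "a \<in> gl_ops n"
  obtains f where "f \<in> carrier (Fgl n)" "a = rho1 f"
  using assms unfolding gl_ops_def U_carrier by (auto simp: phi_cls)

lemma gl_ops_rho1:
  assumes "f \<in> carrier (Fgl n)"
  shows "rho1 f \<in> gl_ops n"
proof -
  have "cls n f \<in> carrier (U_gl n)" using assms by (simp add: U_carrier)
  then show ?thesis unfolding gl_ops_def phi_cls[OF assms, symmetric] by (rule imageI)
qed

lemma gl_ops_add: "a \<in> gl_ops n \<Longrightarrow> b \<in> gl_ops n \<Longrightarrow> a + b \<in> gl_ops n"
  by (elim gl_opsE) (auto simp flip: rho_add intro: gl_ops_rho1 carrier_add)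

lemma gl_ops_mult: "a \<in> gl_ops n \<Longrightarrow> b \<in> gl_ops n \<Longrightarrow> a * b \<in> gl_ops n"
  by (elim gl_opsE) (auto simp flip: rho_conv intro: gl_ops_rho1 carrier_conv)

lemma gl_ops_scal: "scal c \<in> gl_ops n"
proof -
  have "(\<lambda>w. c * word [] w) \<in> carrier (Fgl n)" by (intro carrier_scale carrier_word) auto
  from gl_ops_rho1[OF this] show ?thesis by (simp add: rho.ext_word)
qed

lemma gl_ops_letter: "l \<in> gl_letters n \<Longrightarrow> gl_op l \<in> gl_ops n"
  using gl_ops_rho1[OF carrier_word[of "[l]" "gl_letters n"]] by (simp add: rho.ext_word')

lemma gl_ops_prod_list: "(\<And>x. x \<in> set xs \<Longrightarrow> f x \<in> gl_ops n) \<Longrightarrow> prod_list (map f xs) \<in> gl_ops n"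
proof (induction xs)
  case Nil
  then show ?case using gl_ops_scal[of 1 n] by simp
qed (auto intro: gl_ops_mult)

lemma gl_ops_mono: "a \<in> gl_ops n \<Longrightarrow> a \<in> gl_ops (n + 1)"
  by (elim gl_opsE) (use gl_ops_rho1 Fgl_mono in blast)

lemma gl_ops_commute:
  assumes a: "\<And>l. l \<in> gl_letters n \<Longrightarrow> commutator (gl_op l) a = 0" "\<And>c. scal c * a = a * scal c"
    and b: "b \<in> gl_ops n"
  shows "a * b = b * a"
proof -
  obtain f where f: "f \<in> carrier (Fgl n)" "b = rho1 f" using b by (rule gl_opsE)
  have "a * prod_list (map gl_op w) = prod_list (map gl_op w) * a" if "w \<in> lists (gl_letters n)" for w
    using that
  proof (induction w rule: list.induct)
    case (Cons l w)
    then have l: "gl_op l * a = a * gl_op l" and IH: "a * prod_list (map gl_op w) = prod_list (map gl_op w) * a"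
      using a(1)[of l] by (auto simp: commutator_def)
    have "a * (gl_op l * prod_list (map gl_op w)) = gl_op l * (a * prod_list (map gl_op w))"
      by (simp only: mult.assoc[symmetric] l)
    then show ?case by (simp add: IH mult.assoc)
  qed simp
  then have w: "a * (scal (f w) * prod_list (map gl_op w)) = scal (f w) * prod_list (map gl_op w) * a"
    if "f w \<noteq> 0" for w
  proof -
    assume *: "\<And>w. w \<in> lists (gl_letters n) \<Longrightarrow> a * prod_list (map gl_op w) = prod_list (map gl_op w) * a"
    have "w \<in> lists (gl_letters n)" using f(1) that by (simp add: free_algebra_carrier)
    note w = *[OF this]
    have "a * (scal (f w) * prod_list (map gl_op w)) = scal (f w) * (a * prod_list (map gl_op w))"
      by (simp only: mult.assoc[symmetric] a(2))
    then show ?thesis by (simp add: w mult.assoc)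
  qed
  show ?thesis
    unfolding f(2) ext_def sum_distrib_left sum_distrib_right by (rule sum.cong[OF refl]) (simp add: w)
qed

lemma gl_ops_commute_scal:
  assumes "a \<in> gl_ops n"
  shows "scal c * a = a * scal c"
  using assms
proof (rule gl_opsE)
  fix f assume "a = rho1 f"
  moreover have "scal c * (scal x * prod_list (map gl_op w)) = scal x * prod_list (map gl_op w) * scal c" for x w
  proof -
    have "scal c * (scal x * prod_list (map gl_op w)) = scal x * (scal c * prod_list (map gl_op w))"
      unfolding mult.assoc[symmetric] scal_simps(4)[symmetric] by (simp only: mult.commute)
    also have "\<dots> = scal x * (prod_list (map gl_op w) * scal c)"
      by (simp only: rho.s_prod_list)
    finally show ?thesis by (simp only: mult.assoc)
  qed
  ultimately show ?thesis
    by (simp add: ext_def sum_distrib_left sum_distrib_right)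
qed

lemma capelli_alg_gl_ops: "a \<in> capelli_alg n \<Longrightarrow> a \<in> gl_ops n"
proof (induction rule: capelli_alg.induct)
  case (capelli k)
  then show ?case using phi_Capelli[of k n] unfolding gl_ops_def by (metis image_eqI)
qed (auto intro: gl_ops_scal gl_ops_add gl_ops_mult)

lemma capelli_alg_commute:
  assumes "a \<in> capelli_alg n" "b \<in> gl_ops n"
  shows "a * b = b * a"
  using capelli_alg_central[OF assms(1)] gl_ops_commute_scal[OF capelli_alg_gl_ops[OF assms(1)]] assms(2)
  by (rule gl_ops_commute)

text \<open>Commuting with the generators of U(gl(n)) puts the operator into
  \<open>capelli_alg\<close> by the descent on the order; conversely, commutation of operators is
  pulled back along the injective \<open>phi1\<close>.\<close>

lemma zeta_iff: "X \<in> zeta n \<longleftrightarrow> X \<in> carrier (U_gl n) \<and> phi1 X \<in> capelli_alg n"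
proof (intro iffI conjI)
  assume X: "X \<in> zeta n"
  then show c: "X \<in> carrier (U_gl n)" by (simp add: zeta_def centralizer_def)
  have comm: "commutator (gl_op l) (phi1 X) = 0" if "l \<in> gl_letters n" for l
  proof -
    obtain i j where l: "l = (i, j)" by fastforce
    have g: "gen n i j \<in> carrier (U_gl n)" using that l by (simp add: gen_closed)
    then have "X \<otimes>\<^bsub>U_gl n\<^esub> gen n i j = gen n i j \<otimes>\<^bsub>U_gl n\<^esub> X"
      using X by (simp add: zeta_def centralizer_def)
    then have "phi1 X * gl_op l = gl_op l * phi1 X"
      using phi_mult[OF c g, of "\<lambda>_. 1"] phi_mult[OF g c, of "\<lambda>_. 1"] phi_gen[of i j n] that l by simp
    then show ?thesis by (simp add: commutator_def)
  qed
  obtain f where f: "f \<in> carrier (Fgl n)" "X = cls n f" using c by (rule U_cases)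
  obtain d where d: "\<And>w. f w \<noteq> 0 \<Longrightarrow> length w \<le> d" using carrier_bounded[OF f(1)] by blast
  have "symbol_rel n d (phi1 X) (comp_deg d (ab f))"
    by (rule symbol_relI[OF f(1) d]) (simp_all add: f phi_cls)
  from central_imp_capelli_alg[OF this comm] show "phi1 X \<in> capelli_alg n" .
next
  interpret U: ring "U_gl n" by (rule ring_U_gl)
  assume X: "X \<in> carrier (U_gl n) \<and> phi1 X \<in> capelli_alg n"
  have "X \<otimes>\<^bsub>U_gl n\<^esub> Y = Y \<otimes>\<^bsub>U_gl n\<^esub> X" if Y: "Y \<in> carrier (U_gl n)" for Y
  proof (rule phi1_inj)
    have "phi1 X * phi1 Y = phi1 Y * phi1 X"
      using X Y by (intro capelli_alg_commute) (auto simp: gl_ops_def)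
    then show "phi1 (X \<otimes>\<^bsub>U_gl n\<^esub> Y) = phi1 (Y \<otimes>\<^bsub>U_gl n\<^esub> X)"
      using X Y by (simp add: phi_mult)
  qed (use X Y in auto)
  then show "X \<in> zeta n" using X by (simp add: zeta_def centralizer_def)
qed

lemma zeta_lift:
  assumes "a \<in> capelli_alg n"
  obtains X where "X \<in> zeta n" "phi1 X = a"
  using capelli_alg_gl_ops[OF assms] assms unfolding gl_ops_def by (auto simp: zeta_iff)

lemma zeta_closed:
  assumes "X \<in> zeta n" "Y \<in> zeta n"
  shows "X \<otimes>\<^bsub>U_gl n\<^esub> Y \<in> zeta n" "X \<oplus>\<^bsub>U_gl n\<^esub> Y \<in> zeta n" "U_smult n c X \<in> zeta n"
proof -
  interpret U: ring "U_gl n" by (rule ring_U_gl)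
  show "X \<otimes>\<^bsub>U_gl n\<^esub> Y \<in> zeta n" "X \<oplus>\<^bsub>U_gl n\<^esub> Y \<in> zeta n" "U_smult n c X \<in> zeta n"
    using assms by (auto simp: zeta_iff phi_mult phi_add phi_smult U_smult_closed intro: capelli_alg.intros)
qed

lemma one_in_zeta: "\<one>\<^bsub>U_gl n\<^esub> \<in> zeta n"
proof -
  interpret U: ring "U_gl n" by (rule ring_U_gl)
  show ?thesis using capelli_alg.scal[of 1 n] by (simp add: zeta_iff phi_one)
qed

lemma zero_in_zeta: "\<zero>\<^bsub>U_gl n\<^esub> \<in> zeta n"
proof -
  interpret U: ring "U_gl n" by (rule ring_U_gl)
  show ?thesis using capelli_alg.scal[of 0 n] by (simp add: zeta_iff phi_zero)
qed

lemma Capelli_in_zeta: "k \<in> {1..n} \<Longrightarrow> Capelli k n \<in> zeta n"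
  using phi_Capelli[of k n] capelli_alg.capelli[of k n] by (simp add: zeta_iff)

section \<open>The left ideal generated by the last column\<close>

definition last_ideal :: "nat \<Rightarrow> U_elem set" where
  "last_ideal m = gen_left_ideal (U_gl m) {gen m i m | i. i \<in> {1..m}}"

definition last_ops :: "nat \<Rightarrow> op set" where
  "last_ops m = phi1 ` last_ideal m"

lemma last_ideal_minimal:
  assumes "left_ideal L (U_gl m)" "\<And>i. i \<in> {1..m} \<Longrightarrow> gen m i m \<in> L"
  shows "last_ideal m \<subseteq> L"
  unfolding last_ideal_def gen_left_ideal_def using assms by auto

lemma last_ideal_carrier: "last_ideal m \<subseteq> carrier (U_gl m)"
proof (rule last_ideal_minimal)
  interpret U: ring "U_gl m" by (rule ring_U_gl)
  show "left_ideal (carrier (U_gl m)) (U_gl m)"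
    unfolding left_ideal_def using U.add.subgroup_self by (auto intro: additive_subgroup.intro)
qed (auto intro: gen_closed simp: gl_letters_def)

lemma last_ideal_gen: "i \<in> {1..m} \<Longrightarrow> gen m i m \<in> last_ideal m"
  unfolding last_ideal_def gen_left_ideal_def by blast

lemma last_ideal_zero: "\<zero>\<^bsub>U_gl m\<^esub> \<in> last_ideal m"
  unfolding last_ideal_def gen_left_ideal_def left_ideal_def
  by (auto intro: additive_subgroup.zero_closed)

lemma last_ideal_add:
  "X \<in> last_ideal m \<Longrightarrow> Y \<in> last_ideal m \<Longrightarrow> X \<oplus>\<^bsub>U_gl m\<^esub> Y \<in> last_ideal m"
  unfolding last_ideal_def gen_left_ideal_def left_ideal_def
  by (auto intro: additive_subgroup.a_closed)

lemma last_ideal_mult: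
  "X \<in> carrier (U_gl m) \<Longrightarrow> Y \<in> last_ideal m \<Longrightarrow> X \<otimes>\<^bsub>U_gl m\<^esub> Y \<in> last_ideal m"
  unfolding last_ideal_def gen_left_ideal_def left_ideal_def by auto

lemma last_ops_gl_ops: "a \<in> last_ops m \<Longrightarrow> a \<in> gl_ops m"
  unfolding last_ops_def gl_ops_def using last_ideal_carrier by blast

lemma last_ops_zero: "0 \<in> last_ops m"
  unfolding last_ops_def using last_ideal_zero by (rule rev_image_eqI) (simp add: phi_zero)

lemma last_ops_add:
  assumes "a \<in> last_ops m" "b \<in> last_ops m"
  shows "a + b \<in> last_ops m"
proof -
  obtain X Y where XY: "X \<in> last_ideal m" "a = phi1 X" "Y \<in> last_ideal m" "b = phi1 Y"
    using assms unfolding last_ops_def by blast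
  then have "X \<in> carrier (U_gl m)" "Y \<in> carrier (U_gl m)"
    using last_ideal_carrier by blast+
  then show ?thesis
    unfolding last_ops_def using last_ideal_add[OF XY(1,3)] XY(2,4)
    by (auto simp: phi_add intro!: rev_image_eqI)
qed

lemma last_ops_mult:
  assumes "a \<in> gl_ops m" "b \<in> last_ops m"
  shows "a * b \<in> last_ops m"
proof -
  obtain X Y where XY: "X \<in> carrier (U_gl m)" "a = phi1 X" "Y \<in> last_ideal m" "b = phi1 Y"
    using assms unfolding last_ops_def gl_ops_def by blast
  then have "Y \<in> carrier (U_gl m)"
    using last_ideal_carrier by blast
  then show ?thesis
    unfolding last_ops_def using last_ideal_mult[OF XY(1,3)] XY
    by (auto simp: phi_mult intro!: rev_image_eqI)
qed

lemma last_ops_sum: "(\<And>i. i \<in> I \<Longrightarrow> f i \<in> last_ops m) \<Longrightarrow> sum f I \<in> last_ops m"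
  by (induction I rule: infinite_finite_induct) (auto intro: last_ops_zero last_ops_add)

lemma last_ops_letter:
  assumes "i \<in> {1..m}"
  shows "gl_op (i, m) \<in> last_ops m"
proof -
  have "(i, m) \<in> gl_letters m" using assms by (auto simp: gl_letters_def)
  then show ?thesis
    unfolding last_ops_def using last_ideal_gen[OF assms] phi_gen[of i m m "\<lambda>_. 1"]
    by (metis image_eqI)
qed

text \<open>
  In the column determinant the entries of the last column come last in every product, and the
  diagonal correction \<open>k - s\<close> vanishes there.
\<close>

lemma minor_in_last_ops:
  assumes I: "I \<subseteq> {1..m}" "card I = k" "m \<in> I"
  shows "gl.minor k (gl.nth_elem I) (gl.nth_elem I) \<in> last_ops m"
proof -
  have fin: "finite I" using I(1) by (rule finite_subset) simp
  note b = gl.nth_elem_bij[OF fin I(2)]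
  have k: "1 \<le> k" using I(2,3) fin by (metis One_nat_def Suc_leI card_gt_0_iff empty_iff)
  have len: "length (sorted_list_of_set I) = k" using I(2) by simp
  \<comment> \<open>As the largest possible index, \<open>m\<close> ends the sorted list, so it
    labels the last column.\<close>
  have last: "gl.nth_elem I k = m"
  proof (rule antisym)
    have "gl.nth_elem I k \<in> I" using bij_betwE[OF b] k by simp
    then show "gl.nth_elem I k \<le> m" using I(1) by auto
    have "m \<in> gl.nth_elem I ` {1..k}"
      by (simp only: bij_betw_imp_surj_on[OF b] I(3))
    then obtain r where r: "r \<in> {1..k}" "gl.nth_elem I r = m" by blast
    have "sorted_list_of_set I ! (r - 1) \<le> sorted_list_of_set I ! (k - 1)"
      by (rule sorted_nth_mono) (use r(1) len k in auto)
    then show "m \<le> gl.nth_elem I k" using r(2) by simp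
  qed
  let ?a = "gl.nth_elem I"
  have a: "?a s \<in> {1..m}" if "s \<in> {1..k}" for s
    using bij_betwE[OF b] I(1) that by blast
  show ?thesis
    unfolding gl.minor_def
  proof (rule last_ops_sum)
    fix \<sigma> assume "\<sigma> \<in> {\<sigma>. \<sigma> permutes {1..k}}"
    then have \<sigma>: "\<sigma> s \<in> {1..k}" if "s \<in> {1..k}" for s
      using that permutes_in_image[of \<sigma> "{1..k}" s] by blast
    let ?f = "\<lambda>s. gl.E (int k - int s) (?a (\<sigma> s)) (?a s)"
    have "prod_range ?f 1 (k + 1) = prod_range ?f 1 k * ?f k"
      using prod_range_split[of 1 k "k + 1" ?f] k by (simp add: prod_range_def)
    also have "?f k = gl_op (?a (\<sigma> k), m)"
      unfolding gl.E_def last by simp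
    finally have eq: "of_int (sign \<sigma>) * prod_range ?f 1 (k + 1)
        = (scal (of_int (sign \<sigma>)) * prod_range ?f 1 k) * gl_op (?a (\<sigma> k), m)"
      by (simp add: scal_of_int mult.assoc)
    have "prod_range ?f 1 k \<in> gl_ops m"
      unfolding prod_range_def
    proof (rule gl_ops_prod_list)
      fix s assume "s \<in> set [1..<k]"
      then have s: "s \<in> {1..k}" by auto
      have "(?a (\<sigma> s), ?a s) \<in> gl_letters m" using a[OF s] a[OF \<sigma>[OF s]] by (simp add: gl_letters_def)
      then have "gl_op (?a (\<sigma> s), ?a s) + (if ?a (\<sigma> s) = ?a s then scal (of_int (int k - int s)) else scal 0) \<in> gl_ops m"
        by (intro gl_ops_add gl_ops_letter) (auto intro: gl_ops_scal simp del: scal_simps)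
      then show "?f s \<in> gl_ops m"
        unfolding gl.E_def scal_of_int scal_simps(1) .
    qed
    then show "of_int (sign \<sigma>) * prod_range ?f 1 (k + 1) \<in> last_ops m"
      unfolding eq using a[OF \<sigma>[of k]] k
      by (intro last_ops_mult gl_ops_mult gl_ops_scal last_ops_letter) auto
  qed
qed

text \<open>Subsets that avoid \<open>n + 1\<close> give the same operators for both ranks, so only
  minors with \<open>n + 1 \<in> I\<close> survive in the difference.\<close>

lemma capelli_diff_in_last_ops: "gl.capelli k (n + 1) - gl.capelli k n \<in> last_ops (n + 1)"
proof -
  let ?S = "\<lambda>n. {I. I \<subseteq> {1..n} \<and> card I = k}"
  have sub: "?S n \<subseteq> ?S (n + 1)" by auto
  have fin: "finite (?S (n + 1))" by simp
  have "gl.capelli k (n + 1) - gl.capelli k n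
      = (\<Sum>I\<in>?S (n + 1) - ?S n. gl.minor k (gl.nth_elem I) (gl.nth_elem I))"
    unfolding gl.capelli_def by (rule sum_diff[OF fin sub, symmetric])
  also have "\<dots> \<in> last_ops (n + 1)"
  proof (rule last_ops_sum)
    fix I assume I: "I \<in> ?S (n + 1) - ?S n"
    have "n + 1 \<in> I"
    proof (rule ccontr)
      assume "n + 1 \<notin> I"
      then have "I \<subseteq> {1..n}" using I by (auto simp: subset_iff le_Suc_eq)
      then show False using I by auto
    qed
    then show "gl.minor k (gl.nth_elem I) (gl.nth_elem I) \<in> last_ops (n + 1)"
      using I by (intro minor_in_last_ops) auto
  qed
  finally show ?thesis .
qed


section \<open>The Olshanski projection\<close>

text \<open>Stated as a relation so that it can be followed through sums and products before
  anything is known about the projection; \<open>olshanski_spec\<close> and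
  \<open>olshanski_eqI\<close> identify it with the graph of the projection on the centres.\<close>

definition proj_rel :: "nat \<Rightarrow> op \<Rightarrow> op \<Rightarrow> bool" where
  "proj_rel n a b \<longleftrightarrow> a \<in> capelli_alg (n + 1) \<and> b \<in> capelli_alg n \<and> a - b \<in> last_ops (n + 1)"

lemma proj_rel_scal: "proj_rel n (scal c) (scal c)"
  by (simp add: proj_rel_def capelli_alg.scal last_ops_zero)

lemma proj_rel_capelli: "k \<in> {1..n} \<Longrightarrow> proj_rel n (gl.capelli k (n + 1)) (gl.capelli k n)"
  using capelli_diff_in_last_ops by (auto simp: proj_rel_def intro!: capelli_alg.capelli)

text \<open>For gl(n) the Capelli sum of index \<open>n + 1\<close> is empty.\<close>

lemma proj_rel_capelli_last: "proj_rel n (gl.capelli (n + 1) (n + 1)) 0"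
proof -
  have "card I \<noteq> n + 1" if "I \<subseteq> {1..n}" for I
    using card_mono[OF finite_atLeastAtMost that] by simp
  then have "{I. I \<subseteq> {1..n} \<and> card I = n + 1} = {}" by blast
  then have "gl.capelli (n + 1) n = 0" by (simp only: gl.capelli_def sum.empty)
  then have "gl.capelli (n + 1) (n + 1) \<in> last_ops (n + 1)"
    using capelli_diff_in_last_ops[of "n + 1" n] by simp
  moreover have "gl.capelli (n + 1) (n + 1) \<in> capelli_alg (n + 1)"
    by (rule capelli_alg.capelli) simp
  ultimately show ?thesis
    using capelli_alg.scal[of 0 n] by (simp add: proj_rel_def)
qed

lemma proj_rel_add:
  assumes "proj_rel n a b" "proj_rel n a' b'"
  shows "proj_rel n (a + a') (b + b')"
  using assms last_ops_add[of "a - b" "n + 1" "a' - b'"]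
  by (auto simp: proj_rel_def algebra_simps intro: capelli_alg.add)

lemma proj_rel_mult:
  assumes "proj_rel n a b" "proj_rel n a' b'"
  shows "proj_rel n (a * a') (b * b')"
proof -
  have in_alg: "a \<in> capelli_alg (n + 1)" "a' \<in> capelli_alg (n + 1)" "b \<in> capelli_alg n" "b' \<in> capelli_alg n"
    and diff: "a - b \<in> last_ops (n + 1)" "a' - b' \<in> last_ops (n + 1)"
    using assms by (auto simp: proj_rel_def)
  have "a * a' - b * b' = (a - b) * a' + b * (a' - b')"
    by (simp add: algebra_simps)
  \<comment> \<open>Centrality of \<open>a'\<close> brings \<open>a - b\<close> to the right, where
    the left ideal absorbs the other factor.\<close>
  also have "(a - b) * a' = a' * (a - b)"
    using capelli_alg_commute[OF in_alg(2) last_ops_gl_ops[OF diff(1)]] by simp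
  also have "a' * (a - b) + b * (a' - b') \<in> last_ops (n + 1)"
    using in_alg diff
    by (intro last_ops_add last_ops_mult) (auto intro: capelli_alg_gl_ops gl_ops_mono[unfolded Suc_eq_plus1[symmetric]])
  finally show ?thesis
    using in_alg by (simp add: proj_rel_def capelli_alg.mult)
qed

lemma proj_rel_left_total: "a \<in> capelli_alg (n + 1) \<Longrightarrow> \<exists>b. proj_rel n a b"
proof (induction rule: capelli_alg.induct)
  case (capelli k)
  then consider "k \<in> {1..n}" | "k = n + 1" by fastforce
  then show ?case using proj_rel_capelli proj_rel_capelli_last by cases blast+
qed (use proj_rel_scal proj_rel_add proj_rel_mult in blast)+

lemma proj_rel_right_total: "b \<in> capelli_alg n \<Longrightarrow> \<exists>a. proj_rel n a b"
  by (induction rule: capelli_alg.induct)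
    (use proj_rel_scal proj_rel_add proj_rel_mult proj_rel_capelli in blast)+

text \<open>
  With \<open>y\<^sub>n\<^sub>+\<^sub>1 = 0\<close> the left ideal kills the constant polynomial 1, while the
  subalgebra \<open>U(gl(n))\<close> still acts on 1 without annihilator.
\<close>

definition cut :: "nat \<Rightarrow> nat \<Rightarrow> complex" where
  "cut n j = (if j \<le> n then 1 else 0)"

text \<open>The column index of a letter of gl(n) is at most \<open>n\<close>, where
  \<open>cut n\<close> equals 1.\<close>

lemma phi_cut:
  assumes "X \<in> carrier (U_gl n)"
  shows "phi (cut n) X = phi1 X"
proof -
  obtain f where f: "f \<in> carrier (Fgl n)" "X = cls n f" using assms by (rule U_cases)
  have "map (letter_op (cut n)) w = map gl_op w" if "f w \<noteq> 0" for w
  proof (rule map_cong[OF refl])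
    fix l assume "l \<in> set w"
    then have "l \<in> gl_letters n" using that f(1) by (auto simp: free_algebra_carrier)
    then show "letter_op (cut n) l = gl_op l"
      by (auto simp: letter_op_def cut_def gl_letters_def)
  qed
  then have "rho (cut n) f = rho1 f"
    unfolding ext_def by (intro sum.cong refl arg_cong2[of _ _ _ _ "(*)"] arg_cong[of _ _ prod_list]) auto
  then show ?thesis by (simp add: f phi_cls)
qed

text \<open>The annihilator of a vector is a left ideal. A generator kills 1 because its derivation
  does and \<open>cut n (n + 1) = 0\<close> removes its multiplication part.\<close>

lemma last_ideal_kills_one:
  assumes "Z \<in> last_ideal (n + 1)"
  shows "app (phi (cut n) Z) 1 = 0"
proof -
  interpret U: ring "U_gl (n + 1)" by (rule ring_U_gl)
  let ?L = "{Z \<in> carrier (U_gl (n + 1)). app (phi (cut n) Z) 1 = 0}"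
  have "left_ideal ?L (U_gl (n + 1))"
    unfolding left_ideal_def
  proof (intro conjI ballI additive_subgroup.intro U.add.subgroupI)
    show "?L \<noteq> {}" using U.zero_closed phi_zero[of "cut n" "n + 1"] by fastforce
  next
    fix X assume "X \<in> ?L"
    then show "\<ominus>\<^bsub>U_gl (n + 1)\<^esub> X \<in> ?L"
      by (simp add: phi_uminus del: One_nat_def)
  qed (auto simp: phi_add phi_mult simp del: One_nat_def)
  moreover have "gen (n + 1) i (n + 1) \<in> ?L" if "i \<in> {1..n + 1}" for i
  proof -
    have "(i, n + 1) \<in> gl_letters (n + 1)" using that by (simp add: gl_letters_def)
    then show ?thesis
      using gen_closed[of i "n + 1" "n + 1"] phi_gen[of i "n + 1" "n + 1" "cut n"] by (simp add: cut_def)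
  qed
  ultimately have "last_ideal (n + 1) \<subseteq> ?L" by (rule last_ideal_minimal)
  then show ?thesis using assms by blast
qed

text \<open>This is the directness of the sum: under \<open>phi (cut n)\<close> all three elements
  have the same value at 1, and on U(gl(n)) that value determines the element.\<close>

lemma last_ideal_unique:
  assumes X: "X \<in> carrier (U_gl (n + 1))" and Y: "Y \<in> carrier (U_gl n)" "Z \<in> carrier (U_gl n)"
    and "X \<ominus>\<^bsub>U_gl (n + 1)\<^esub> U_incl n Y \<in> last_ideal (n + 1)" "X \<ominus>\<^bsub>U_gl (n + 1)\<^esub> U_incl n Z \<in> last_ideal (n + 1)"
  shows "Y = Z"
proof (rule phi_one_inj[OF Y])
  have "app (phi (cut n) X) 1 = app (phi1 V) 1"
    if V: "V \<in> carrier (U_gl n)" "X \<ominus>\<^bsub>U_gl (n + 1)\<^esub> U_incl n V \<in> last_ideal (n + 1)" for V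
    using last_ideal_kills_one[OF V(2)] phi_minus[OF X U_incl_closed[OF V(1)], of "cut n"]
      phi_incl[OF V(1), of "cut n"] phi_cut[OF V(1)] by simp
  from this[OF Y(1) assms(4)] this[OF Y(2) assms(5)]
  show "app (phi1 Y) 1 = app (phi1 Z) 1" by simp
qed

lemma last_ideal_if_last_ops:
  assumes "X \<in> carrier (U_gl m)" "phi1 X \<in> last_ops m"
  shows "X \<in> last_ideal m"
proof -
  obtain Z where Z: "Z \<in> last_ideal m" "phi1 X = phi1 Z"
    using assms(2) unfolding last_ops_def by blast
  then have "X = Z" using assms(1) last_ideal_carrier by (intro phi1_inj[of _ m]) auto
  then show ?thesis using Z(1) by simp
qed

text \<open>The matrix unit of the last diagonal entry commutes with gl(n); this gives the
  centralizer half of membership in \<open>I0\<close>.\<close>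

lemma U_incl_commutes_last:
  assumes "Y \<in> carrier (U_gl n)"
  shows "phi1 Y * gl_op (n + 1, n + 1) = gl_op (n + 1, n + 1) * phi1 Y"
proof -
  have "phi1 Y \<in> gl_ops n" using assms by (auto simp: gl_ops_def)
  moreover have "commutator (gl_op l) (gl_op (n + 1, n + 1)) = 0" if "l \<in> gl_letters n" for l
    using that letter_op_commutator[of "\<lambda>_. 1" "fst l" "snd l" "n + 1" "n + 1"]
    by (auto simp: commutator_def gl_letters_def)
  ultimately show ?thesis
    using gl_ops_commute[of n "gl_op (n + 1, n + 1)" "phi1 Y"] rho.s_comm by metis
qed

text \<open>The difference lies in the left ideal by \<open>proj_rel\<close>, and in the centralizer
  because both the central \<open>X\<close> and the elements of U(gl(n)) commute with the last
  diagonal unit. Uniqueness is \<open>last_ideal_unique\<close>.\<close>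

lemma olshanski_eqI:
  assumes X: "X \<in> zeta (n + 1)" and Y: "Y \<in> zeta n" and rel: "proj_rel n (phi1 X) (phi1 Y)"
  shows "olshanski n X = Y"
proof -
  let ?g = "gen (n + 1) (n + 1) (n + 1)" and ?U = "U_gl (n + 1)"
  interpret U: ring ?U by (rule ring_U_gl)
  have Xc: "X \<in> carrier ?U" and Yc: "Y \<in> carrier (U_gl n)"
    using X Y by (auto simp: zeta_iff)
  have l: "(n + 1, n + 1) \<in> gl_letters (n + 1)" by (simp add: gl_letters_def)
  have g: "?g \<in> carrier ?U" using gen_closed[OF l] .
  have X0: "X \<in> U0 (n + 1)"
    using X g by (simp add: U0_def centralizer_def zeta_def)
  let ?D = "X \<ominus>\<^bsub>?U\<^esub> U_incl n Y"
  have D: "?D \<in> carrier ?U" by (rule U.minus_closed[OF Xc U_incl_closed[OF Yc]])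
  have pD: "phi1 ?D = phi1 X - phi1 Y"
    using phi_minus[OF Xc U_incl_closed[OF Yc]] phi_incl[OF Yc] by simp
  have "?D \<in> last_ideal (n + 1)"
    using last_ideal_if_last_ops[OF D, unfolded pD] rel by (simp add: proj_rel_def)
  moreover have "?D \<in> U0 (n + 1)"
  proof -
    have "phi1 X * gl_op (n + 1, n + 1) = gl_op (n + 1, n + 1) * phi1 X"
      using rel gl_ops_letter[OF l] by (intro capelli_alg_commute) (auto simp: proj_rel_def)
    then have "phi1 (?D \<otimes>\<^bsub>?U\<^esub> ?g) = phi1 (?g \<otimes>\<^bsub>?U\<^esub> ?D)"
      unfolding phi_mult[OF D g] phi_mult[OF g D] pD phi_gen[OF l]
      using U_incl_commutes_last[OF Yc] by (simp add: algebra_simps)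
    then have "?D \<otimes>\<^bsub>?U\<^esub> ?g = ?g \<otimes>\<^bsub>?U\<^esub> ?D"
      by (rule phi1_inj[OF U.m_closed[OF D g] U.m_closed[OF g D]])
    then show ?thesis using D by (simp add: U0_def centralizer_def)
  qed
  ultimately have I0: "?D \<in> I0 (n + 1)" by (simp add: I0_def last_ideal_def)
  have "(THE y. y \<in> carrier (U_gl n) \<and> X \<ominus>\<^bsub>?U\<^esub> U_incl n y \<in> I0 (n + 1)) = Y"
  proof (rule the_equality)
    show "Y \<in> carrier (U_gl n) \<and> ?D \<in> I0 (n + 1)" using Yc I0 by simp
    fix Z assume "Z \<in> carrier (U_gl n) \<and> X \<ominus>\<^bsub>?U\<^esub> U_incl n Z \<in> I0 (n + 1)"
    then show "Z = Y"
      using last_ideal_unique[OF Xc _ Yc] I0 by (simp add: I0_def last_ideal_def)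
  qed
  then show ?thesis using X0 by (simp add: olshanski_def)
qed

lemma olshanski_spec:
  assumes "X \<in> zeta (n + 1)"
  shows "olshanski n X \<in> zeta n" "proj_rel n (phi1 X) (phi1 (olshanski n X))"
proof -
  obtain b where b: "proj_rel n (phi1 X) b"
    using proj_rel_left_total assms unfolding zeta_iff by blast
  then obtain Y where Y: "Y \<in> zeta n" "phi1 Y = b"
    using zeta_lift unfolding proj_rel_def by blast
  have "olshanski n X = Y"
    using olshanski_eqI[OF assms Y(1)] b Y(2) by simp
  then show "olshanski n X \<in> zeta n" "proj_rel n (phi1 X) (phi1 (olshanski n X))"
    using Y b by auto
qed

text \<open>Each identity comes from \<open>olshanski_eqI\<close>, since \<open>proj_rel\<close>
  respects the operation in question; surjectivity is the right totality of
  \<open>proj_rel\<close>.\<close>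

lemma olshanski_zeta_epi: "zeta_epi n (olshanski_zeta n)"
proof -
  let ?m = "olshanski n" and ?f = "olshanski_zeta n"
  have f: "?f X = ?m X" if "X \<in> zeta (n + 1)" for X
    using that by (simp add: olshanski_zeta_def)
  note spec = olshanski_spec
  have carr: "X \<in> zeta k \<Longrightarrow> X \<in> carrier (U_gl k)" for X k by (simp add: zeta_iff)
  have mult: "?m (X \<otimes>\<^bsub>U_gl (n + 1)\<^esub> Y) = ?m X \<otimes>\<^bsub>U_gl n\<^esub> ?m Y"
    and add: "?m (X \<oplus>\<^bsub>U_gl (n + 1)\<^esub> Y) = ?m X \<oplus>\<^bsub>U_gl n\<^esub> ?m Y"
    if X: "X \<in> zeta (n + 1)" and Y: "Y \<in> zeta (n + 1)" for X Y
    using proj_rel_mult[OF spec(2)[OF X] spec(2)[OF Y]] proj_rel_add[OF spec(2)[OF X] spec(2)[OF Y]]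
      phi_mult[OF carr[OF X] carr[OF Y]] phi_mult[OF carr[OF spec(1)[OF X]] carr[OF spec(1)[OF Y]]]
      phi_add[OF carr[OF X] carr[OF Y]] phi_add[OF carr[OF spec(1)[OF X]] carr[OF spec(1)[OF Y]]]
      zeta_closed[OF X Y] zeta_closed[OF spec(1)[OF X] spec(1)[OF Y]]
    by (intro olshanski_eqI; simp)+
  have one: "?m \<one>\<^bsub>U_gl (n + 1)\<^esub> = \<one>\<^bsub>U_gl n\<^esub>"
    using proj_rel_scal[of n 1] by (intro olshanski_eqI one_in_zeta) (simp add: phi_one)
  have smult: "?m (U_smult (n + 1) c X) = U_smult n c (?m X)" if X: "X \<in> zeta (n + 1)" for c X
    using proj_rel_mult[OF proj_rel_scal spec(2)[OF X], of c] phi_smult[OF carr[OF X], of "\<lambda>_. 1" c]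
      phi_smult[OF carr[OF spec(1)[OF X]], of "\<lambda>_. 1" c]
      zeta_closed(3)[OF X X] zeta_closed(3)[OF spec(1)[OF X] spec(1)[OF X]]
    by (intro olshanski_eqI) simp_all
  have "\<exists>X\<in>zeta (n + 1). ?m X = Y" if Y: "Y \<in> zeta n" for Y
  proof -
    obtain a where a: "proj_rel n a (phi1 Y)"
      using proj_rel_right_total Y unfolding zeta_iff by blast
    then obtain X where "X \<in> zeta (n + 1)" "phi1 X = a"
      using zeta_lift unfolding proj_rel_def by blast
    then show ?thesis using olshanski_eqI[OF _ Y] a by blast
  qed
  then have surj: "?f ` zeta (n + 1) = zeta n"
    using spec(1) by (force simp: f image_iff)
  have "?f \<in> ring_hom (U_gl (n + 1)\<lparr>carrier := zeta (n + 1)\<rparr>) (U_gl n\<lparr>carrier := zeta n\<rparr>)"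
    by (rule ring_hom_memI) (simp_all add: f spec(1) zeta_closed one_in_zeta mult add one del: One_nat_def)
  then show ?thesis
    unfolding zeta_epi_def using surj by (simp add: f smult zeta_closed(3) del: One_nat_def)
qed

text \<open>Induction over \<open>capelli_alg\<close>: injectivity of \<open>phi1\<close> turns each
  way of building the operator into the same way of building the central element.\<close>

lemma zeta_epi_unique:
  assumes f: "zeta_epi n f" and g: "zeta_epi n g"
    and eq: "\<And>k. k \<in> {1..n + 1} \<Longrightarrow> f (Capelli k (n + 1)) = g (Capelli k (n + 1))"
    and X: "X \<in> zeta (n + 1)"
  shows "f X = g X"
proof -
  let ?U = "U_gl (n + 1)"
  interpret U: ring ?U by (rule ring_U_gl)
  have hmult: "h (X \<otimes>\<^bsub>?U\<^esub> Y) = h X \<otimes>\<^bsub>U_gl n\<^esub> h Y" and hadd: "h (X \<oplus>\<^bsub>?U\<^esub> Y) = h X \<oplus>\<^bsub>U_gl n\<^esub> h Y"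
    if "zeta_epi n h" "X \<in> zeta (n + 1)" "Y \<in> zeta (n + 1)" for h X Y
    using that unfolding zeta_epi_def ring_hom_def by auto
  have hone: "h \<one>\<^bsub>?U\<^esub> = \<one>\<^bsub>U_gl n\<^esub>" and hsmult: "h (U_smult (n + 1) c \<one>\<^bsub>?U\<^esub>) = U_smult n c (h \<one>\<^bsub>?U\<^esub>)"
    if "zeta_epi n h" for h c
    using that one_in_zeta[of "n + 1"] unfolding zeta_epi_def ring_hom_def by auto
  have main: "a \<in> capelli_alg (n + 1) \<Longrightarrow> \<forall>X\<in>zeta (n + 1). phi1 X = a \<longrightarrow> f X = g X" for a
  proof (induction rule: capelli_alg.induct)
    case (scal c)
    show ?case
    proof (intro ballI impI)
      fix X assume X: "X \<in> zeta (n + 1)" "phi1 X = scal c"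
      have "X = U_smult (n + 1) c \<one>\<^bsub>?U\<^esub>"
        using X by (intro phi1_inj[of _ "n + 1"]) (auto simp: zeta_iff phi_smult phi_one U_smult_closed simp del: One_nat_def)
      then show "f X = g X"
        by (simp only: hsmult[OF f] hsmult[OF g] hone[OF f] hone[OF g])
    qed
  next
    case (capelli k)
    show ?case
    proof (intro ballI impI)
      fix X assume X: "X \<in> zeta (n + 1)" "phi1 X = gl.capelli k (n + 1)"
      have "X = Capelli k (n + 1)"
        using X phi_Capelli[of k "n + 1"] by (intro phi1_inj[of _ "n + 1"]) (auto simp: zeta_iff)
      then show "f X = g X" using eq[OF capelli] by simp
    qed
  next
    case (add a b)
    obtain A B where AB: "A \<in> zeta (n + 1)" "phi1 A = a" "B \<in> zeta (n + 1)" "phi1 B = b"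
      using zeta_lift[OF add.hyps(1)] zeta_lift[OF add.hyps(2)] by metis
    have IH: "f A = g A" "f B = g B" using add.IH AB by auto
    show ?case
    proof (intro ballI impI)
      fix X assume X: "X \<in> zeta (n + 1)" "phi1 X = a + b"
      have "X = A \<oplus>\<^bsub>?U\<^esub> B"
        using X AB by (intro phi1_inj[of _ "n + 1"]) (auto simp: zeta_iff phi_add simp del: One_nat_def)
      then show "f X = g X"
        by (simp only: hadd[OF f AB(1,3)] hadd[OF g AB(1,3)] IH)
    qed
  next
    case (mult a b)
    obtain A B where AB: "A \<in> zeta (n + 1)" "phi1 A = a" "B \<in> zeta (n + 1)" "phi1 B = b"
      using zeta_lift[OF mult.hyps(1)] zeta_lift[OF mult.hyps(2)] by metis
    have IH: "f A = g A" "f B = g B" using mult.IH AB by auto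
    show ?case
    proof (intro ballI impI)
      fix X assume X: "X \<in> zeta (n + 1)" "phi1 X = a * b"
      have "X = A \<otimes>\<^bsub>?U\<^esub> B"
        using X AB by (intro phi1_inj[of _ "n + 1"]) (auto simp: zeta_iff phi_mult simp del: One_nat_def)
      then show "f X = g X"
        by (simp only: hmult[OF f AB(1,3)] hmult[OF g AB(1,3)] IH)
    qed
  qed
  have "phi1 X \<in> capelli_alg (n + 1)" using X by (simp only: zeta_iff)
  from main[OF this] X show ?thesis by simp
qed

theorem proposition5p6:
  fixes n :: nat
  assumes "n \<ge> 1"
  shows "olshanski_zeta n = capelli_proj n"
proof -
  let ?P = "\<lambda>f. f \<in> extensional (zeta (n + 1)) \<and> zeta_epi n f \<and>
     (\<forall>k\<in>{1..n}. f (Capelli k (n + 1)) = Capelli k n) \<and> f (Capelli (n + 1) (n + 1)) = \<zero>\<^bsub>U_gl n\<^esub>"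
  have "olshanski_zeta n (Capelli k (n + 1)) = Capelli k n" if k: "k \<in> {1..n}" for k
  proof -
    have z: "Capelli k (n + 1) \<in> zeta (n + 1)" using k by (intro Capelli_in_zeta) auto
    then have "olshanski n (Capelli k (n + 1)) = Capelli k n"
      using olshanski_eqI[OF z Capelli_in_zeta[OF k]] proj_rel_capelli[OF k] phi_Capelli by metis
    then show ?thesis using z by (simp add: olshanski_zeta_def)
  qed
  moreover have "olshanski_zeta n (Capelli (n + 1) (n + 1)) = \<zero>\<^bsub>U_gl n\<^esub>"
  proof -
    have z: "Capelli (n + 1) (n + 1) \<in> zeta (n + 1)" by (intro Capelli_in_zeta) auto
    then have "olshanski n (Capelli (n + 1) (n + 1)) = \<zero>\<^bsub>U_gl n\<^esub>"
      using olshanski_eqI[OF z zero_in_zeta] proj_rel_capelli_last phi_Capelli phi_zero by metis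
    then show ?thesis using z by (simp add: olshanski_zeta_def)
  qed
  \<comment> \<open>This is the existence half for the \<open>THE\<close>; what remains is that no
    other map has these properties.\<close>
  ultimately have P: "?P (olshanski_zeta n)"
    using olshanski_zeta_epi by (auto simp: olshanski_zeta_def)
  have "f = olshanski_zeta n" if f: "?P f" for f
  proof (rule extensionalityI[of _ "zeta (n + 1)"])
    have "f (Capelli k (n + 1)) = olshanski_zeta n (Capelli k (n + 1))" if "k \<in> {1..n + 1}" for k
    proof (cases "k = n + 1")
      case False
      then have "k \<in> {1..n}" using that by auto
      then show ?thesis using f P by metis
    qed (use f P in simp)
    then show "f X = olshanski_zeta n X" if "X \<in> zeta (n + 1)" for X
      using zeta_epi_unique[of n f "olshanski_zeta n" X] f P that by blast
  qed (use f P in blast)+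
  then show ?thesis
    unfolding capelli_proj_def using P by (intro the_equality[symmetric]) blast+
qed

end
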